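(* Let $\lambda_0\in\mathbb{R}$ and $t_0\in(0,1)$, and assume: (i) $\lambda_0\notin\operatorname{Spec}_{\mathrm{ess}}(\mathcal{N}_{t_0}+V_{t_0})$; (ii) $\dim\ker(\mathcal{N}_{t_0}+V_{t_0}-\lambda_0)=g$ with basis $\{\mathbf{u}_{t_0}^{(1)},\dots,\mathbf{u}_{t_0}^{(g)}\}$; and that there is an interval $\mathcal{I}\subset[0,1]$ containing $t_0$ in its interior such that (iii) the mappings $t\mapsto V_t$, $t\mapsto P_t$, $t\mapsto Q_t$, $t\mapsto\mathrm{T}_t$ are $C^2$ on $\mathcal{I}$; (iv) $\ker\big((N^*+V_t^*-\lambda)\tau\big)\cap\operatorname{dom}(\tau N)=\{0\}$ for all $t\in\mathcal{I}$ and all real $\lambda$ near $\lambda_0$. Then there exists a $g\times g$ matrix $M(\lambda,t)$, defined for real $(\lambda,t)$ near $(\lambda_0,t_0)$, such that $\lambda\in\operatorname{Spec}(\mathcal{N}_t+V_t)$ if and only if $\det M(\lambda,t)=0$. This matrix satisfies $M(\lambda_0,t_0)=0$ and, for $i,j=1,\dots,g$, $$\frac{\partial M_{ji}}{\partial t}(\lambda_0,t_0)=\big\langle\tau\dot V_{t_0}\mathbf{u}_{t_0}^{(i)},\mathbf{u}_{t_0}^{(j)}\big\rangle_{\mathcal{H}^2}+\Omega\big((\dot P_{t_0}\oplus\dot Q_{t_0})\mathrm{T}_{t_0}\mathbf{u}_{t_0}^{(i)},\mathrm{T}_{t_0}\mathbf{u}_{t_0}^{(j)}\big)+\Omega\big(\mathrm{T}_{t_0}\mathbf{u}_{t_0}^{(i)},\dot{\mathrm{T}}_{t_0}\mathbf{u}_{t_0}^{(j)}\big),$$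 $$\frac{\partial M_{ji}}{\partial\lambda}(\lambda_0,t_0)=-\big\langle\tau\mathbf{u}_{t_0}^{(i)},\mathbf{u}_{t_0}^{(j)}\big\rangle_{\mathcal{H}^2}.$$
   Context: $\mathcal{H},\mathfrak{H}$ are separable complex Hilbert spaces. $A$ is a closed, densely defined, symmetric linear operator in $\mathcal{H}$ with $\dim\ker(A^*+i)=\dim\ker(A^*-i)<\infty$. $\mathcal{H}_+:=\operatorname{dom}(A^* )$ carries the graph scalar product of $A^*$. Put $\mathcal{H}^2=\mathcal{H}\times\mathcal{H}$, $\mathcal{H}_+^2=\mathcal{H}_+\times\mathcal{H}_+$, $\mathfrak{H}^2=\mathfrak{H}\times\mathfrak{H}$, $\mathfrak{H}^4=\mathfrak{H}^2\times\mathfrak{H}^2$, and $$N=\begin{pmatrix}0&-A\\ A&0\end{pmatrix},\ \operatorname{dom}N=\operatorname{dom}A\times\operatorname{dom}A,\qquad N^*=\begin{pmatrix}0&A^*\\ -A^*&0\end{pmatrix},\ \operatorname{dom}N^*=\mathcal{H}_+^2,\qquad \tau=\begin{pmatrix}0&I_{\mathcal{H}}\\ I_{\mathcal{H}}&0\end{pmatrix},$$ $$J=\begin{pmatrix}0&I_{\mathfrak{H}}\\ -I_{\mathfrak{H}}&0\end{pmatrix}\ \text{on }\mathfrak{H}^2,\qquad \mathcal{J}=J\oplus(-J)\ \text{on }\mathfrak{H}^4,\qquad \Omega(f,g)=\langle\mathcal{J}f,g\rangle_{\mathfrak{H}^4}.$$ A subspace of $\mathfrak{H}^2$ is Lagrangian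 if it equals its annihilator with respect to $\omega(f,g)=\langle Jf,g\rangle_{\mathfrak{H}^2}$. $X\oplus Y$ denotes the block diagonal operator on $\mathfrak{H}^4=\mathfrak{H}^2\times\mathfrak{H}^2$. Standing assumptions on one-parameter families, $t\in[0,1]$: (a) $\operatorname{tr}_t=(\Gamma_{0,t},\Gamma_{1,t})^\top\in\mathcal{B}(\mathcal{H}_+,\mathfrak{H}^2)$ is surjective and satisfies $\langle A^*u,v\rangle_{\mathcal{H}}-\langle u,A^*v\rangle_{\mathcal{H}}=\langle\Gamma_{1,t}u,\Gamma_{0,t}v\rangle_{\mathfrak{H}}-\langle\Gamma_{0,t}u,\Gamma_{1,t}v\rangle_{\mathfrak{H}}$ for all $u,v\in\mathcal{H}_+$; $\mathrm{T}_t:=\operatorname{tr}_t\oplus\operatorname{tr}_t\in\mathcal{B}(\mathcal{H}_+^2,\mathfrak{H}^4)$. (b) $P_t,Q_t\in\mathcal{B}(\mathfrak{H}^2)$ are orthogonal projections with Lagrangian ranges. (c) $\mathcal{A}_t,\mathcal{B}_t$ are self-adjoint extensions of $A$ with $\operatorname{tr}_t(\operatorname{dom}\mathcal{A}_t)=\operatorname{ran}P_t$, $\operatorname{tr}_t(\operatorname{dom}\mathcal{B}_t)=\operatorname{ran}Q_t$, and $\mathcal{N}_t=\begin{pmatrix}0&-\mathcal{B}_t\\ \mathcal{A}_t&0\end{pmatrix}$ with $\operatorname{dom}\mathcal{N}_t=\operatorname{dom}\mathcal{A}_t\times\operatorname{dom}\mathcal{B}_t$. (d) $F_t,G_t\in\mathcal{B}(\mathcal{H})$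 are self-adjoint and $V_t=\begin{pmatrix}0&-G_t\\ F_t&0\end{pmatrix}\in\mathcal{B}(\mathcal{H}^2)$. Regularity of $V_t,\mathrm{T}_t,P_t,Q_t$ is in operator norm (with $\mathrm{T}_t\in\mathcal{B}(\mathcal{H}_+^2,\mathfrak{H}^4)$); the dot denotes $d/dt$. $\operatorname{Spec}_{\mathrm{ess}}(\mathcal{N}_t+V_t)$ is the set of $\lambda$ for which $\mathcal{N}_t+V_t-\lambda$ is not Fredholm. *)

theory Defs
  imports "HOL-Analysis.Analysis" "Jordan_Normal_Form.Determinant"
begin

section \<open>Complex Hilbert spaces\<close>

class scaleC =
  fixes scaleC :: "complex \<Rightarrow> 'a \<Rightarrow> 'a"  (infixr "*\<^sub>C" 75)

text \<open>The norm is the one of the real Banach space structure; the inner product is linear in its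
  first argument.\<close>

class complex_hilbert = scaleC + banach +
  fixes cinner :: "'a \<Rightarrow> 'a \<Rightarrow> complex"
  assumes scaleC_add_right: "a *\<^sub>C (x + y) = a *\<^sub>C x + a *\<^sub>C y"
    and scaleC_add_left: "(a + b) *\<^sub>C x = a *\<^sub>C x + b *\<^sub>C x"
    and scaleC_scaleC: "a *\<^sub>C (b *\<^sub>C x) = (a * b) *\<^sub>C x"
    and scaleC_one: "1 *\<^sub>C x = x"
    and scaleR_eq_scaleC: "r *\<^sub>R x = complex_of_real r *\<^sub>C x"
    and cinner_commute: "cinner x y = cnj (cinner y x)"
    and cinner_add_left: "cinner (x + y) z = cinner x z + cinner y z"
    and cinner_scaleC_left: "cinner (a *\<^sub>C x) y = a * cinner x y"
    and norm_eq_sqrt_cinner: "norm x = sqrt (Re (cinner x x))"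

global_interpretation complex_vs: vector_space "scaleC :: complex \<Rightarrow> 'a \<Rightarrow> 'a :: complex_hilbert"
  defines csubspace = complex_vs.subspace
    and cspan = complex_vs.span
    and cdependent = complex_vs.dependent
    and cdim = complex_vs.dim
  by unfold_locales
    (simp_all add: scaleC_add_right scaleC_add_left scaleC_scaleC scaleC_one)

lemma cinner_self_nonneg: "0 \<le> Re (cinner x x)" for x :: "'a :: complex_hilbert"
  using norm_ge_zero[of x] unfolding norm_eq_sqrt_cinner by simp

instantiation prod :: (complex_hilbert, complex_hilbert) complex_hilbert
begin

definition scaleC_prod :: "complex \<Rightarrow> 'a \<times> 'b \<Rightarrow> 'a \<times> 'b"
  where "scaleC_prod a x = (a *\<^sub>C fst x, a *\<^sub>C snd x)"

definition cinner_prod :: "'a \<times> 'b \<Rightarrow> 'a \<times> 'b \<Rightarrow> complex"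
  where "cinner_prod x y = cinner (fst x) (fst y) + cinner (snd x) (snd y)"

instance
proof
  fix a b :: complex and r :: real and x y z :: "'a \<times> 'b"
  show "a *\<^sub>C (x + y) = a *\<^sub>C x + a *\<^sub>C y"
    by (simp add: scaleC_prod_def scaleC_add_right)
  show "(a + b) *\<^sub>C x = a *\<^sub>C x + b *\<^sub>C x"
    by (simp add: scaleC_prod_def scaleC_add_left)
  show "a *\<^sub>C (b *\<^sub>C x) = (a * b) *\<^sub>C x"
    by (simp add: scaleC_prod_def scaleC_scaleC)
  show "1 *\<^sub>C x = x"
    by (simp add: scaleC_prod_def scaleC_one)
  show "r *\<^sub>R x = complex_of_real r *\<^sub>C x"
    by (simp add: scaleC_prod_def scaleR_prod_def scaleR_eq_scaleC)
  show "cinner x y = cnj (cinner y x)"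
    using cinner_commute[of "fst x" "fst y"] cinner_commute[of "snd x" "snd y"]
    by (simp add: cinner_prod_def)
  show "cinner (x + y) z = cinner x z + cinner y z"
    by (simp add: cinner_prod_def cinner_add_left)
  show "cinner (a *\<^sub>C x) y = a * cinner x y"
    by (simp add: cinner_prod_def scaleC_prod_def cinner_scaleC_left distrib_left)
  show "norm x = sqrt (Re (cinner x x))"
    by (simp add: norm_prod_def cinner_prod_def norm_eq_sqrt_cinner cinner_self_nonneg)
qed

end

definition finite_cdim :: "'a :: complex_hilbert set \<Rightarrow> bool"
  where "finite_cdim S \<longleftrightarrow> (\<exists>B. finite B \<and> S \<subseteq> cspan B)"

text \<open>The family is indexed by \<open>0, \<dots>, g - 1\<close>.\<close>

definition is_cbasis :: "nat \<Rightarrow> (nat \<Rightarrow> 'a :: complex_hilbert) \<Rightarrow> 'a set \<Rightarrow> bool"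
  where "is_cbasis g u S \<longleftrightarrow>
    inj_on u {..<g} \<and> \<not> cdependent (u ` {..<g}) \<and> cspan (u ` {..<g}) = S"


section \<open>Unbounded operators\<close>

text \<open>An operator is a domain together with a function of which only the values on the domain
  matter. Equality of this type is therefore never used to compare operators.\<close>

datatype ('a, 'b) oper = Oper (dm: "'a set") (ap: "'a \<Rightarrow> 'b")

definition bdd_oper :: "('a::real_normed_vector \<Rightarrow>\<^sub>L 'b::real_normed_vector) \<Rightarrow> ('a, 'b) oper"
  where "bdd_oper F = Oper UNIV (blinfun_apply F)"

definition oper_plus :: "('a, 'b::plus) oper \<Rightarrow> ('a, 'b) oper \<Rightarrow> ('a, 'b) oper"
  where "oper_plus S T = Oper (dm S \<inter> dm T) (\<lambda>x. ap S x + ap T x)"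

definition oper_shift :: "('a::complex_hilbert, 'a) oper \<Rightarrow> complex \<Rightarrow> ('a, 'a) oper"
  where "oper_shift T z = Oper (dm T) (\<lambda>x. ap T x - z *\<^sub>C x)"

definition oper_comp :: "('b, 'c) oper \<Rightarrow> ('a, 'b) oper \<Rightarrow> ('a, 'c) oper"
  where "oper_comp S T = Oper {x \<in> dm T. ap T x \<in> dm S} (\<lambda>x. ap S (ap T x))"

definition ker :: "('a, 'b::zero) oper \<Rightarrow> 'a set"
  where "ker T = {x \<in> dm T. ap T x = 0}"

definition ran :: "('a, 'b) oper \<Rightarrow> 'b set"
  where "ran T = ap T ` dm T"

definition clinear_on :: "'a::complex_hilbert set \<Rightarrow> ('a \<Rightarrow> 'b::complex_hilbert) \<Rightarrow> bool"
  where "clinear_on D f \<longleftrightarrow> csubspace D \<and>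
    (\<forall>x\<in>D. \<forall>y\<in>D. f (x + y) = f x + f y) \<and> (\<forall>c. \<forall>x\<in>D. f (c *\<^sub>C x) = c *\<^sub>C f x)"

definition lin_oper :: "('a::complex_hilbert, 'b::complex_hilbert) oper \<Rightarrow> bool"
  where "lin_oper T \<longleftrightarrow> clinear_on (dm T) (ap T)"

definition closed_oper :: "('a::complex_hilbert, 'b::complex_hilbert) oper \<Rightarrow> bool"
  where "closed_oper T \<longleftrightarrow> closed {(x, ap T x) | x. x \<in> dm T}"

definition densely_defined :: "('a::complex_hilbert, 'b) oper \<Rightarrow> bool"
  where "densely_defined T \<longleftrightarrow> closure (dm T) = UNIV"

definition symmetric_oper :: "('a::complex_hilbert, 'a) oper \<Rightarrow> bool"
  where "symmetric_oper T \<longleftrightarrow> (\<forall>x\<in>dm T. \<forall>y\<in>dm T. cinner (ap T x) y = cinner x (ap T y))"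

text \<open>For densely defined \<open>T\<close> the vector \<open>w\<close> below is unique.\<close>

definition adj :: "('a::complex_hilbert, 'b::complex_hilbert) oper \<Rightarrow> ('b, 'a) oper"
  where "adj T = Oper {v. \<exists>w. \<forall>u\<in>dm T. cinner (ap T u) v = cinner u w}
    (\<lambda>v. THE w. \<forall>u\<in>dm T. cinner (ap T u) v = cinner u w)"

definition self_adjoint :: "('a::complex_hilbert, 'a) oper \<Rightarrow> bool"
  where "self_adjoint T \<longleftrightarrow> lin_oper T \<and> densely_defined T \<and>
    dm (adj T) = dm T \<and> (\<forall>x\<in>dm T. ap (adj T) x = ap T x)"

definition extends :: "('a, 'b) oper \<Rightarrow> ('a, 'b) oper \<Rightarrow> bool"
  where "extends S T \<longleftrightarrow> dm T \<subseteq> dm S \<and> (\<forall>x\<in>dm T. ap S x = ap T x)"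

definition fredholm :: "('a::complex_hilbert, 'b::complex_hilbert) oper \<Rightarrow> bool"
  where "fredholm T \<longleftrightarrow> finite_cdim (ker T) \<and> closed (ran T) \<and>
    (\<exists>B. finite B \<and> cspan (ran T \<union> B) = UNIV)"

definition Spec_ess :: "('a::complex_hilbert, 'a) oper \<Rightarrow> complex set"
  where "Spec_ess T = {z. \<not> fredholm (oper_shift T z)}"

definition resolvent_set :: "('a::complex_hilbert, 'a) oper \<Rightarrow> complex set"
  where "resolvent_set T = {z. \<exists>R :: 'a \<Rightarrow>\<^sub>L 'a.
    (\<forall>y. R y \<in> dm T \<and> ap (oper_shift T z) (R y) = y) \<and>
    (\<forall>x\<in>dm T. R (ap (oper_shift T z) x) = x)}"

definition Spec :: "('a::complex_hilbert, 'a) oper \<Rightarrow> complex set"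
  where "Spec T = - resolvent_set T"

text \<open>The block operator with rows \<open>(0, -S)\<close> and \<open>(R, 0)\<close>.\<close>

definition offdiag ::
    "('a::complex_hilbert, 'b::complex_hilbert) oper \<Rightarrow> ('b, 'a) oper \<Rightarrow> ('b \<times> 'a, 'b \<times> 'a) oper"
  where "offdiag S R = Oper (dm R \<times> dm S) (\<lambda>(x, y). (- ap S y, ap R x))"

definition tau :: "('a \<times> 'a, 'a \<times> 'a) oper"
  where "tau = Oper UNIV (\<lambda>(x, y). (y, x))"


section \<open>Symplectic forms and Lagrangian subspaces\<close>

definition Jmap :: "'k \<times> 'k \<Rightarrow> 'k \<times> ('k::complex_hilbert)"
  where "Jmap f = (snd f, - fst f)"

definition omega :: "'k \<times> 'k \<Rightarrow> 'k \<times> ('k::complex_hilbert) \<Rightarrow> complex"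
  where "omega f g = cinner (Jmap f) g"

definition Omega :: "('k \<times> 'k) \<times> ('k \<times> 'k) \<Rightarrow> ('k \<times> 'k) \<times> ('k \<times> ('k::complex_hilbert)) \<Rightarrow> complex"
  where "Omega f g = cinner (Jmap (fst f), - Jmap (snd f)) g"

definition lagrangian :: "('k \<times> ('k::complex_hilbert)) set \<Rightarrow> bool"
  where "lagrangian L \<longleftrightarrow> csubspace L \<and> L = {f. \<forall>g\<in>L. omega f g = 0}"

definition orth_proj :: "('a::complex_hilbert \<Rightarrow>\<^sub>L 'a) \<Rightarrow> bool"
  where "orth_proj P \<longleftrightarrow> self_adjoint (bdd_oper P) \<and> P o\<^sub>L P = P"


section \<open>Boundary traces\<close>

text \<open>The space of the trace operators is the domain of the adjoint with its graph scalar
  product; it is represented by a set together with a norm on that set.\<close>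

definition graph_cinner :: "('a::complex_hilbert, 'b::complex_hilbert) oper \<Rightarrow> 'a \<Rightarrow> 'a \<Rightarrow> complex"
  where "graph_cinner T x y = cinner x y + cinner (ap T x) (ap T y)"

definition graph_norm :: "('a::complex_hilbert, 'b::complex_hilbert) oper \<Rightarrow> 'a \<Rightarrow> real"
  where "graph_norm T x = sqrt (Re (graph_cinner T x x))"

definition graph_norm2 :: "('a::complex_hilbert, 'b::complex_hilbert) oper \<Rightarrow> 'a \<times> 'a \<Rightarrow> real"
  where "graph_norm2 T x = sqrt ((graph_norm T (fst x))\<^sup>2 + (graph_norm T (snd x))\<^sup>2)"

definition bounded_op_on ::
    "'a::complex_hilbert set \<Rightarrow> ('a \<Rightarrow> real) \<Rightarrow> ('a \<Rightarrow> 'b::complex_hilbert) \<Rightarrow> bool"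
  where "bounded_op_on D \<nu> f \<longleftrightarrow> clinear_on D f \<and> (\<exists>K. \<forall>x\<in>D. norm (f x) \<le> K * \<nu> x)"

definition trace_op ::
    "('h::complex_hilbert, 'h) oper \<Rightarrow> ('h \<Rightarrow> 'k \<times> ('k::complex_hilbert)) \<Rightarrow> bool"
  where "trace_op A tr \<longleftrightarrow>
    bounded_op_on (dm (adj A)) (graph_norm (adj A)) tr \<and>
    tr ` dm (adj A) = UNIV \<and>
    (\<forall>u\<in>dm (adj A). \<forall>v\<in>dm (adj A).
      cinner (ap (adj A) u) v - cinner u (ap (adj A) v) =
      cinner (snd (tr u)) (fst (tr v)) - cinner (fst (tr u)) (snd (tr v)))"


section \<open>Twice continuously differentiable families of operators\<close>

text \<open>Operators on a whole space carry the norm of the type of bounded linear maps. For operators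
  on a set \<open>D\<close> with norm \<open>\<nu>\<close>, the operator norm is meaningful for bounded operators only.\<close>

definition op_norm_on :: "'a set \<Rightarrow> ('a \<Rightarrow> real) \<Rightarrow> ('a \<Rightarrow> 'b::real_normed_vector) \<Rightarrow> real"
  where "op_norm_on D \<nu> f = (SUP x\<in>D. norm (f x) / \<nu> x)"

definition C2_on ::
    "real set \<Rightarrow> (real \<Rightarrow> 'a::real_normed_vector) \<Rightarrow> (real \<Rightarrow> 'a) \<Rightarrow> bool"
  where "C2_on I f f' \<longleftrightarrow> (\<exists>f''.
    (\<forall>t\<in>I. (f has_vector_derivative f' t) (at t within I)) \<and>
    (\<forall>t\<in>I. (f' has_vector_derivative f'' t) (at t within I)) \<and>
    continuous_on I f'')"

definition has_op_derivative_on ::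
    "'a set \<Rightarrow> ('a \<Rightarrow> real) \<Rightarrow> real set \<Rightarrow> (real \<Rightarrow> 'a \<Rightarrow> 'b::real_normed_vector) \<Rightarrow>
      (real \<Rightarrow> 'a \<Rightarrow> 'b) \<Rightarrow> bool"
  where "has_op_derivative_on D \<nu> I f f' \<longleftrightarrow> (\<forall>t\<in>I.
    ((\<lambda>s. op_norm_on D \<nu> (\<lambda>x. (f s x - f t x) /\<^sub>R (s - t) - f' t x)) \<longlongrightarrow> 0) (at t within I))"

definition C2_op_on ::
    "'a::complex_hilbert set \<Rightarrow> ('a \<Rightarrow> real) \<Rightarrow> real set \<Rightarrow>
      (real \<Rightarrow> 'a \<Rightarrow> 'b::complex_hilbert) \<Rightarrow> (real \<Rightarrow> 'a \<Rightarrow> 'b) \<Rightarrow> bool"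
  where "C2_op_on D \<nu> I f f' \<longleftrightarrow> (\<exists>f''.
    (\<forall>t\<in>I. bounded_op_on D \<nu> (f t) \<and> bounded_op_on D \<nu> (f' t) \<and> bounded_op_on D \<nu> (f'' t)) \<and>
    has_op_derivative_on D \<nu> I f f' \<and>
    has_op_derivative_on D \<nu> I f' f'' \<and>
    (\<forall>t\<in>I. ((\<lambda>s. op_norm_on D \<nu> (\<lambda>x. f'' s x - f'' t x)) \<longlongrightarrow> 0) (at t within I)))"

end

theory Submission
  imports Defs
begin

text \<open>
  Multiplying the coupled operator \<open>\<N>\<^sub>t + V\<^sub>t - \<lambda>\<close> by \<open>\<tau>\<close> changes neither its kernel nor its
  invertibility, and turns it into \<open>S\<^sub>\<lambda>\<^sub>,\<^sub>t (x, y) = (A\<^sup>* x + F\<^sub>t x - \<lambda> y, - A\<^sup>* y - G\<^sub>t y - \<lambda> x)\<close>, which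
  satisfies the Green identity \<open>\<langle>S w, v\<rangle> - \<langle>w, S v\<rangle> = \<Omega>(T w, T v)\<close> on the maximal domain and is
  self-adjoint under the boundary condition \<open>T w \<in> ran R\<^sub>t\<close>, where \<open>R\<^sub>t = P\<^sub>t \<oplus> Q\<^sub>t\<close>. The question is
  therefore for which \<open>(\<lambda>, t)\<close> the boundary value problem \<open>S\<^sub>\<lambda>\<^sub>,\<^sub>t w = f\<close>, \<open>T\<^sub>t w \<in> ran R\<^sub>t\<close> is uniquely
  solvable.

  Let \<open>S\<close>, \<open>T\<close>, \<open>R\<close> denote the objects at the base point \<open>(\<lambda>\<^sub>0, t\<^sub>0)\<close> and \<open>\<Pi>\<close> the orthogonal
  projection onto the kernel \<open>E\<close> spanned by the \<open>u\<^sub>i\<close>. The range of the self-adjoint operator is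
  closed, hence equal to the orthogonal complement of \<open>E\<close>, so that \<open>S + \<Pi>\<close> with the boundary
  condition of \<open>R\<close> is a bijection; its inverse is symmetric and defined everywhere, hence bounded
  (\<open>symmetric_everywhere_imp_bounded\<close>). It follows that the inhomogeneous problem
  \<open>(S + \<Pi>) w = f\<close>, \<open>(1 - R) T w = (1 - R) b\<close> has a solution \<open>w = solve (f, b)\<close> that depends boundedly
  on the data (\<open>solve_bounded\<close>). The variable domains and boundary conditions disappear when
  everything is expressed through the data: on the fixed space of pairs \<open>(f, b)\<close> the problem at
  \<open>(\<lambda>, t)\<close> becomes the equation for \<open>1 - K + W\<^sub>\<lambda>\<^sub>,\<^sub>t\<close>, where \<open>K (f, b) = (\<Pi> (solve (f, b)), 0)\<close> is a projection
  onto the span of the vectors \<open>(u\<^sub>i, 0)\<close> and where \<open>W\<^sub>\<lambda>\<^sub>,\<^sub>t\<close> is small in norm near the base point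
  (\<open>perturbed_operator\<close>, \<open>perturbation_bound\<close>).

  Since \<open>1 + W\<close> is invertible for small \<open>W\<close>, the operator \<open>1 - K + W\<close> is invertible iff the Schur
  complement \<open>1 - K (1 + W)\<^sup>-\<^sup>1\<close> on the range of \<open>K\<close> is; \<open>M\<close> is the matrix of this Schur
  complement, tested against the basis (\<open>schur_matrix_singular\<close>, \<open>schur_matrix_nonsingular\<close>). To first order \<open>(1 + W)\<^sup>-\<^sup>1 = 1 - W\<close>, so
  that the derivative of \<open>M\<^sub>j\<^sub>i\<close> is \<open>\<langle>\<Pi> (solve z), u\<^sub>j\<rangle>\<close> with \<open>z\<close> the derivative of \<open>W (u\<^sub>i, 0)\<close>. By the
  Green identity this is \<open>\<langle>f, u\<^sub>j\<rangle> - \<Omega>(b, T u\<^sub>j)\<close> for \<open>z = (f, b)\<close> (\<open>cinner_solve_kernel\<close>). Inserting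
  \<open>f = \<tau> V' u\<^sub>i\<close> and \<open>b = (1 - R) ((1 - R) T' u\<^sub>i - R' T u\<^sub>i)\<close>, and using that \<open>\<Omega>\<close> vanishes on \<open>ran R\<close>,
  gives \<open>\<langle>\<tau> V' u\<^sub>i, u\<^sub>j\<rangle> + \<Omega>(R' T u\<^sub>i, T u\<^sub>j) - \<Omega>(T' u\<^sub>i, T u\<^sub>j)\<close>. Finally \<open>\<Omega>(T\<^sub>t u\<^sub>i, T\<^sub>t u\<^sub>j)\<close> does not depend on
  \<open>t\<close>, again by the Green identity, which turns the last term into \<open>\<Omega>(T u\<^sub>i, T' u\<^sub>j)\<close>. In the
  \<open>\<lambda>\<close>-direction only \<open>f = - \<tau> u\<^sub>i\<close> contributes.
\<close>

section \<open>The geometry of complex Hilbert spaces\<close>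

text \<open>The type of bounded linear maps records linearity over the reals only; the coefficients of the
  matrix constructed below are complex.\<close>

abbreviation bounded_clinear :: "('a::complex_hilbert \<Rightarrow> 'b::complex_hilbert) \<Rightarrow> bool"
  where "bounded_clinear \<equiv> bounded_op_on UNIV norm"

lemma cinner_add_right: "cinner x (y + z) = cinner x y + cinner x z"
  for x :: "'a::complex_hilbert"
  by (metis cinner_add_left cinner_commute complex_cnj_add)

lemma cinner_scaleC_right: "cinner x (c *\<^sub>C y) = cnj c * cinner x y"
  for x :: "'a::complex_hilbert"
  by (metis cinner_scaleC_left cinner_commute complex_cnj_mult)

lemma scaleC_minus_one: "- x = (- 1) *\<^sub>C x" for x :: "'a::complex_hilbert"
  by (simp add: scaleC_one)

lemma cinner_minus_left: "cinner (- x) y = - cinner x y" for x :: "'a::complex_hilbert"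
  by (metis scaleC_minus_one cinner_scaleC_left mult_minus1)

lemma cinner_minus_right: "cinner x (- y) = - cinner x y" for x :: "'a::complex_hilbert"
  by (metis cinner_minus_left cinner_commute complex_cnj_minus)

lemma cinner_zero_left [simp]: "cinner 0 y = 0" for y :: "'a::complex_hilbert"
  using cinner_scaleC_left[of 0 0 y] by simp

lemma cinner_zero_right [simp]: "cinner y 0 = 0" for y :: "'a::complex_hilbert"
  using cinner_scaleC_right[of y 0 0] by simp

lemma cinner_diff_left: "cinner (x - y) z = cinner x z - cinner y z"
  for x :: "'a::complex_hilbert"
  by (metis cinner_add_left cinner_minus_left diff_conv_add_uminus)

lemma cinner_diff_right: "cinner z (x - y) = cinner z x - cinner z y"
  for x :: "'a::complex_hilbert"
  by (metis cinner_add_right cinner_minus_right diff_conv_add_uminus)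

lemma cinner_sum_left: "cinner (sum f S) y = (\<Sum>i\<in>S. cinner (f i) y)"
  for y :: "'a::complex_hilbert"
  by (induction S rule: infinite_finite_induct) (auto simp: cinner_add_left)

lemmas cinner_simps = cinner_add_left cinner_add_right cinner_diff_left cinner_diff_right
  cinner_minus_left cinner_minus_right cinner_scaleC_left cinner_scaleC_right

lemma cinner_self: "cinner x x = complex_of_real ((norm x)\<^sup>2)" for x :: "'a::complex_hilbert"
proof -
  have "Im (cinner x x) = Im (cnj (cinner x x))"
    by (metis cinner_commute)
  then have "Im (cinner x x) = 0" by simp
  then show ?thesis
    by (simp add: complex_eq_iff norm_eq_sqrt_cinner cinner_self_nonneg)
qed

lemma norm_square_cinner: "(norm x)\<^sup>2 = Re (cinner x x)" for x :: "'a::complex_hilbert"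
  by (simp add: cinner_self)

lemma norm_scaleC: "norm (c *\<^sub>C x) = cmod c * norm x" for x :: "'a::complex_hilbert"
proof -
  have "complex_of_real ((norm (c *\<^sub>C x))\<^sup>2) = (c * cnj c) * complex_of_real ((norm x)\<^sup>2)"
    unfolding cinner_self[symmetric] by (simp add: cinner_simps)
  also have "\<dots> = complex_of_real ((cmod c * norm x)\<^sup>2)"
    by (simp add: complex_mult_cnj cmod_power2 power_mult_distrib)
  finally have "(norm (c *\<^sub>C x))\<^sup>2 = (cmod c * norm x)\<^sup>2"
    using of_real_eq_iff by blast
  then show ?thesis by simp
qed

lemma Cauchy_Schwarz: "cmod (cinner x y) \<le> norm x * norm y" for x :: "'a::complex_hilbert"
proof (cases "y = 0")
  case False
  define c where "c = cinner x y / complex_of_real ((norm y)\<^sup>2)"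
  have cy: "c * complex_of_real ((norm y)\<^sup>2) = cinner x y"
    using False by (simp add: c_def)
  have yx: "cinner y x = cnj (cinner x y)" by (rule cinner_commute)
  have "cinner (x - c *\<^sub>C y) (x - c *\<^sub>C y)
      = cinner x x - cnj c * cinner x y - c * cinner y x
        + cnj c * (c * complex_of_real ((norm y)\<^sup>2))"
    by (simp add: cinner_simps cinner_self[of y] algebra_simps)
  also have "\<dots> = cinner x x - c * cinner y x"
    unfolding cy by simp
  also have "\<dots> = complex_of_real ((norm x)\<^sup>2) - complex_of_real ((cmod (cinner x y))\<^sup>2 / (norm y)\<^sup>2)"
    unfolding yx cinner_self c_def
    by (simp add: complex_mult_cnj cmod_power2 flip: of_real_mult of_real_power)
  finally have "(norm (x - c *\<^sub>C y))\<^sup>2 = (norm x)\<^sup>2 - (cmod (cinner x y))\<^sup>2 / (norm y)\<^sup>2"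
    unfolding norm_square_cinner[of "x - c *\<^sub>C y"] by simp
  then have "(cmod (cinner x y))\<^sup>2 / (norm y)\<^sup>2 \<le> (norm x)\<^sup>2"
    using zero_le_power2[of "norm (x - c *\<^sub>C y)"] by linarith
  then have "(cmod (cinner x y))\<^sup>2 \<le> (norm x * norm y)\<^sup>2"
    using False by (simp add: divide_simps power_mult_distrib)
  then show ?thesis
    by (rule power2_le_imp_le) simp
qed simp

lemma parallelogram_law:
  "(norm (x + y))\<^sup>2 + (norm (x - y))\<^sup>2 = 2 * (norm x)\<^sup>2 + 2 * (norm y)\<^sup>2"
  for x :: "'a::complex_hilbert"
  unfolding norm_square_cinner by (simp add: cinner_simps)

lemma norm_pythagoras:
  fixes x :: "'a::complex_hilbert"
  assumes "cinner x y = 0"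
  shows "(norm (x + y))\<^sup>2 = (norm x)\<^sup>2 + (norm y)\<^sup>2"
  using assms cinner_commute[of y x] unfolding norm_square_cinner by (simp add: cinner_simps)

lemma bounded_linear_cinner_left: "bounded_linear (\<lambda>x. cinner x y)"
  for y :: "'a::complex_hilbert"
proof (rule bounded_linear_intro)
  show "norm (cinner x y) \<le> norm x * norm y" for x
    by (rule Cauchy_Schwarz)
qed (simp_all add: cinner_simps scaleR_eq_scaleC scaleR_conv_of_real)

text \<open>A minimising sequence for the distance to \<open>E\<close> is a Cauchy sequence by the parallelogram
  law, and its limit is the foot of the perpendicular.\<close>

lemma orthogonal_projection_exists:
  fixes E :: "'a::complex_hilbert set"
  assumes E: "csubspace E" and "closed E"
  shows "\<exists>p\<in>E. \<forall>e\<in>E. cinner (x - p) e = 0"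
proof -
  define d where "d = Inf ((\<lambda>e. norm (x - e)) ` E)"
  have ne: "E \<noteq> {}"
    using E complex_vs.subspace_0 by (auto)
  have bdd: "bdd_below ((\<lambda>e. norm (x - e)) ` E)"
    by (rule bdd_belowI[of _ 0]) auto
  have d_le: "d \<le> norm (x - e)" if "e \<in> E" for e
    unfolding d_def by (intro cInf_lower bdd imageI that)
  have "0 \<le> d"
    unfolding d_def by (intro cInf_greatest) (use ne in auto)
  have "\<exists>e\<in>E. norm (x - e) < d + 1 / real (Suc n)" for n
  proof -
    have "Inf ((\<lambda>e. norm (x - e)) ` E) < d + 1 / real (Suc n)"
      unfolding d_def by simp
    from cInf_lessD[OF _ this] ne show ?thesis by auto
  qed
  then obtain e where eE: "\<And>n. e n \<in> E" and e: "\<And>n. norm (x - e n) < d + 1 / real (Suc n)"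
    by metis
  have lim_d: "(\<lambda>n. norm (x - e n)) \<longlonglongrightarrow> d"
  proof (rule tendsto_sandwich[where f = "\<lambda>_. d" and h = "\<lambda>n. d + 1 / real (Suc n)"])
    show "\<forall>\<^sub>F n in sequentially. norm (x - e n) \<le> d + 1 / real (Suc n)"
      by (intro always_eventually allI less_imp_le e)
    show "(\<lambda>n. d + 1 / real (Suc n)) \<longlonglongrightarrow> d"
      using tendsto_add[OF tendsto_const[of d] LIMSEQ_inverse_real_of_nat]
      by (simp add: inverse_eq_divide)
    show "\<forall>\<^sub>F n in sequentially. d \<le> norm (x - e n)"
      by (intro always_eventually allI d_le eE)
  qed (rule tendsto_const)
  have mid: "(norm (e m - e n))\<^sup>2 \<le> 2 * (norm (x - e m))\<^sup>2 + 2 * (norm (x - e n))\<^sup>2 - 4 * d\<^sup>2" for m n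
  proof -
    define h where "h = (1/2) *\<^sub>C (e m + e n)"
    have "h \<in> E"
      using E eE unfolding h_def
      by (intro complex_vs.subspace_scale complex_vs.subspace_add) auto
    have "e m + e n = 2 *\<^sub>C h"
      by (simp add: h_def scaleC_scaleC scaleC_one)
    also have "\<dots> = h + h"
      using scaleC_add_left[of 1 1 h] by (simp add: scaleC_one)
    finally have "(x - e n) + (x - e m) = (x - h) + (x - h)"
      by (simp add: algebra_simps)
    also have "\<dots> = 2 *\<^sub>R (x - h)" by (simp add: scaleR_2)
    finally have "norm ((x - e n) + (x - e m)) = 2 * norm (x - h)" by simp
    moreover have "d\<^sup>2 \<le> (norm (x - h))\<^sup>2"
      using d_le[OF \<open>h \<in> E\<close>] \<open>0 \<le> d\<close> by (intro power_mono)
    ultimately show ?thesis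
      using parallelogram_law[of "x - e n" "x - e m"] by (simp add: power_mult_distrib)
  qed
  have "Cauchy e"
  proof (rule metric_CauchyI)
    fix \<epsilon> :: real assume "0 < \<epsilon>"
    have "(\<lambda>n. (norm (x - e n))\<^sup>2) \<longlonglongrightarrow> d\<^sup>2"
      by (intro tendsto_intros lim_d)
    then have "\<forall>\<^sub>F n in sequentially. (norm (x - e n))\<^sup>2 < d\<^sup>2 + \<epsilon>\<^sup>2 / 4"
      by (rule order_tendstoD(2)) (use \<open>0 < \<epsilon>\<close> in simp)
    then obtain N where N: "\<And>n. n \<ge> N \<Longrightarrow> (norm (x - e n))\<^sup>2 < d\<^sup>2 + \<epsilon>\<^sup>2 / 4"
      by (auto simp: eventually_sequentially)
    have "norm (e m - e n) < \<epsilon>" if "m \<ge> N" "n \<ge> N" for m n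
    proof -
      have "(norm (e m - e n))\<^sup>2 < \<epsilon>\<^sup>2"
        using mid[of m n] N[OF that(1)] N[OF that(2)] by argo
      then show ?thesis
        by (rule power2_less_imp_less) (use \<open>0 < \<epsilon>\<close> in simp)
    qed
    then show "\<exists>N. \<forall>m\<ge>N. \<forall>n\<ge>N. dist (e m) (e n) < \<epsilon>"
      by (auto simp: dist_norm)
  qed
  then obtain p where p: "e \<longlonglongrightarrow> p"
    using Cauchy_convergent convergent_def by blast
  have "p \<in> E"
    using \<open>closed E\<close> eE p closed_sequentially by blast
  have "(\<lambda>n. norm (x - e n)) \<longlonglongrightarrow> norm (x - p)"
    by (intro tendsto_intros p)
  then have dp: "norm (x - p) = d"
    using lim_d LIMSEQ_unique by blast
  have "cinner (x - p) f = 0" if "f \<in> E" for f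
  proof (cases "f = 0")
    case False
    define c where "c = cinner (x - p) f / complex_of_real ((norm f)\<^sup>2)"
    define r where "r = x - p - c *\<^sub>C f"
    have cf: "c * complex_of_real ((norm f)\<^sup>2) = cinner (x - p) f"
      using False by (simp add: c_def)
    then have "cinner r f = 0"
      unfolding r_def by (simp only: cinner_diff_left[of "x - p" "c *\<^sub>C f"] cinner_scaleC_left cinner_self) simp
    then have "(norm (r + c *\<^sub>C f))\<^sup>2 = (norm r)\<^sup>2 + (norm (c *\<^sub>C f))\<^sup>2"
      by (intro norm_pythagoras) (simp add: cinner_simps)
    moreover have "p + c *\<^sub>C f \<in> E"
      using E \<open>p \<in> E\<close> that
      by (intro complex_vs.subspace_scale complex_vs.subspace_add) auto
    then have "d \<le> norm r"
      using d_le[of "p + c *\<^sub>C f"] by (simp add: r_def algebra_simps)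
    then have "d\<^sup>2 \<le> (norm r)\<^sup>2"
      using \<open>0 \<le> d\<close> by (intro power_mono)
    moreover have "r + c *\<^sub>C f = x - p" by (simp add: r_def)
    ultimately have "norm (c *\<^sub>C f) = 0"
      using dp by (smt (verit) norm_ge_zero zero_eq_power2 zero_le_power2)
    then have "c = 0" using False by (simp add: norm_scaleC)
    then show ?thesis using cf by simp
  qed simp
  then show ?thesis using \<open>p \<in> E\<close> by blast
qed

lemma bounded_clinearI:
  fixes f :: "'a::complex_hilbert \<Rightarrow> 'b::complex_hilbert"
  assumes "\<And>x y. f (x + y) = f x + f y" "\<And>c x. f (c *\<^sub>C x) = c *\<^sub>C f x"
    and "\<And>x. norm (f x) \<le> K * norm x"
  shows "bounded_clinear f"
  using assms by (auto simp: bounded_op_on_def clinear_on_def intro: complex_vs.subspace_UNIV)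

lemma clinear_on_add: "clinear_on D f \<Longrightarrow> x \<in> D \<Longrightarrow> y \<in> D \<Longrightarrow> f (x + y) = f x + f y"
  by (auto simp: clinear_on_def)

lemma clinear_on_scaleC: "clinear_on D f \<Longrightarrow> x \<in> D \<Longrightarrow> f (c *\<^sub>C x) = c *\<^sub>C f x"
  by (auto simp: clinear_on_def)

lemma clinear_on_subspace: "clinear_on D f \<Longrightarrow> csubspace D"
  by (auto simp: clinear_on_def)

lemma csubspace_add: "csubspace D \<Longrightarrow> x \<in> D \<Longrightarrow> y \<in> D \<Longrightarrow> x + y \<in> D"
  by (auto simp: complex_vs.subspace_add)

lemma csubspace_scaleC: "csubspace D \<Longrightarrow> x \<in> D \<Longrightarrow> c *\<^sub>C x \<in> D"
  by (auto simp: complex_vs.subspace_scale)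

lemma csubspace_zero: "csubspace D \<Longrightarrow> 0 \<in> D"
  by (auto simp: complex_vs.subspace_0)

lemma csubspace_diff: "csubspace D \<Longrightarrow> x \<in> D \<Longrightarrow> y \<in> D \<Longrightarrow> x - y \<in> D"
  by (auto simp: complex_vs.subspace_diff)

lemma csubspaceI:
  assumes "0 \<in> D" "\<And>x y. x \<in> D \<Longrightarrow> y \<in> D \<Longrightarrow> x + y \<in> D" "\<And>c x. x \<in> D \<Longrightarrow> c *\<^sub>C x \<in> D"
  shows "csubspace D"
  using assms by (auto intro: complex_vs.subspaceI)

lemma clinear_on_diff:
  assumes "clinear_on D f" "x \<in> D" "y \<in> D" shows "f (x - y) = f x - f y"
proof -
  have "f (x + (- 1) *\<^sub>C y) = f x + (- 1) *\<^sub>C f y"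
    using assms by (metis clinear_on_add clinear_on_scaleC clinear_on_subspace csubspace_scaleC)
  then show ?thesis by (simp add: scaleC_one)
qed

lemma clinear_on_zero: "clinear_on D f \<Longrightarrow> f 0 = 0"
  using clinear_on_diff[of D f 0 0] clinear_on_subspace csubspace_zero by fastforce

lemma bounded_clinear_clinear: "bounded_clinear f \<Longrightarrow> clinear_on UNIV f"
  by (simp add: bounded_op_on_def)

lemmas bounded_clinear_add = clinear_on_add[OF bounded_clinear_clinear UNIV_I UNIV_I]
lemmas bounded_clinear_diff = clinear_on_diff[OF bounded_clinear_clinear UNIV_I UNIV_I]
lemmas bounded_clinear_scaleC = clinear_on_scaleC[OF bounded_clinear_clinear UNIV_I]
lemmas bounded_clinear_zero = clinear_on_zero[OF bounded_clinear_clinear]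

lemma bounded_clinear_bounded:
  assumes "bounded_clinear f"
  obtains K where "0 < K" "\<And>x. norm (f x) \<le> K * norm x"
proof -
  obtain K where K: "\<And>x. norm (f x) \<le> K * norm x"
    using assms by (auto simp: bounded_op_on_def)
  have "norm (f x) \<le> max K 1 * norm x" for x
    using K[of x] by (rule order_trans) (simp add: mult_right_mono)
  then show thesis by (intro that[of "max K 1"]) auto
qed

lemma bounded_clinear_bounded_linear:
  assumes "bounded_clinear f"
  shows "bounded_linear f"
proof -
  obtain K where K: "\<And>x. norm (f x) \<le> K * norm x"
    using assms by (auto simp: bounded_op_on_def)
  show ?thesis
    by (rule bounded_linear_intro[of _ K])
      (use K in \<open>simp_all add: bounded_clinear_add[OF assms] scaleR_eq_scaleC
        bounded_clinear_scaleC[OF assms] mult.commute\<close>)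
qed

text \<open>The theorem of Hellinger and Toeplitz. The sets \<open>{x. norm (G x) \<le> n}\<close> are closed because
  symmetry turns them into intersections of the closed sets \<open>{x. cmod (cinner x (G y)) \<le> n}\<close>; by
  the category theorem one of them contains a ball.\<close>

lemma symmetric_everywhere_imp_bounded:
  fixes G :: "'a::complex_hilbert \<Rightarrow> 'a"
  assumes lin: "clinear_on UNIV G" and sym: "\<And>x y. cinner (G x) y = cinner x (G y)"
  shows "bounded_clinear G"
proof -
  define E where "E n = {x. norm (G x) \<le> real n}" for n
  have E_eq: "E n = (\<Inter>y\<in>cball 0 1. {x. cmod (cinner x (G y)) \<le> real n})" for n
  proof (intro equalityI subsetI)
    fix x assume "x \<in> E n"
    moreover have "cmod (cinner x (G y)) \<le> norm (G x)" if "norm y \<le> 1" for y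
      using Cauchy_Schwarz[of "G x" y] mult_left_le[OF that norm_ge_zero[of "G x"]]
      unfolding sym by linarith
    ultimately show "x \<in> (\<Inter>y\<in>cball 0 1. {x. cmod (cinner x (G y)) \<le> real n})"
      by (force simp: E_def)
  next
    fix x assume x: "x \<in> (\<Inter>y\<in>cball 0 1. {x. cmod (cinner x (G y)) \<le> real n})"
    show "x \<in> E n"
    proof (cases "G x = 0")
      case False
      define y where "y = (1 / complex_of_real (norm (G x))) *\<^sub>C G x"
      have "norm y = 1" using False by (simp add: y_def norm_scaleC norm_divide)
      then have "cmod (cinner x (G y)) \<le> real n" using x by auto
      moreover have "cinner x (G y) = complex_of_real (norm (G x))"
        using False by (simp add: y_def sym[symmetric] cinner_simps cinner_self power2_eq_square)
      ultimately show ?thesis by (simp add: E_def)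
    qed (simp add: E_def)
  qed
  have "closed (E n)" for n
    unfolding E_eq
    by (intro closed_INT ballI closed_Collect_le continuous_intros
        linear_continuous_on bounded_linear_cinner_left)
  then have closed_E: "closedin euclidean (E n)" for n
    by simp
  have "(\<Union>n. E n) = UNIV"
    by (auto simp: E_def) (meson real_arch_simple)
  have "\<exists>n. euclidean interior_of (E n) \<noteq> {}"
  proof (rule ccontr)
    assume "\<nexists>n. euclidean interior_of (E n) \<noteq> {}"
    then have "Met_TC.mtopology interior_of (\<Union>(range E)) = ({} :: 'a set)"
      using closed_E
      by (intro Met_TC.metric_Baire_category_alt)
         (auto simp: mcomplete_iff_complete complete_UNIV)
    then show False using \<open>(\<Union>n. E n) = UNIV\<close> by simp
  qed
  then obtain n a where "a \<in> interior (E n)"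
    by auto
  then obtain r where "0 < r" and ball: "cball a r \<subseteq> E n"
    by (meson mem_interior_cball)
  have "norm (G x) \<le> (2 * real n / r) * norm x" for x
  proof (cases "x = 0")
    case True
    then show ?thesis using clinear_on_zero[OF lin] by simp
  next
    case False
    define c where "c = complex_of_real (r / norm x)"
    have nc: "cmod c = r / norm x" using \<open>0 < r\<close> by (simp add: c_def norm_divide)
    have "a + c *\<^sub>C x \<in> E n" "a \<in> E n"
      using False \<open>0 < r\<close> nc by (auto intro!: subsetD[OF ball] simp: dist_norm norm_scaleC)
    moreover have "G (a + c *\<^sub>C x) = G a + c *\<^sub>C G x"
      by (simp add: clinear_on_add[OF lin] clinear_on_scaleC[OF lin])
    ultimately have "norm (c *\<^sub>C G x) \<le> 2 * real n"
      unfolding E_def using norm_triangle_ineq4[of "G a + c *\<^sub>C G x" "G a"] by simp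
    then show ?thesis
      using False \<open>0 < r\<close> unfolding norm_scaleC nc by (simp add: field_simps)
  qed
  then show ?thesis
    by (intro bounded_clinearI[of G "2 * real n / r"])
      (simp_all add: clinear_on_add[OF lin] clinear_on_scaleC[OF lin])
qed

section \<open>Perturbing the identity minus a projection of finite rank\<close>

lemma bounded_clinear_compose:
  fixes f :: "'b::complex_hilbert \<Rightarrow> 'c::complex_hilbert" and g :: "'a::complex_hilbert \<Rightarrow> 'b"
  assumes "bounded_clinear f" "bounded_clinear g"
  shows "bounded_clinear (\<lambda>x. f (g x))"
proof -
  obtain K where K: "0 < K" "\<And>x. norm (f x) \<le> K * norm x"
    using bounded_clinear_bounded[OF assms(1)] by blast
  obtain L where L: "0 < L" "\<And>x. norm (g x) \<le> L * norm x"
    using bounded_clinear_bounded[OF assms(2)] by blast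
  have "norm (f (g x)) \<le> K * L * norm x" for x
    using order_trans[OF K(2) mult_left_mono[OF L(2)]] K(1) by (simp add: mult.assoc)
  then show ?thesis
    by (intro bounded_clinearI[where K = "K * L"])
      (simp_all add: bounded_clinear_add[OF assms(1)] bounded_clinear_add[OF assms(2)]
        bounded_clinear_scaleC[OF assms(1)] bounded_clinear_scaleC[OF assms(2)])
qed

lemma bounded_clinear_plus:
  fixes f g :: "'a::complex_hilbert \<Rightarrow> 'b::complex_hilbert"
  assumes "bounded_clinear f" "bounded_clinear g"
  shows "bounded_clinear (\<lambda>x. f x + g x)"
proof -
  obtain K where K: "0 < K" "\<And>x. norm (f x) \<le> K * norm x"
    using bounded_clinear_bounded[OF assms(1)] by blast
  obtain L where L: "0 < L" "\<And>x. norm (g x) \<le> L * norm x"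
    using bounded_clinear_bounded[OF assms(2)] by blast
  have "norm (f x + g x) \<le> (K + L) * norm x" for x
    using norm_triangle_ineq[of "f x" "g x"] K(2)[of x] L(2)[of x] by (simp add: distrib_right)
  then show ?thesis
    by (intro bounded_clinearI[where K = "K + L"])
      (simp_all add: bounded_clinear_add[OF assms(1)] bounded_clinear_add[OF assms(2)]
        bounded_clinear_scaleC[OF assms(1)] bounded_clinear_scaleC[OF assms(2)] scaleC_add_right)
qed

lemma bounded_clinear_scale:
  fixes f :: "'a::complex_hilbert \<Rightarrow> 'b::complex_hilbert"
  assumes "bounded_clinear f"
  shows "bounded_clinear (\<lambda>x. c *\<^sub>C f x)"
proof -
  obtain K where K: "0 < K" "\<And>x. norm (f x) \<le> K * norm x"
    using bounded_clinear_bounded[OF assms] by blast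
  have "norm (c *\<^sub>C f x) \<le> cmod c * K * norm x" for x
    using mult_left_mono[OF K(2) norm_ge_zero[of c]] by (simp add: norm_scaleC mult.assoc)
  then show ?thesis
    by (intro bounded_clinearI[where K = "cmod c * K"])
      (simp_all add: bounded_clinear_add[OF assms] bounded_clinear_scaleC[OF assms]
        scaleC_add_right scaleC_scaleC mult.commute)
qed

lemma bounded_clinear_id: "bounded_clinear (\<lambda>x::'a::complex_hilbert. x)"
  by (rule bounded_clinearI[where K = 1]) simp_all

lemma bounded_clinear_const_zero:
  "bounded_clinear (\<lambda>x::'a::complex_hilbert. 0 :: 'b::complex_hilbert)"
  by (rule bounded_clinearI[where K = 0]) simp_all

lemma bounded_clinear_sum:
  fixes f :: "'i \<Rightarrow> 'a::complex_hilbert \<Rightarrow> 'b::complex_hilbert"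
  assumes "\<And>i. i \<in> S \<Longrightarrow> bounded_clinear (f i)"
  shows "bounded_clinear (\<lambda>x. \<Sum>i\<in>S. f i x)"
  using assms
  by (induction S rule: infinite_finite_induct)
    (simp_all add: bounded_clinear_const_zero bounded_clinear_plus)

lemma bounded_clinear_rank_one:
  fixes f :: "'a::complex_hilbert \<Rightarrow> 'b::complex_hilbert" and e :: "'c::complex_hilbert"
  assumes "bounded_clinear f"
  shows "bounded_clinear (\<lambda>z. cinner (f z) y *\<^sub>C e)"
proof -
  obtain K where K: "0 < K" "\<And>x. norm (f x) \<le> K * norm x"
    using bounded_clinear_bounded[OF assms] by blast
  have "norm (cinner (f x) y *\<^sub>C e) \<le> K * norm y * norm e * norm x" for x
  proof -
    have "norm (cinner (f x) y *\<^sub>C e) \<le> norm (f x) * norm y * norm e"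
      by (simp add: norm_scaleC mult_right_mono Cauchy_Schwarz)
    also have "\<dots> \<le> K * norm x * norm y * norm e"
      by (intro mult_right_mono K) simp_all
    finally show ?thesis by (simp add: mult_ac)
  qed
  then show ?thesis
    by (intro bounded_clinearI[where K = "K * norm y * norm e"])
      (simp_all add: bounded_clinear_add[OF assms] bounded_clinear_scaleC[OF assms]
        cinner_simps scaleC_add_left scaleC_scaleC)
qed

lemma clinear_on_sum:
  assumes "clinear_on UNIV f"
  shows "f (\<Sum>i\<in>S. c i *\<^sub>C x i) = (\<Sum>i\<in>S. c i *\<^sub>C f (x i))"
  by (induction S rule: infinite_finite_induct)
    (simp_all add: clinear_on_zero[OF assms] clinear_on_add[OF assms] clinear_on_scaleC[OF assms])

lemma has_vector_derivative_iff_quotient: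
  fixes f :: "real \<Rightarrow> 'a::real_normed_vector"
  shows "(f has_vector_derivative f') (at t within S) \<longleftrightarrow>
    ((\<lambda>s. (f s - f t) /\<^sub>R (s - t)) \<longlongrightarrow> f') (at t within S)"
proof -
  have eq: "norm (((f s - f t) - (s - t) *\<^sub>R f') /\<^sub>R norm (s - t)) = norm ((f s - f t) /\<^sub>R (s - t) - f')"
    if "s \<noteq> t" for s
  proof -
    have "(f s - f t) /\<^sub>R (s - t) - f' = ((f s - f t) - (s - t) *\<^sub>R f') /\<^sub>R (s - t)"
      using that by (simp add: scaleR_diff_right)
    then show ?thesis by simp
  qed
  have "(f has_vector_derivative f') (at t within S) \<longleftrightarrow>
    ((\<lambda>s. norm (((f s - f t) - (s - t) *\<^sub>R f') /\<^sub>R norm (s - t))) \<longlongrightarrow> 0) (at t within S)"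
    by (simp add: has_vector_derivative_def has_derivative_iff_norm bounded_linear_scaleR_left
        divide_inverse_commute)
  also have "\<dots> \<longleftrightarrow> ((\<lambda>s. norm ((f s - f t) /\<^sub>R (s - t) - f')) \<longlongrightarrow> 0) (at t within S)"
    by (intro filterlim_cong refl eventually_mono[OF _ eq]) (auto simp: eventually_at_filter)
  also have "\<dots> \<longleftrightarrow> ((\<lambda>s. (f s - f t) /\<^sub>R (s - t)) \<longlongrightarrow> f') (at t within S)"
    by (simp only: tendsto_norm_zero_iff LIM_zero_iff)
  finally show ?thesis .
qed

text \<open>The equation \<open>x + W x = y\<close> is the fixed point equation of the contraction \<open>x \<mapsto> y - W x\<close>.\<close>

lemma identity_plus_contraction:
  fixes W :: "'a::complex_hilbert \<Rightarrow> 'a"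
  assumes lin: "clinear_on UNIV W" and q: "0 \<le> q" "q < 1"
    and bound: "\<And>x. norm (W x) \<le> q * norm x"
  defines "R \<equiv> inv_into UNIV (\<lambda>x. x + W x)"
  shows "bounded_clinear R" "R y + W (R y) = y" "R (x + W x) = x"
    and "norm (R y - y) \<le> q / (1 - q) * norm y"
proof -
  have ex1: "\<exists>!x. y - W x = x" for y
  proof (rule banach_fix_type[OF q])
    show "\<forall>x z. dist (y - W x) (y - W z) \<le> q * dist x z"
    proof (intro allI)
      fix x z
      have "(y - W x) - (y - W z) = - W (x - z)"
        by (simp add: clinear_on_diff[OF lin])
      then show "dist (y - W x) (y - W z) \<le> q * dist x z"
        using bound[of "x - z"] by (simp add: dist_norm)
    qed
  qed
  have bij: "bij (\<lambda>x. x + W x)"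
  proof (rule bijI)
    show "inj (\<lambda>x. x + W x)"
    proof (rule injI)
      fix x z assume "x + W x = z + W z"
      then have "(x + W x) - W x = x" "(x + W x) - W z = z"
        by (simp_all add: algebra_simps)
      with ex1 show "x = z" by blast
    qed
    show "surj (\<lambda>x. x + W x)"
      unfolding surj_def
    proof
      fix y
      obtain x where "y - W x = x" using ex1 by blast
      then show "\<exists>x. y = x + W x" by (metis diff_add_cancel)
    qed
  qed
  show RR: "R y + W (R y) = y" for y
    unfolding R_def using bij by (metis (mono_tags) bij_inv_eq_iff)
  show R: "R (x + W x) = x" for x
    unfolding R_def using bij by (metis (mono_tags) bij_inv_eq_iff)
  have Rle: "norm (R y) \<le> 1 / (1 - q) * norm y" for y
  proof -
    have "norm (R y) \<le> norm y + norm (W (R y))"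
      using RR[of y] norm_triangle_ineq4[of y "W (R y)"] by (simp add: eq_diff_eq[symmetric])
    then have "norm (R y) \<le> norm y + q * norm (R y)"
      using bound[of "R y"] by linarith
    then have "(1 - q) * norm (R y) \<le> norm y"
      by (simp add: algebra_simps)
    then show ?thesis using q by (simp add: field_simps)
  qed
  show "bounded_clinear R"
  proof (rule bounded_clinearI)
    show "R (x + y) = R x + R y" for x y
    proof -
      have "R x + R y + W (R x + R y) = x + y"
        using RR[of x] RR[of y] clinear_on_add[OF lin, of "R x" "R y"] by (simp add: algebra_simps)
      then show ?thesis using R by metis
    qed
    show "R (c *\<^sub>C x) = c *\<^sub>C R x" for c x
    proof -
      have "c *\<^sub>C R x + W (c *\<^sub>C R x) = c *\<^sub>C x"
        using RR[of x] clinear_on_scaleC[OF lin, of "R x" c] by (metis UNIV_I scaleC_add_right)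
      then show ?thesis using R by metis
    qed
  qed (rule Rle)
  have "R y - y = - W (R y)"
    using RR[of y] by (simp add: algebra_simps)
  then have "norm (R y - y) \<le> q * norm (R y)"
    using bound[of "R y"] by simp
  also have "\<dots> \<le> q * (1 / (1 - q) * norm y)"
    by (intro mult_left_mono Rle q)
  finally show "norm (R y - y) \<le> q / (1 - q) * norm y" by simp
qed

text \<open>\<open>F\<close> is a projection onto the span of the vectors \<open>x i\<close>, in general not an orthogonal one.\<close>

locale finite_rank_projection =
  fixes g :: nat and x :: "nat \<Rightarrow> 'a::complex_hilbert" and F :: "'a \<Rightarrow> 'a"
  assumes F: "bounded_clinear F"
    and F_range: "\<exists>c. F z = (\<Sum>i<g. c i *\<^sub>C x i)"
    and F_fixes: "i < g \<Longrightarrow> F (x i) = x i"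
    and independent: "(\<Sum>i<g. c i *\<^sub>C x i) = 0 \<Longrightarrow> i < g \<Longrightarrow> c i = 0"
begin

text \<open>The Schur complement of \<open>1 + W\<close> in the problem of inverting \<open>1 - F + W\<close>. Testing with the basis
  vectors instead of a dual basis keeps the formula for its derivative free of Gram matrices.\<close>

definition schur_matrix :: "('a \<Rightarrow> 'a) \<Rightarrow> complex mat"
  where "schur_matrix W =
    mat g g (\<lambda>(j, i). cinner (x i - F (inv_into UNIV (\<lambda>z. z + W z) (x i))) (x j))"

lemma schur_matrix_carrier: "schur_matrix W \<in> carrier_mat g g"
  by (simp add: schur_matrix_def)

lemma schur_matrix_zero:
  assumes "\<And>z. W z = 0"
  shows "schur_matrix W = 0\<^sub>m g g"
proof -
  have "inv_into UNIV (\<lambda>z. z + W z) = (\<lambda>z. z)"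
    using assms by simp
  then show ?thesis
    by (intro eq_matI) (simp_all add: schur_matrix_def F_fixes)
qed

lemma span_orthogonal_imp_zero:
  assumes "\<And>j. j < g \<Longrightarrow> cinner (\<Sum>i<g. c i *\<^sub>C x i) (x j) = 0"
  shows "(\<Sum>i<g. c i *\<^sub>C x i) = 0"
proof -
  let ?z = "\<Sum>i<g. c i *\<^sub>C x i"
  have "cinner ?z ?z = cnj (\<Sum>i<g. c i * cinner (x i) ?z)"
    by (subst cinner_commute) (simp add: cinner_sum_left cinner_scaleC_left)
  also have "\<dots> = cnj (\<Sum>i<g. c i * cnj (cinner ?z (x i)))"
    by (simp only: cinner_commute[of "x _" ?z])
  also have "\<dots> = 0" using assms by simp
  finally show ?thesis by (simp add: cinner_self)
qed

text \<open>Write \<open>D = 1 + W\<close> and \<open>L = D - F\<close>. A vector \<open>z\<close> solves \<open>L z = 0\<close> iff \<open>z = D\<^sup>-\<^sup>1 k\<close> with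
  \<open>k = F z\<close> in the range of \<open>F\<close> and \<open>k = F (D\<^sup>-\<^sup>1 k)\<close>; in coordinates for the basis \<open>x\<close> of that range
  the last equation says that the Schur matrix annihilates the coordinate vector of \<open>k\<close>.\<close>

context
  fixes W :: "'a \<Rightarrow> 'a" and q :: real
  assumes W: "clinear_on UNIV W" "0 \<le> q" "q < 1" "\<And>z. norm (W z) \<le> q * norm z"
begin

lemma schur_matrix_mult:
  assumes "j < g"
  shows "(\<Sum>i<g. schur_matrix W $$ (j, i) * c i) =
    cinner ((\<Sum>i<g. c i *\<^sub>C x i) - F (inv_into UNIV (\<lambda>z. z + W z) (\<Sum>i<g. c i *\<^sub>C x i))) (x j)"
proof -
  let ?R = "inv_into UNIV (\<lambda>z. z + W z)"
  have FR: "clinear_on UNIV (\<lambda>z. F (?R z))"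
    by (rule bounded_clinear_clinear[OF bounded_clinear_compose[OF F identity_plus_contraction(1)[OF W]]])
  have "(\<Sum>i<g. schur_matrix W $$ (j, i) * c i)
      = (\<Sum>i<g. cinner (c i *\<^sub>C x i) (x j) - cinner (c i *\<^sub>C F (?R (x i))) (x j))"
    by (intro sum.cong)
      (simp_all add: schur_matrix_def assms cinner_diff_left cinner_scaleC_left algebra_simps)
  also have "\<dots> = cinner ((\<Sum>i<g. c i *\<^sub>C x i) - (\<Sum>i<g. c i *\<^sub>C F (?R (x i)))) (x j)"
    by (simp add: sum_subtractf cinner_diff_left cinner_sum_left)
  also have "(\<Sum>i<g. c i *\<^sub>C F (?R (x i))) = F (?R (\<Sum>i<g. c i *\<^sub>C x i))"
    by (rule clinear_on_sum[OF FR, symmetric])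
  finally show ?thesis .
qed

lemma schur_matrix_singular:
  assumes "Determinant.det (schur_matrix W) = 0"
  shows "\<exists>z. z \<noteq> 0 \<and> z - F z + W z = 0"
proof -
  let ?R = "inv_into UNIV (\<lambda>z. z + W z)"
  note R = identity_plus_contraction[OF W]
  obtain v where v: "v \<in> carrier_vec g" "v \<noteq> 0\<^sub>v g" "schur_matrix W *\<^sub>v v = 0\<^sub>v g"
    using assms det_0_iff_vec_prod_zero[OF schur_matrix_carrier] by blast
  define k where "k = (\<Sum>i<g. vec_index v i *\<^sub>C x i)"
  have k0: "cinner (k - F (?R k)) (x j) = 0" if "j < g" for j
  proof -
    have "(\<Sum>i<g. schur_matrix W $$ (j, i) * vec_index v i) = vec_index (schur_matrix W *\<^sub>v v) j"
      using that v(1) schur_matrix_carrier[of W] by (auto simp: scalar_prod_def atLeast0LessThan)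
    also have "\<dots> = 0" using v(3) that by simp
    finally show ?thesis using schur_matrix_mult[OF that, of "\<lambda>i. vec_index v i"] by (simp add: k_def)
  qed
  obtain c where c: "F (?R k) = (\<Sum>i<g. c i *\<^sub>C x i)"
    using F_range by blast
  have eq: "k - F (?R k) = (\<Sum>i<g. (vec_index v i - c i) *\<^sub>C x i)"
    unfolding c unfolding k_def sum_subtractf[symmetric]
    by (intro sum.cong) (simp_all add: complex_vs.scale_left_diff_distrib)
  have kF: "k = F (?R k)"
    using span_orthogonal_imp_zero[of "\<lambda>i. vec_index v i - c i"] k0 unfolding eq[symmetric] by simp
  have "k \<noteq> 0"
  proof
    assume "k = 0"
    then have "vec_index v i = 0" if "i < g" for i
      using independent[of "\<lambda>i. vec_index v i"] that by (simp add: k_def)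
    with v(1,2) show False by auto
  qed
  show ?thesis
  proof (intro exI[of _ "?R k"] conjI)
    show "?R k \<noteq> 0"
      using kF \<open>k \<noteq> 0\<close> bounded_clinear_zero[OF F] by metis
    show "?R k - F (?R k) + W (?R k) = 0"
      using R(2)[of k] kF by (simp add: algebra_simps)
  qed
qed

lemma schur_matrix_nonsingular:
  assumes "Determinant.det (schur_matrix W) \<noteq> 0"
  shows "\<exists>S. bounded_clinear S \<and> (\<forall>z. S z - F (S z) + W (S z) = z) \<and>
    (\<forall>z. z - F z + W z = 0 \<longrightarrow> z = 0)"
proof -
  let ?M = "schur_matrix W" and ?R = "inv_into UNIV (\<lambda>z. z + W z)"
  note R = identity_plus_contraction[OF W]
  note M = schur_matrix_carrier[of W]
  obtain N where N: "N \<in> carrier_mat g g" "?M * N = 1\<^sub>m g"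
    using det_non_zero_imp_unit[OF M assms, of "()"] by (auto simp: Units_def ring_mat_def)
  define k where "k z = (\<Sum>i<g. \<Sum>j<g. N $$ (i, j) *\<^sub>C cinner (F (?R z)) (x j) *\<^sub>C x i)" for z
  define c where "c z i = (\<Sum>j<g. N $$ (i, j) * cinner (F (?R z)) (x j))" for z i
  have FR: "bounded_clinear (\<lambda>z. F (?R z))"
    by (rule bounded_clinear_compose[OF F R(1)])
  have kc: "k z = (\<Sum>i<g. c z i *\<^sub>C x i)" for z
    unfolding k_def c_def complex_vs.scale_sum_left by (simp add: scaleC_scaleC)
  have k: "bounded_clinear k"
    unfolding k_def by (intro bounded_clinear_sum bounded_clinear_scale bounded_clinear_rank_one FR)
  have Mc: "(\<Sum>i<g. ?M $$ (j, i) * c z i) = cinner (F (?R z)) (x j)" if "j < g" for j z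
  proof -
    have "(\<Sum>i<g. ?M $$ (j, i) * c z i)
        = (\<Sum>i<g. \<Sum>l<g. ?M $$ (j, i) * N $$ (i, l) * cinner (F (?R z)) (x l))"
      by (simp add: c_def sum_distrib_left mult.assoc)
    also have "\<dots> = (\<Sum>l<g. (\<Sum>i<g. ?M $$ (j, i) * N $$ (i, l)) * cinner (F (?R z)) (x l))"
      by (subst sum.swap) (simp add: sum_distrib_right)
    also have "\<dots> = (\<Sum>l<g. (if j = l then 1 else 0) * cinner (F (?R z)) (x l))"
    proof (rule sum.cong)
      fix l assume "l \<in> {..<g}"
      then have "(?M * N) $$ (j, l) = (\<Sum>i<g. ?M $$ (j, i) * N $$ (i, l))"
        using M N(1) that by (auto simp: scalar_prod_def atLeast0LessThan)
      then show "(\<Sum>i<g. ?M $$ (j, i) * N $$ (i, l)) * cinner (F (?R z)) (x l)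
          = (if j = l then 1 else 0) * cinner (F (?R z)) (x l)"
        using N(2) \<open>l \<in> {..<g}\<close> that by simp
    qed simp
    also have "\<dots> = (\<Sum>l<g. if l = j then cinner (F (?R z)) (x l) else 0)"
      by (intro sum.cong) auto
    also have "\<dots> = cinner (F (?R z)) (x j)"
      using that by (simp add: sum.delta)
    finally show ?thesis .
  qed
  have k_eq: "k z = F (?R z) + F (?R (k z))" for z
  proof -
    obtain a where a: "F (?R z) = (\<Sum>i<g. a i *\<^sub>C x i)" using F_range by blast
    obtain b where b: "F (?R (k z)) = (\<Sum>i<g. b i *\<^sub>C x i)" using F_range by blast
    have eq: "k z - F (?R (k z)) - F (?R z) = (\<Sum>i<g. (c z i - b i - a i) *\<^sub>C x i)"
      unfolding a b unfolding kc sum_subtractf[symmetric]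
      by (intro sum.cong) (simp_all add: complex_vs.scale_left_diff_distrib)
    have "cinner (k z - F (?R (k z)) - F (?R z)) (x j) = 0" if "j < g" for j
      using schur_matrix_mult[OF that, of "c z"] Mc[OF that, of z]
      by (simp add: cinner_diff_left kc[symmetric])
    then have "k z - F (?R (k z)) - F (?R z) = 0"
      using span_orthogonal_imp_zero[of "\<lambda>i. c z i - b i - a i"] unfolding eq[symmetric] by simp
    then show ?thesis by (simp add: algebra_simps)
  qed
  show ?thesis
  proof (intro exI[of _ "\<lambda>z. ?R (z + k z)"] conjI allI impI)
    show "bounded_clinear (\<lambda>z. ?R (z + k z))"
      by (rule bounded_clinear_compose[OF R(1) bounded_clinear_plus[OF bounded_clinear_id k]])
    show "?R (z + k z) - F (?R (z + k z)) + W (?R (z + k z)) = z" for z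
    proof -
      have "F (?R (z + k z)) = k z"
        using k_eq[of z] by (simp add: bounded_clinear_add[OF FR])
      then show ?thesis using R(2)[of "z + k z"] by (simp add: algebra_simps)
    qed
    show "z = 0" if z: "z - F z + W z = 0" for z
    proof -
      have "z + W z = F z" using z by (simp add: algebra_simps)
      then have zR: "z = ?R (F z)" using R(3)[of z] by simp
      obtain a where a: "F z = (\<Sum>i<g. a i *\<^sub>C x i)" using F_range by blast
      define v where "v = vec g a"
      have "?M *\<^sub>v v = 0\<^sub>v g"
      proof (rule eq_vecI)
        fix j assume "j < dim_vec (0\<^sub>v g :: complex vec)"
        then have j: "j < g" by simp
        have "vec_index (?M *\<^sub>v v) j = (\<Sum>i<g. ?M $$ (j, i) * a i)"
          using j M by (auto simp: v_def scalar_prod_def atLeast0LessThan)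
        also have "\<dots> = cinner (F z - F (?R (F z))) (x j)"
          using schur_matrix_mult[OF j, of a] by (simp add: a)
        also have "\<dots> = 0" using zR by simp
        finally show "vec_index (?M *\<^sub>v v) j = vec_index (0\<^sub>v g :: complex vec) j" using j by simp
      qed (use M in auto)
      then have "v = 0\<^sub>v g"
        using assms det_0_iff_vec_prod_zero[OF M] by (metis v_def vec_carrier)
      then have "a i = 0" if "i < g" for i
        using that by (metis v_def index_vec index_zero_vec(1))
      then have "F z = 0" by (simp add: a)
      then show ?thesis using zR bounded_clinear_zero[OF R(1)] by simp
    qed
  qed
qed

end

text \<open>To first order \<open>(1 + W)\<^sup>-\<^sup>1\<close> is \<open>1 - W\<close>. Only the vectors \<open>W (x i)\<close> have to be
  differentiable: the error is of the order of the norm of \<open>W\<close> times the norm of \<open>W (x i)\<close>.\<close>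

lemma schur_matrix_has_derivative:
  fixes W :: "real \<Rightarrow> 'a \<Rightarrow> 'a" and q :: "real \<Rightarrow> real"
  assumes lin: "\<forall>\<^sub>F t in at t0. clinear_on UNIV (W t)"
    and bound: "\<forall>\<^sub>F t in at t0. \<forall>z. norm (W t z) \<le> q t * norm z"
    and q_nonneg: "\<forall>\<^sub>F t in at t0. 0 \<le> q t"
    and q: "(q \<longlongrightarrow> 0) (at t0)"
    and zero: "\<And>z. W t0 z = 0"
    and deriv: "((\<lambda>t. W t (x i)) has_vector_derivative z) (at t0)"
    and ij: "i < g" "j < g"
  shows "((\<lambda>t. schur_matrix (W t) $$ (j, i)) has_vector_derivative cinner (F z) (x j)) (at t0)"
proof -
  define h where "h t = inv_into UNIV (\<lambda>z. z + W t z) (x i)" for t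
  have h0: "h t0 = x i"
    unfolding h_def by (simp add: zero)
  define \<epsilon> where "\<epsilon> t = h t - x i + W t (x i)" for t
  have \<epsilon>0: "\<epsilon> t0 = 0" by (simp add: \<epsilon>_def h0 zero)
  have D: "((\<lambda>t. W t (x i) /\<^sub>R (t - t0)) \<longlongrightarrow> z) (at t0)"
    using deriv unfolding has_vector_derivative_iff_quotient by (simp add: zero)
  have "((\<lambda>t. \<epsilon> t /\<^sub>R (t - t0)) \<longlongrightarrow> 0) (at t0)"
  proof (rule Lim_null_comparison)
    have "((\<lambda>t. q t / (1 - q t) * norm (W t (x i) /\<^sub>R (t - t0))) \<longlongrightarrow> 0 / (1 - 0) * norm z) (at t0)"
      by (intro tendsto_mult tendsto_divide tendsto_diff tendsto_const tendsto_norm q D) simp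
    then show "((\<lambda>t. q t / (1 - q t) * norm (W t (x i) /\<^sub>R (t - t0))) \<longlongrightarrow> 0) (at t0)"
      by (simp only: div_0 mult_zero_left)
    have "\<forall>\<^sub>F t in at t0. q t < 1"
      by (rule order_tendstoD(2)[OF q]) simp
    with lin bound q_nonneg
    show "\<forall>\<^sub>F t in at t0. norm (\<epsilon> t /\<^sub>R (t - t0)) \<le> q t / (1 - q t) * norm (W t (x i) /\<^sub>R (t - t0))"
    proof eventually_elim
      case (elim t)
      then have b: "\<And>z. norm (W t z) \<le> q t * norm z" by blast
      note R = identity_plus_contraction[OF elim(1,3,4) b]
      let ?R = "inv_into UNIV (\<lambda>z. z + W t z)"
      have "x i = ?R (x i) + ?R (W t (x i))"
        using R(3)[of "x i"] by (simp add: bounded_clinear_add[OF R(1)])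
      then have "\<epsilon> t = W t (x i) - ?R (W t (x i))"
        unfolding \<epsilon>_def h_def by (simp add: algebra_simps)
      then have "norm (\<epsilon> t) \<le> q t / (1 - q t) * norm (W t (x i))"
        using R(4)[of "W t (x i)"] by (simp add: norm_minus_commute)
      then have "norm (\<epsilon> t) * \<bar>inverse (t - t0)\<bar>
          \<le> q t / (1 - q t) * norm (W t (x i)) * \<bar>inverse (t - t0)\<bar>"
        by (rule mult_right_mono) simp
      then show ?case by (simp add: mult_ac)
    qed
  qed
  then have \<epsilon>': "(\<epsilon> has_vector_derivative 0) (at t0)"
    unfolding has_vector_derivative_iff_quotient by (simp add: \<epsilon>0)
  have "((\<lambda>t. x i + \<epsilon> t - W t (x i)) has_vector_derivative 0 + 0 - z) (at t0)"
    by (intro has_vector_derivative_diff has_vector_derivative_add has_vector_derivative_const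
        \<epsilon>' deriv)
  then have h': "(h has_vector_derivative - z) (at t0)"
    by (simp add: \<epsilon>_def)
  have "bounded_linear (\<lambda>y. cinner (F y) (x j))"
    by (rule bounded_linear_compose[OF bounded_linear_cinner_left bounded_clinear_bounded_linear[OF F]])
  note Fh' = bounded_linear.has_vector_derivative[OF this h']
  have "((\<lambda>t. cinner (x i) (x j) - cinner (F (h t)) (x j)) has_vector_derivative
      0 - cinner (F (- z)) (x j)) (at t0)"
    by (intro has_vector_derivative_diff has_vector_derivative_const Fh')
  moreover have "F (- z) = - F z"
    using bounded_clinear_diff[OF F, of 0 z] bounded_clinear_zero[OF F] by simp
  ultimately show ?thesis
    using ij by (simp add: schur_matrix_def h_def cinner_diff_left cinner_minus_left)
qed

end

section \<open>Boundary value problems for an abstract Green identity\<close>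

text \<open>\<open>S\<close> is an operator on a maximal domain \<open>D\<close>, \<open>T\<close> its boundary map with values in the space \<open>'l\<close>
  with the form \<open>cinner (J b) c\<close>, and \<open>T w \<in> range R\<close> is the boundary condition. Together, the
  isotropy of the range of \<open>R\<close> and the assumption \<open>maximal\<close> say what is needed of the
  self-adjointness of the restricted operator: it is symmetric, and the orthogonal complement of its
  range is its kernel.\<close>

locale boundary_problem =
  fixes D :: "'h::complex_hilbert set" and S :: "'h \<Rightarrow> 'h"
    and T :: "'h \<Rightarrow> 'l::complex_hilbert" and J R :: "'l \<Rightarrow> 'l"
    and g :: nat and u :: "nat \<Rightarrow> 'h"
  assumes S: "clinear_on D S" and T: "clinear_on D T"
    and T_bound: "\<exists>K. \<forall>w\<in>D. norm (T w) \<le> K * (norm w + norm (S w))"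
    and T_surj: "\<exists>w\<in>D. T w = b"
    and J: "bounded_clinear J" and R: "bounded_clinear R" and RR: "R (R b) = R b"
    and isotropic: "cinner (J (R b)) (R c) = 0"
    and Green: "w \<in> D \<Longrightarrow> v \<in> D \<Longrightarrow> cinner (S w) v - cinner w (S v) = cinner (J (T w)) (T v)"
    and maximal: "(\<And>v. v \<in> D \<Longrightarrow> R (T v) = T v \<Longrightarrow> cinner (S v) q = 0) \<Longrightarrow>
      q \<in> D \<and> R (T q) = T q \<and> S q = 0"
    and closed_range: "closed (S ` {v\<in>D. R (T v) = T v})"
    and basis: "is_cbasis g u {v\<in>D. R (T v) = T v \<and> S v = 0}"
begin

definition D\<^sub>R :: "'h set" where "D\<^sub>R = {v\<in>D. R (T v) = T v}"

definition E :: "'h set" where "E = {v\<in>D\<^sub>R. S v = 0}"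

lemma D: "csubspace D"
  by (rule clinear_on_subspace[OF S])

lemma D\<^sub>R: "csubspace D\<^sub>R"
proof (rule csubspaceI)
  show "0 \<in> D\<^sub>R"
    by (simp add: D\<^sub>R_def csubspace_zero[OF D] clinear_on_zero[OF T] bounded_clinear_zero[OF R])
qed (auto simp: D\<^sub>R_def csubspace_add[OF D] csubspace_scaleC[OF D] clinear_on_add[OF T]
    clinear_on_scaleC[OF T] bounded_clinear_add[OF R] bounded_clinear_scaleC[OF R])

lemma D\<^sub>R_D: "v \<in> D\<^sub>R \<Longrightarrow> v \<in> D"
  by (simp add: D\<^sub>R_def)

lemma E_D\<^sub>R: "v \<in> E \<Longrightarrow> v \<in> D\<^sub>R"
  by (simp add: E_def)

lemma E: "csubspace E"
proof (rule csubspaceI)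
  show "0 \<in> E"
    by (simp add: E_def csubspace_zero[OF D\<^sub>R] clinear_on_zero[OF S])
qed (auto simp: E_def csubspace_add[OF D\<^sub>R] csubspace_scaleC[OF D\<^sub>R] clinear_on_add[OF S]
    clinear_on_scaleC[OF S] D\<^sub>R_D)

lemma isotropic_trace: "v \<in> D\<^sub>R \<Longrightarrow> cinner (J (R b)) (T v) = 0"
  using isotropic[of b "T v"] by (simp add: D\<^sub>R_def)

lemma Green_D\<^sub>R:
  assumes "w \<in> D" "v \<in> D\<^sub>R"
  shows "cinner (S w) v = cinner w (S v) + cinner (J (T w - R (T w))) (T v)"
  using Green[OF assms(1) D\<^sub>R_D[OF assms(2)]] isotropic_trace[OF assms(2)]
  by (simp add: bounded_clinear_diff[OF J] cinner_diff_left algebra_simps)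

lemma symmetric_D\<^sub>R: "w \<in> D\<^sub>R \<Longrightarrow> v \<in> D\<^sub>R \<Longrightarrow> cinner (S w) v = cinner w (S v)"
  using Green_D\<^sub>R[of w v] bounded_clinear_zero[OF J] by (simp add: D\<^sub>R_def)

text \<open>The range of \<open>S\<close> on \<open>D\<^sub>R\<close> is closed, so that \<open>h\<close> can be projected onto it; by maximality the
  remainder, being orthogonal to this range, lies in the kernel \<open>E\<close>.\<close>

lemma range_kernel_decomposition:
  obtains v k where "v \<in> D\<^sub>R" "k \<in> E" "h = S v + k"
proof -
  have "csubspace (S ` D\<^sub>R)"
  proof (rule csubspaceI)
    show "0 \<in> S ` D\<^sub>R"
      using clinear_on_zero[OF S] csubspace_zero[OF D\<^sub>R] by (metis imageI)
    show "x + y \<in> S ` D\<^sub>R" if "x \<in> S ` D\<^sub>R" "y \<in> S ` D\<^sub>R" for x y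
      using that clinear_on_add[OF S] csubspace_add[OF D\<^sub>R] D\<^sub>R_D by (smt (verit) image_iff)
    show "c *\<^sub>C x \<in> S ` D\<^sub>R" if "x \<in> S ` D\<^sub>R" for c x
      using that clinear_on_scaleC[OF S] csubspace_scaleC[OF D\<^sub>R] D\<^sub>R_D by (smt (verit) image_iff)
  qed
  moreover have "closed (S ` D\<^sub>R)"
    using closed_range by (simp add: D\<^sub>R_def)
  ultimately obtain v where v: "v \<in> D\<^sub>R" "\<And>v'. v' \<in> D\<^sub>R \<Longrightarrow> cinner (h - S v) (S v') = 0"
    using orthogonal_projection_exists[of "S ` D\<^sub>R" h] by auto
  have "cinner (S v') (h - S v) = 0" if "v' \<in> D" "R (T v') = T v'" for v'
    using v(2)[of v'] that cinner_commute[of "S v'" "h - S v"] by (simp add: D\<^sub>R_def)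
  then have "h - S v \<in> E"
    using maximal[of "h - S v"] by (simp add: E_def D\<^sub>R_def)
  then show thesis using that[of v "h - S v"] v(1) by simp
qed

definition proj :: "'h \<Rightarrow> 'h"
  where "proj h = (THE k. k \<in> E \<and> (\<forall>k'\<in>E. cinner (h - k) k' = 0))"

lemma proj_eqI:
  assumes "k \<in> E" "\<And>k'. k' \<in> E \<Longrightarrow> cinner (h - k) k' = 0"
  shows "proj h = k"
  unfolding proj_def
proof (rule the_equality)
  fix k1 assume k1: "k1 \<in> E \<and> (\<forall>k'\<in>E. cinner (h - k1) k' = 0)"
  then have "k - k1 \<in> E" using csubspace_diff[OF E] assms(1) by blast
  then have "cinner (h - k1) (k - k1) - cinner (h - k) (k - k1) = 0"
    using k1 assms by simp
  then have "cinner (k - k1) (k - k1) = 0"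
    by (simp add: cinner_diff_left)
  then show "k1 = k" by (simp add: cinner_self)
qed (use assms in blast)

lemma proj: "proj h \<in> E" "k \<in> E \<Longrightarrow> cinner (proj h) k = cinner h k"
proof -
  obtain v k where vk: "v \<in> D\<^sub>R" "k \<in> E" "h = S v + k"
    using range_kernel_decomposition by blast
  have "cinner (S v) k' = 0" if "k' \<in> E" for k'
    using symmetric_D\<^sub>R[of v k'] vk(1) that by (simp add: E_def)
  then have orth: "cinner (h - k) k' = 0" if "k' \<in> E" for k'
    using that vk(3) by simp
  then have *: "proj h = k"
    by (intro proj_eqI vk)
  show "proj h \<in> E" by (metis * vk(2))
  show "cinner (proj h) k = cinner h k" if "k \<in> E" for k
    using orth[OF that] by (simp add: * cinner_diff_left)
qed

lemma proj_fixes: "k \<in> E \<Longrightarrow> proj k = k"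
  by (rule proj_eqI) simp_all

lemma S_proj: "S (proj h) = 0"
  using proj(1)[of h] by (simp add: E_def)

lemma proj_symmetric: "cinner (proj h) h' = cinner h (proj h')"
  by (metis proj cinner_commute)

lemma proj_add: "proj (x + y) = proj x + proj y"
  by (rule proj_eqI) (simp_all add: proj csubspace_add[OF E] cinner_simps)

lemma proj_scaleC: "proj (c *\<^sub>C x) = c *\<^sub>C proj x"
  by (rule proj_eqI) (simp_all add: proj csubspace_scaleC[OF E] cinner_simps)

lemma norm_proj: "norm (proj h) \<le> norm h"
proof (cases "proj h = 0")
  case False
  have "cinner (proj h) (proj h) = cinner h (proj h)"
    by (rule proj(2)[OF proj(1)])
  then have "(norm (proj h))\<^sup>2 \<le> norm h * norm (proj h)"
    unfolding norm_square_cinner[of "proj h"]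
    using complex_Re_le_cmod[of "cinner h (proj h)"] Cauchy_Schwarz[of h "proj h"] by simp
  then show ?thesis using False by (simp add: power2_eq_square)
qed simp

lemma proj_bounded: "bounded_clinear proj"
  by (rule bounded_clinearI[where K = 1]) (simp_all add: proj_add proj_scaleC norm_proj)

text \<open>Adding \<open>proj\<close> removes the kernel and fills up the missing part of the range.\<close>

lemma regularized_injective:
  assumes "v \<in> D\<^sub>R" "S v + proj v = 0"
  shows "v = 0"
proof -
  have "cinner (S v) (proj v) = 0"
    using symmetric_D\<^sub>R[OF assms(1) E_D\<^sub>R[OF proj(1)], of v] by (simp add: S_proj)
  moreover have "cinner (S v + proj v) (proj v) = 0"
    by (simp add: assms)
  ultimately have "proj v = 0"
    by (simp add: cinner_add_left cinner_self)
  then have "v \<in> E" using assms by (simp add: E_def)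
  then show ?thesis using proj_fixes[of v] \<open>proj v = 0\<close> by simp
qed

lemma regularized_surjective:
  obtains v where "v \<in> D\<^sub>R" "S v + proj v = f"
proof -
  obtain v0 k where v0: "v0 \<in> D\<^sub>R" "k \<in> E" "f = S v0 + k"
    using range_kernel_decomposition by blast
  have kE: "k - proj v0 \<in> E" by (rule csubspace_diff[OF E v0(2) proj(1)])
  have "S (v0 + (k - proj v0)) = S v0"
    using kE v0(1) by (subst clinear_on_add[OF S]) (auto simp: D\<^sub>R_D E_D\<^sub>R, simp add: E_def)
  moreover have "proj (v0 + (k - proj v0)) = k"
    by (simp add: proj_add proj_fixes[OF kE])
  moreover have "v0 + (k - proj v0) \<in> D\<^sub>R"
    by (rule csubspace_add[OF D\<^sub>R v0(1) E_D\<^sub>R[OF kE]])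
  ultimately show thesis using that v0(3) by metis
qed

definition green_op :: "'h \<Rightarrow> 'h"
  where "green_op f = (THE v. v \<in> D\<^sub>R \<and> S v + proj v = f)"

lemma green_op_eqI:
  assumes "v \<in> D\<^sub>R" "S v + proj v = f"
  shows "green_op f = v"
  unfolding green_op_def
proof (rule the_equality)
  fix w assume w: "w \<in> D\<^sub>R \<and> S w + proj w = f"
  have "S (w - v) + proj (w - v) = (S w + proj w) - (S v + proj v)"
    using w assms(1)
    by (simp add: clinear_on_diff[OF S] D\<^sub>R_D bounded_clinear_diff[OF proj_bounded])
  then have "S (w - v) + proj (w - v) = 0"
    using w assms(2) by simp
  moreover have "w - v \<in> D\<^sub>R"
    using w assms(1) csubspace_diff[OF D\<^sub>R] by blast
  ultimately have "w - v = 0"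
    using regularized_injective by blast
  then show "w = v" by simp
qed (use assms in blast)

lemma green_op: "green_op f \<in> D\<^sub>R" "S (green_op f) + proj (green_op f) = f"
proof -
  obtain v where "v \<in> D\<^sub>R" "S v + proj v = f"
    using regularized_surjective by blast
  then show "green_op f \<in> D\<^sub>R" "S (green_op f) + proj (green_op f) = f"
    by (simp_all add: green_op_eqI)
qed

lemma green_op_bounded: "bounded_clinear green_op"
proof (rule symmetric_everywhere_imp_bounded)
  have "green_op (x + y) = green_op x + green_op y" for x y
  proof (rule green_op_eqI)
    show "S (green_op x + green_op y) + proj (green_op x + green_op y) = x + y"
      using green_op[of x] green_op[of y]
      by (simp add: clinear_on_add[OF S] D\<^sub>R_D proj_add algebra_simps)
  qed (intro csubspace_add[OF D\<^sub>R] green_op)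
  moreover have "green_op (c *\<^sub>C x) = c *\<^sub>C green_op x" for c x
  proof (rule green_op_eqI)
    show "S (c *\<^sub>C green_op x) + proj (c *\<^sub>C green_op x) = c *\<^sub>C x"
      using green_op[of x]
      by (simp add: clinear_on_scaleC[OF S] D\<^sub>R_D proj_scaleC flip: scaleC_add_right)
  qed (intro csubspace_scaleC[OF D\<^sub>R] green_op)
  ultimately show "clinear_on UNIV green_op"
    by (auto simp: clinear_on_def complex_vs.subspace_UNIV)
  show "cinner (green_op x) y = cinner x (green_op y)" for x y
  proof -
    have "cinner (green_op x) (S (green_op y) + proj (green_op y))
        = cinner (S (green_op x) + proj (green_op x)) (green_op y)"
      by (simp add: cinner_simps proj_symmetric symmetric_D\<^sub>R green_op(1))
    then show ?thesis by (simp add: green_op(2))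
  qed
qed

text \<open>The boundary value \<open>b\<close> is prescribed only modulo the range of \<open>R\<close>, which keeps the data in
  the full space \<open>'l\<close> rather than in the range of \<open>1 - R\<close>.\<close>

definition solve :: "'h \<times> 'l \<Rightarrow> 'h"
  where "solve z = (THE w. w \<in> D \<and> S w + proj w = fst z \<and> T w - R (T w) = snd z - R (snd z))"

lemma solve_eqI:
  assumes "w \<in> D" "S w + proj w = f" "T w - R (T w) = b - R b"
  shows "solve (f, b) = w"
  unfolding solve_def
proof (rule the_equality)
  fix v assume v: "v \<in> D \<and> S v + proj v = fst (f, b) \<and> T v - R (T v) = snd (f, b) - R (snd (f, b))"
  have vw: "v - w \<in> D" using v assms csubspace_diff[OF D] by blast
  have "T (v - w) - R (T (v - w)) = (T v - R (T v)) - (T w - R (T w))"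
    using v assms(1) by (simp add: clinear_on_diff[OF T] bounded_clinear_diff[OF R])
  then have "v - w \<in> D\<^sub>R"
    using v assms(3) vw by (simp add: D\<^sub>R_def)
  moreover have "S (v - w) + proj (v - w) = (S v + proj v) - (S w + proj w)"
    using v assms(1) by (simp add: clinear_on_diff[OF S] bounded_clinear_diff[OF proj_bounded])
  then have "S (v - w) + proj (v - w) = 0"
    using v assms(2) by simp
  ultimately show "v = w" using regularized_injective by fastforce
qed (use assms in auto)

lemma solve:
  shows "solve (f, b) \<in> D" "S (solve (f, b)) + proj (solve (f, b)) = f"
    "T (solve (f, b)) - R (T (solve (f, b))) = b - R b"
proof -
  obtain w0 where w0: "w0 \<in> D" "T w0 = b - R b" using T_surj by blast
  define v where "v = green_op (f - (S w0 + proj w0))"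
  have v: "v \<in> D\<^sub>R" "S v + proj v = f - (S w0 + proj w0)"
    unfolding v_def by (rule green_op)+
  have 1: "w0 + v \<in> D" using w0 v D\<^sub>R_D csubspace_add[OF D] by blast
  have 2: "S (w0 + v) + proj (w0 + v) = f"
    using w0 v by (simp add: clinear_on_add[OF S] D\<^sub>R_D proj_add algebra_simps)
  have "T (w0 + v) = b - R b + T v" "R (T v) = T v"
    using w0 v by (auto simp: clinear_on_add[OF T] D\<^sub>R_D) (simp add: D\<^sub>R_def)
  then have 3: "T (w0 + v) - R (T (w0 + v)) = b - R b"
    by (simp add: bounded_clinear_add[OF R] bounded_clinear_diff[OF R] RR)
  have "solve (f, b) = w0 + v" by (rule solve_eqI[OF 1 2 3])
  then show "solve (f, b) \<in> D" "S (solve (f, b)) + proj (solve (f, b)) = f"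
    "T (solve (f, b)) - R (T (solve (f, b))) = b - R b"
    using 1 2 3 by simp_all
qed

lemma solve_add: "solve (z + z') = solve z + solve z'"
proof -
  obtain f b f' b' where z: "z = (f, b)" "z' = (f', b')" by (metis surj_pair)
  have "solve (f + f', b + b') = solve (f, b) + solve (f', b')"
  proof (rule solve_eqI)
    show "S (solve (f, b) + solve (f', b')) + proj (solve (f, b) + solve (f', b')) = f + f'"
      using solve(1,2)[of f b] solve(1,2)[of f' b']
      by (simp add: clinear_on_add[OF S] proj_add algebra_simps)
    show "T (solve (f, b) + solve (f', b')) - R (T (solve (f, b) + solve (f', b')))
        = b + b' - R (b + b')"
    proof -
      have "T (solve (f, b) + solve (f', b')) - R (T (solve (f, b) + solve (f', b')))
          = (T (solve (f, b)) - R (T (solve (f, b)))) + (T (solve (f', b')) - R (T (solve (f', b'))))"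
        by (simp add: clinear_on_add[OF T solve(1) solve(1)] bounded_clinear_add[OF R])
      then show ?thesis by (simp add: solve(3) bounded_clinear_add[OF R])
    qed
  qed (intro csubspace_add[OF D] solve)
  then show ?thesis by (simp add: z)
qed

lemma solve_scaleC: "solve (c *\<^sub>C z) = c *\<^sub>C solve z"
proof -
  obtain f b where z: "z = (f, b)" by (metis surj_pair)
  have "solve (c *\<^sub>C f, c *\<^sub>C b) = c *\<^sub>C solve (f, b)"
  proof (rule solve_eqI)
    show "S (c *\<^sub>C solve (f, b)) + proj (c *\<^sub>C solve (f, b)) = c *\<^sub>C f"
      using solve(1,2)[of f b] by (simp add: clinear_on_scaleC[OF S] proj_scaleC flip: scaleC_add_right)
    show "T (c *\<^sub>C solve (f, b)) - R (T (c *\<^sub>C solve (f, b))) = c *\<^sub>C b - R (c *\<^sub>C b)"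
      using solve(1,3)[of f b]
      by (simp add: clinear_on_scaleC[OF T] bounded_clinear_scaleC[OF R]
          flip: complex_vs.scale_right_diff_distrib)
  qed (intro csubspace_scaleC[OF D] solve)
  then show ?thesis by (simp add: z scaleC_prod_def)
qed

text \<open>Testing \<open>w = solve (f, b)\<close> against \<open>h = S v + proj v\<close> with \<open>v = green_op h\<close> and moving \<open>S\<close> to
  the other side bounds \<open>cinner w h\<close> by the data, because \<open>v\<close> and \<open>T v\<close> depend boundedly on \<open>h\<close>; the
  choice \<open>h = w\<close> gives the estimate.\<close>

lemma solve_bounded:
  "\<exists>C>0. \<forall>z. norm (solve z) \<le> C * norm z \<and> norm (S (solve z)) \<le> C * norm z \<and>
    norm (T (solve z)) \<le> C * norm z"
proof -
  obtain Kg where Kg: "0 < Kg" "\<And>h. norm (green_op h) \<le> Kg * norm h"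
    using bounded_clinear_bounded[OF green_op_bounded] by blast
  obtain Kj where Kj: "0 < Kj" "\<And>b. norm (J b) \<le> Kj * norm b"
    using bounded_clinear_bounded[OF J] by blast
  obtain Kr where Kr: "0 < Kr" "\<And>b. norm (R b) \<le> Kr * norm b"
    using bounded_clinear_bounded[OF R] by blast
  obtain Kt' where Kt': "\<And>w. w \<in> D \<Longrightarrow> norm (T w) \<le> Kt' * (norm w + norm (S w))"
    using T_bound by blast
  define Kt where "Kt = max Kt' 0"
  have Kt: "norm (T w) \<le> Kt * (norm w + norm (S w))" if "w \<in> D" for w
    using Kt'[OF that] by (rule order_trans) (simp add: Kt_def mult_right_mono)
  have Kt0: "0 \<le> Kt" by (simp add: Kt_def)
  have SS: "norm (S (solve z)) \<le> norm z + norm (solve z)" for z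
  proof -
    have "S (solve z) = fst z - proj (solve z)"
      using solve(2)[of "fst z" "snd z"] by (simp add: algebra_simps)
    then have "norm (S (solve z)) \<le> norm (fst z) + norm (proj (solve z))"
      by (simp add: norm_triangle_ineq4)
    then show ?thesis
      using norm_fst_le[of "fst z" "snd z"] norm_proj[of "solve z"] by simp
  qed
  define Cb where "Cb = Kg + Kj * (1 + Kr) * (Kt * (1 + 2 * Kg))"
  have Cb: "norm (solve (f, b)) \<le> Cb * norm (f, b)" for f b
  proof -
    define w where "w = solve (f, b)"
    define v where "v = green_op w"
    have v: "v \<in> D\<^sub>R" "S v + proj v = w"
      unfolding v_def by (rule green_op)+
    have w: "w \<in> D" "S w + proj w = f" "T w - R (T w) = b - R b"
      unfolding w_def by (rule solve)+
    have nv: "norm v \<le> Kg * norm w" unfolding v_def by (rule Kg)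
    have "S v = w - proj v" using v(2) by (simp add: algebra_simps)
    then have "norm (S v) \<le> norm w + norm v"
      using norm_triangle_ineq4[of w "proj v"] norm_proj[of v] by simp
    then have "norm v + norm (S v) \<le> (1 + 2 * Kg) * norm w"
      using nv by (simp add: algebra_simps)
    then have nT: "norm (T v) \<le> Kt * (1 + 2 * Kg) * norm w"
      using order_trans[OF Kt[OF D\<^sub>R_D[OF v(1)]] mult_left_mono[OF _ Kt0]] by (simp add: mult.assoc)
    have "norm (b - R b) \<le> norm b + norm (R b)" by (rule norm_triangle_ineq4)
    then have nb: "norm (b - R b) \<le> (1 + Kr) * norm b"
      using Kr(2)[of b] by (simp add: algebra_simps)
    have "(1 + Kr) * norm b \<le> (1 + Kr) * norm (f, b)"
      using Kr(1) by (intro mult_left_mono norm_snd_le) simp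
    then have "norm (b - R b) \<le> (1 + Kr) * norm (f, b)"
      using nb by simp
    then have nJ: "norm (J (b - R b)) \<le> Kj * (1 + Kr) * norm (f, b)"
      using order_trans[OF Kj(2) mult_left_mono] Kj(1) by (simp add: mult.assoc)
    have "cinner w w = cinner w (S v) + cinner w (proj v)"
      by (simp add: v(2) flip: cinner_add_right)
    also have "\<dots> = cinner (S w + proj w) v - cinner (J (b - R b)) (T v)"
      using Green_D\<^sub>R[OF w(1) v(1)] by (simp add: w(3) cinner_add_left proj_symmetric)
    also have "\<dots> = cinner f v - cinner (J (b - R b)) (T v)"
      by (simp add: w(2))
    finally have "cmod (cinner w w) \<le> cmod (cinner f v) + cmod (cinner (J (b - R b)) (T v))"
      by (simp add: norm_triangle_ineq4)
    also have "\<dots> \<le> norm f * norm v + norm (J (b - R b)) * norm (T v)"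
      by (intro add_mono Cauchy_Schwarz)
    also have "\<dots> \<le> norm (f, b) * (Kg * norm w) +
        (Kj * (1 + Kr) * norm (f, b)) * (Kt * (1 + 2 * Kg) * norm w)"
      using norm_fst_le[of f b]
      by (intro add_mono mult_mono nv nT nJ) (use Kj Kr in auto)
    also have "\<dots> = Cb * norm (f, b) * norm w"
      by (simp add: Cb_def algebra_simps)
    finally have "norm w * norm w \<le> (Cb * norm (f, b)) * norm w"
      by (simp add: cinner_self power2_eq_square norm_mult)
    moreover have "0 \<le> Cb" unfolding Cb_def using Kg Kj Kr Kt0 by simp
    ultimately show ?thesis unfolding w_def[symmetric]
      by (cases "w = 0") auto
  qed
  have Cb': "norm (solve z) \<le> Cb * norm z" for z
    using Cb[of "fst z" "snd z"] by simp
  have "0 \<le> Cb" unfolding Cb_def using Kg Kj Kr Kt0 by simp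
  have SC: "norm (S (solve z)) \<le> (1 + Cb) * norm z" for z
    using SS[of z] Cb'[of z] by (simp add: algebra_simps)
  have TC: "norm (T (solve z)) \<le> Kt * (1 + 2 * Cb) * norm z" for z
  proof -
    have "norm (solve z) + norm (S (solve z)) \<le> (1 + 2 * Cb) * norm z"
      using SC[of z] Cb'[of z] by (simp add: algebra_simps)
    moreover have "solve z \<in> D" using solve(1)[of "fst z" "snd z"] by simp
    ultimately show ?thesis
      using order_trans[OF Kt mult_left_mono[OF _ Kt0]] by (simp add: mult.assoc)
  qed
  define C where "C = 1 + Cb + Kt * (1 + 2 * Cb)"
  have le: "Cb \<le> C" "1 + Cb \<le> C" "Kt * (1 + 2 * Cb) \<le> C" "0 < C"
    using \<open>0 \<le> Cb\<close> Kt0 mult_nonneg_nonneg[of Kt "1 + 2 * Cb"] unfolding C_def by linarith+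
  show ?thesis
  proof (intro exI[of _ C] conjI allI le(4))
    fix z
    show "norm (solve z) \<le> C * norm z"
      by (rule order_trans[OF Cb' mult_right_mono[OF le(1) norm_ge_zero]])
    show "norm (S (solve z)) \<le> C * norm z"
      by (rule order_trans[OF SC mult_right_mono[OF le(2) norm_ge_zero]])
    show "norm (T (solve z)) \<le> C * norm z"
      by (rule order_trans[OF TC mult_right_mono[OF le(3) norm_ge_zero]])
  qed
qed

lemma solve_bounded_clinear: "bounded_clinear solve"
proof -
  obtain C where "\<And>z. norm (solve z) \<le> C * norm z"
    using solve_bounded by blast
  then show ?thesis
    by (rule bounded_clinearI[OF solve_add solve_scaleC])
qed

text \<open>The right-hand side is the obstruction to solving \<open>S w = f\<close> with the boundary value \<open>b\<close> modulo
  the range of \<open>R\<close>: by the Green identity it vanishes on all data that come from such a \<open>w\<close>.\<close>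

lemma cinner_solve_kernel:
  assumes "k \<in> E"
  shows "cinner (solve (f, b)) k = cinner f k - cinner (J b) (T k)"
proof -
  let ?w = "solve (f, b)"
  have kD: "k \<in> D\<^sub>R" and Sk: "S k = 0"
    using assms by (auto simp: E_def)
  have "cinner (S ?w) k = cinner (J (b - R b)) (T k)"
    using Green_D\<^sub>R[OF solve(1) kD, of f b] by (simp add: Sk solve(3))
  also have "\<dots> = cinner (J b) (T k)"
    by (simp add: bounded_clinear_diff[OF J] cinner_diff_left isotropic_trace[OF kD])
  finally have "cinner (J b) (T k) + cinner (proj ?w) k = cinner (S ?w + proj ?w) k"
    by (simp add: cinner_add_left)
  then have "cinner (J b) (T k) + cinner (proj ?w) k = cinner f k"
    by (simp only: solve(2))
  then show ?thesis
    using proj(2)[OF assms, of ?w] by (simp add: algebra_simps)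
qed

lemma u_E: "i < g \<Longrightarrow> u i \<in> E"
proof -
  assume "i < g"
  then have "u i \<in> cspan (u ` {..<g})" by (intro complex_vs.span_base) auto
  then show ?thesis using basis by (simp add: is_cbasis_def E_def D\<^sub>R_def conj_assoc)
qed

lemma u_span: "k \<in> E \<Longrightarrow> \<exists>c. k = (\<Sum>i<g. c i *\<^sub>C u i)"
proof -
  assume "k \<in> E"
  then have "k \<in> cspan (u ` {..<g})"
    using basis by (simp add: is_cbasis_def E_def D\<^sub>R_def conj_assoc)
  then obtain c where "k = (\<Sum>v\<in>u ` {..<g}. c v *\<^sub>C v)"
    by (auto simp: complex_vs.span_finite)
  then show ?thesis
    using basis by (intro exI[of _ "\<lambda>i. c (u i)"]) (simp add: is_cbasis_def sum.reindex)
qed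

lemma u_independent:
  assumes "(\<Sum>i<g. c i *\<^sub>C u i) = 0" "i < g"
  shows "c i = 0"
proof -
  have inj: "inj_on u {..<g}" using basis by (simp add: is_cbasis_def)
  have "(\<Sum>v\<in>u ` {..<g}. c (the_inv_into {..<g} u v) *\<^sub>C v) = (\<Sum>i<g. c i *\<^sub>C u i)"
    by (subst sum.reindex[OF inj]) (auto intro!: sum.cong simp: the_inv_into_f_f[OF inj])
  then have "c (the_inv_into {..<g} u (u i)) = 0"
    using assms basis
    by (intro complex_vs.independentD[of "u ` {..<g}" "u ` {..<g}" "\<lambda>v. c (the_inv_into {..<g} u v)"])
      (auto simp: is_cbasis_def)
  then show ?thesis using assms(2) by (simp add: the_inv_into_f_f[OF inj])
qed

text \<open>What \<open>proj\<close> added to the problem, as an operator on the data: \<open>S w\<close> is the first component of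
  \<open>z - kernel_part z\<close> for \<open>w = solve z\<close>.\<close>

definition kernel_part :: "'h \<times> 'l \<Rightarrow> 'h \<times> 'l"
  where "kernel_part z = (proj (solve z), 0)"

lemma solve_kernel: "k \<in> E \<Longrightarrow> solve (k, 0) = k"
  by (rule solve_eqI) (auto simp: E_def D\<^sub>R_def proj_fixes bounded_clinear_zero[OF R])

lemma sum_pair_zero: "(\<Sum>i\<in>A. c i *\<^sub>C (x i, 0)) = ((\<Sum>i\<in>A. c i *\<^sub>C x i), 0)"
  by (induction A rule: infinite_finite_induct) (auto simp: scaleC_prod_def zero_prod_def)

text \<open>The vectors \<open>u i\<close> solve their own problem with data \<open>(u i, 0)\<close>, which is why these data are
  fixed.\<close>

sublocale finite_rank_projection g "\<lambda>i. (u i, 0)" kernel_part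
proof
  have "bounded_clinear (\<lambda>z. proj (solve z))"
    by (rule bounded_clinear_compose[OF proj_bounded solve_bounded_clinear])
  then show "bounded_clinear kernel_part"
    unfolding kernel_part_def bounded_op_on_def clinear_on_def
    by (simp add: scaleC_prod_def)
  show "\<exists>c. kernel_part z = (\<Sum>i<g. c i *\<^sub>C (u i, 0))" for z
    using u_span[OF proj(1), of "solve z"] by (auto simp: kernel_part_def sum_pair_zero)
  show "kernel_part (u i, 0) = (u i, 0)" if "i < g" for i
    using u_E[OF that] by (simp add: kernel_part_def solve_kernel proj_fixes)
  show "c i = 0" if "(\<Sum>i<g. c i *\<^sub>C (u i, 0 :: 'l)) = 0" "i < g" for c i
    using that u_independent[of c] by (simp add: sum_pair_zero zero_prod_def)
qed

end

subsection \<open>Perturbed boundary value problems\<close>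

context boundary_problem
begin

text \<open>The interior operator \<open>S\<close> is changed by the bounded operator \<open>B\<close>, the boundary map to \<open>T\<^sub>1\<close>
  and the projection to \<open>R\<^sub>1\<close>. The boundary maps are compared in the graph norm of \<open>S\<close>, for
  which \<open>T\<close> is bounded.\<close>

definition near_problem :: "real \<Rightarrow> ('h \<Rightarrow> 'h) \<Rightarrow> ('h \<Rightarrow> 'l) \<Rightarrow> ('l \<Rightarrow> 'l) \<Rightarrow> bool"
  where "near_problem \<epsilon> B T\<^sub>1 R\<^sub>1 \<longleftrightarrow>
    clinear_on UNIV B \<and> clinear_on D T\<^sub>1 \<and> clinear_on UNIV R\<^sub>1 \<and> (\<forall>b. R\<^sub>1 (R\<^sub>1 b) = R\<^sub>1 b) \<and>
    (\<forall>w. norm (B w) \<le> \<epsilon> * norm w) \<and>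
    (\<forall>w\<in>D. norm (T\<^sub>1 w - T w) \<le> \<epsilon> * (norm w + norm (S w))) \<and>
    (\<forall>b. norm (R\<^sub>1 b - R b) \<le> \<epsilon> * norm b)"

definition boundary_defect :: "('h \<Rightarrow> 'l) \<Rightarrow> ('l \<Rightarrow> 'l) \<Rightarrow> 'h \<Rightarrow> 'l"
  where "boundary_defect T\<^sub>1 R\<^sub>1 w = (T\<^sub>1 w - R\<^sub>1 (T\<^sub>1 w)) - (T w - R (T w))"

definition perturbation :: "('h \<Rightarrow> 'h) \<Rightarrow> ('h \<Rightarrow> 'l) \<Rightarrow> ('l \<Rightarrow> 'l) \<Rightarrow> 'h \<times> 'l \<Rightarrow> 'h \<times> 'l"
  where "perturbation B T\<^sub>1 R\<^sub>1 z =
    (B (solve z), boundary_defect T\<^sub>1 R\<^sub>1 (solve z) - R (boundary_defect T\<^sub>1 R\<^sub>1 (solve z)))"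

lemma solve_D: "solve z \<in> D"
  using solve(1)[of "fst z" "snd z"] by simp

lemma perturbation_clinear:
  assumes "near_problem \<epsilon> B T\<^sub>1 R\<^sub>1"
  shows "clinear_on UNIV (perturbation B T\<^sub>1 R\<^sub>1)"
proof -
  have B: "clinear_on UNIV B" and T\<^sub>1: "clinear_on D T\<^sub>1" and R\<^sub>1: "clinear_on UNIV R\<^sub>1"
    using assms by (auto simp: near_problem_def)
  have add: "boundary_defect T\<^sub>1 R\<^sub>1 (v + w) = boundary_defect T\<^sub>1 R\<^sub>1 v + boundary_defect T\<^sub>1 R\<^sub>1 w"
    if "v \<in> D" "w \<in> D" for v w
    using that by (simp add: boundary_defect_def clinear_on_add[OF T\<^sub>1] clinear_on_add[OF T]
        clinear_on_add[OF R\<^sub>1] bounded_clinear_add[OF R])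
  have scale: "boundary_defect T\<^sub>1 R\<^sub>1 (c *\<^sub>C w) = c *\<^sub>C boundary_defect T\<^sub>1 R\<^sub>1 w"
    if "w \<in> D" for c w
    using that by (simp add: boundary_defect_def clinear_on_scaleC[OF T\<^sub>1] clinear_on_scaleC[OF T]
        clinear_on_scaleC[OF R\<^sub>1] bounded_clinear_scaleC[OF R]
        flip: complex_vs.scale_right_diff_distrib)
  have "perturbation B T\<^sub>1 R\<^sub>1 (z + z') = perturbation B T\<^sub>1 R\<^sub>1 z + perturbation B T\<^sub>1 R\<^sub>1 z'" for z z'
    by (simp add: perturbation_def solve_add add solve_D clinear_on_add[OF B] bounded_clinear_add[OF R])
  moreover have "perturbation B T\<^sub>1 R\<^sub>1 (c *\<^sub>C z) = c *\<^sub>C perturbation B T\<^sub>1 R\<^sub>1 z" for c z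
    by (simp only: perturbation_def solve_scaleC scale[OF solve_D] clinear_on_scaleC[OF B UNIV_I]
        bounded_clinear_scaleC[OF R] complex_vs.scale_right_diff_distrib[symmetric])
      (simp add: scaleC_prod_def)
  ultimately show ?thesis
    by (auto simp: clinear_on_def complex_vs.subspace_UNIV)
qed

text \<open>\<open>solve\<close> bounds the graph norm of \<open>w\<close> by the data, and the change of \<open>(1 - R) T w\<close> splits into
  the changes of \<open>T w\<close> and of \<open>R (T w)\<close>.\<close>

lemma perturbation_bound:
  "\<exists>C>0. \<forall>\<epsilon> B T\<^sub>1 R\<^sub>1 z. 0 \<le> \<epsilon> \<longrightarrow> \<epsilon> \<le> 1 \<longrightarrow> near_problem \<epsilon> B T\<^sub>1 R\<^sub>1 \<longrightarrow>
    norm (perturbation B T\<^sub>1 R\<^sub>1 z) \<le> C * \<epsilon> * norm z"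
proof -
  obtain C where C0: "0 < C" and C: "\<And>z. norm (solve z) \<le> C * norm z"
    "\<And>z. norm (S (solve z)) \<le> C * norm z" "\<And>z. norm (T (solve z)) \<le> C * norm z"
    using solve_bounded by blast
  obtain Kr where Kr0: "0 < Kr" and Kr: "\<And>b. norm (R b) \<le> Kr * norm b"
    using bounded_clinear_bounded[OF R] by blast
  define K where "K = C + (1 + Kr) * ((2 + Kr) * (2 * C) + C)"
  have "norm (perturbation B T\<^sub>1 R\<^sub>1 z) \<le> K * \<epsilon> * norm z"
    if \<epsilon>: "0 \<le> \<epsilon>" "\<epsilon> \<le> 1" and near: "near_problem \<epsilon> B T\<^sub>1 R\<^sub>1" for \<epsilon> B T\<^sub>1 R\<^sub>1 z
  proof -
    define w where "w = solve z"
    have w: "w \<in> D" by (simp add: w_def solve_D)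
    have lin: "clinear_on UNIV R\<^sub>1"
      and B: "norm (B w) \<le> \<epsilon> * norm w"
      and T\<^sub>1: "norm (T\<^sub>1 w - T w) \<le> \<epsilon> * (norm w + norm (S w))"
      and R\<^sub>1: "\<And>b. norm (R\<^sub>1 b - R b) \<le> \<epsilon> * norm b"
      using near w by (auto simp: near_problem_def)
    have nR\<^sub>1: "norm (R\<^sub>1 b) \<le> (1 + Kr) * norm b" for b
    proof -
      have "norm (R\<^sub>1 b) \<le> norm (R\<^sub>1 b - R b) + norm (R b)"
        using norm_triangle_ineq[of "R\<^sub>1 b - R b" "R b"] by simp
      also have "\<dots> \<le> 1 * norm b + Kr * norm b"
        using R\<^sub>1[of b] Kr[of b] mult_right_mono[OF \<epsilon>(2) norm_ge_zero[of b]] by linarith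
      finally show ?thesis by (simp add: algebra_simps)
    qed
    have "norm (T\<^sub>1 w - T w) \<le> \<epsilon> * (C * norm z + C * norm z)"
      by (rule order_trans[OF T\<^sub>1 mult_left_mono[OF add_mono \<epsilon>(1)]]) (simp_all add: w_def C)
    then have nT: "norm (T\<^sub>1 w - T w) \<le> 2 * C * \<epsilon> * norm z"
      by (simp add: algebra_simps)
    have nRT: "norm (R\<^sub>1 (T w) - R (T w)) \<le> C * \<epsilon> * norm z"
      using order_trans[OF R\<^sub>1 mult_left_mono[OF C(3)[of z] \<epsilon>(1)]] by (simp add: w_def mult_ac)
    define y where "y = boundary_defect T\<^sub>1 R\<^sub>1 w"
    have y_eq: "y = (T\<^sub>1 w - T w) - R\<^sub>1 (T\<^sub>1 w - T w) - (R\<^sub>1 (T w) - R (T w))"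
      by (simp add: y_def boundary_defect_def clinear_on_diff[OF lin])
    have "norm y \<le> norm (T\<^sub>1 w - T w) + norm (R\<^sub>1 (T\<^sub>1 w - T w)) + norm (R\<^sub>1 (T w) - R (T w))"
      unfolding y_eq using norm_triangle_ineq4[of "(T\<^sub>1 w - T w) - R\<^sub>1 (T\<^sub>1 w - T w)" "R\<^sub>1 (T w) - R (T w)"]
        norm_triangle_ineq4[of "T\<^sub>1 w - T w" "R\<^sub>1 (T\<^sub>1 w - T w)"] by linarith
    also have "\<dots> \<le> (2 + Kr) * norm (T\<^sub>1 w - T w) + C * \<epsilon> * norm z"
      using nR\<^sub>1[of "T\<^sub>1 w - T w"] nRT by (simp add: algebra_simps)
    also have "\<dots> \<le> (2 + Kr) * (2 * C * \<epsilon> * norm z) + C * \<epsilon> * norm z"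
      using mult_left_mono[OF nT, of "2 + Kr"] Kr0 by simp
    finally have ny: "norm y \<le> ((2 + Kr) * (2 * C) + C) * (\<epsilon> * norm z)"
      by (simp add: algebra_simps)
    have "norm (y - R y) \<le> norm y + norm (R y)"
      by (rule norm_triangle_ineq4)
    also have "\<dots> \<le> (1 + Kr) * norm y"
      using Kr[of y] by (simp add: algebra_simps)
    also have "\<dots> \<le> (1 + Kr) * (((2 + Kr) * (2 * C) + C) * (\<epsilon> * norm z))"
      using ny Kr0 by (intro mult_left_mono) auto
    finally have nyR: "norm (y - R y) \<le> (1 + Kr) * ((2 + Kr) * (2 * C) + C) * (\<epsilon> * norm z)"
      by (simp add: mult.assoc)
    have nB: "norm (B w) \<le> C * (\<epsilon> * norm z)"
      using order_trans[OF B mult_left_mono[OF C(1)[of z] \<epsilon>(1), folded w_def]] by (simp add: mult_ac)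
    have "norm (perturbation B T\<^sub>1 R\<^sub>1 z) \<le> norm (B w) + norm (y - R y)"
      unfolding perturbation_def w_def y_def by (rule norm_Pair_le)
    also have "\<dots> \<le> C * (\<epsilon> * norm z) + (1 + Kr) * ((2 + Kr) * (2 * C) + C) * (\<epsilon> * norm z)"
      by (rule add_mono[OF nB nyR])
    also have "\<dots> = K * \<epsilon> * norm z"
      unfolding K_def by (simp only: distrib_right mult.assoc)
    finally show ?thesis .
  qed
  moreover have "0 < K"
    unfolding K_def using C0 Kr0 by (intro add_pos_nonneg) auto
  ultimately show ?thesis by blast
qed

text \<open>With this perturbation \<open>W\<close> the operator \<open>1 - kernel_part + W\<close> becomes the boundary value problem
  with interior operator \<open>S + B\<close> and boundary condition \<open>T\<^sub>1 w \<in> range R\<^sub>1\<close>, transported by \<open>solve\<close>.\<close>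

lemma perturbed_operator:
  fixes f :: 'h and b :: 'l
  defines "w \<equiv> solve (f, b)"
  assumes "near_problem \<epsilon> B T\<^sub>1 R\<^sub>1"
  shows "(f, b) - kernel_part (f, b) + perturbation B T\<^sub>1 R\<^sub>1 (f, b) =
    (S w + B w, R b + ((T\<^sub>1 w - R\<^sub>1 (T\<^sub>1 w)) - R (T\<^sub>1 w - R\<^sub>1 (T\<^sub>1 w))))"
proof -
  have 1: "f - proj w = S w"
    using solve(2)[of f b] by (simp add: w_def algebra_simps)
  have 2: "T w - R (T w) = b - R b"
    unfolding w_def by (rule solve(3))
  then have "boundary_defect T\<^sub>1 R\<^sub>1 w = (T\<^sub>1 w - R\<^sub>1 (T\<^sub>1 w)) - (b - R b)"
    by (simp add: boundary_defect_def)
  then have 3: "boundary_defect T\<^sub>1 R\<^sub>1 w - R (boundary_defect T\<^sub>1 R\<^sub>1 w)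
      = ((T\<^sub>1 w - R\<^sub>1 (T\<^sub>1 w)) - R (T\<^sub>1 w - R\<^sub>1 (T\<^sub>1 w))) - (b - R b)"
    by (simp add: bounded_clinear_diff[OF R] RR)
  show ?thesis
    unfolding perturbation_def kernel_part_def w_def[symmetric] 3 using 1 by simp
qed

text \<open>Two projections at distance less than one: the complement of the range of one is mapped
  injectively by the complementary projection of the other.\<close>

lemma near_projection_injective:
  assumes near: "near_problem \<epsilon> B T\<^sub>1 R\<^sub>1" and "\<epsilon> < 1" and zero: "(c - R\<^sub>1 c) - R (c - R\<^sub>1 c) = 0"
  shows "R\<^sub>1 c = c"
proof -
  define y where "y = c - R\<^sub>1 c"
  have "R\<^sub>1 y = 0" and R\<^sub>1: "norm (R\<^sub>1 y - R y) \<le> \<epsilon> * norm y"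
    using near by (auto simp: near_problem_def y_def clinear_on_diff)
  moreover have "R y = y" using zero by (simp add: y_def)
  ultimately have "norm y \<le> \<epsilon> * norm y" by simp
  then have "(1 - \<epsilon>) * norm y \<le> 0" by (simp add: algebra_simps)
  then have "y = 0" using \<open>\<epsilon> < 1\<close> by (simp add: mult_le_0_iff)
  then show ?thesis by (simp add: y_def)
qed

context
  fixes \<epsilon> q :: real and B T\<^sub>1 R\<^sub>1
  assumes near: "near_problem \<epsilon> B T\<^sub>1 R\<^sub>1" and \<epsilon>: "\<epsilon> < 1"
    and q: "0 \<le> q" "q < 1" "\<And>z. norm (perturbation B T\<^sub>1 R\<^sub>1 z) \<le> q * norm z"
begin

lemma perturbed_kernel:
  assumes "z - kernel_part z + perturbation B T\<^sub>1 R\<^sub>1 z = 0" "z \<noteq> 0"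
  shows "\<exists>w\<in>D. w \<noteq> 0 \<and> R\<^sub>1 (T\<^sub>1 w) = T\<^sub>1 w \<and> S w + B w = 0"
proof -
  obtain f b where z: "z = (f, b)" by (metis surj_pair)
  define w where "w = solve (f, b)"
  have eq: "S w + B w = 0" "R b + ((T\<^sub>1 w - R\<^sub>1 (T\<^sub>1 w)) - R (T\<^sub>1 w - R\<^sub>1 (T\<^sub>1 w))) = 0"
    using assms(1) perturbed_operator[OF near, of f b] by (auto simp: z w_def zero_prod_def)
  have "R (R b + ((T\<^sub>1 w - R\<^sub>1 (T\<^sub>1 w)) - R (T\<^sub>1 w - R\<^sub>1 (T\<^sub>1 w)))) = R b"
    by (simp only: bounded_clinear_add[OF R] bounded_clinear_diff[OF R] RR diff_self add_0_right)
  then have Rb: "R b = 0"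
    using eq(2) bounded_clinear_zero[OF R] by simp
  then have "R\<^sub>1 (T\<^sub>1 w) = T\<^sub>1 w"
    using near_projection_injective[OF near \<epsilon>] eq(2) by simp
  moreover have "w \<noteq> 0"
  proof
    assume "w = 0"
    then have "f = 0" "b - R b = 0"
      using solve(2,3)[of f b]
      by (simp_all add: w_def clinear_on_zero[OF S] clinear_on_zero[OF T]
          bounded_clinear_zero[OF R] bounded_clinear_zero[OF proj_bounded])
    with Rb assms(2) show False by (simp add: z zero_prod_def)
  qed
  ultimately show ?thesis using eq(1) solve_D unfolding w_def by blast
qed

lemma singular_imp_kernel:
  assumes "Determinant.det (schur_matrix (perturbation B T\<^sub>1 R\<^sub>1)) = 0"
  shows "\<exists>w\<in>D. w \<noteq> 0 \<and> R\<^sub>1 (T\<^sub>1 w) = T\<^sub>1 w \<and> S w + B w = 0"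
proof -
  obtain z where "z - kernel_part z + perturbation B T\<^sub>1 R\<^sub>1 z = 0" "z \<noteq> 0"
    using schur_matrix_singular[OF perturbation_clinear[OF near] q assms] by blast
  then show ?thesis by (rule perturbed_kernel)
qed

lemma nonsingular_imp_inverse:
  assumes "Determinant.det (schur_matrix (perturbation B T\<^sub>1 R\<^sub>1)) \<noteq> 0"
  shows "\<exists>Q. bounded_clinear Q \<and>
    (\<forall>f. Q f \<in> D \<and> R\<^sub>1 (T\<^sub>1 (Q f)) = T\<^sub>1 (Q f) \<and> S (Q f) + B (Q f) = f) \<and>
    (\<forall>w\<in>D. R\<^sub>1 (T\<^sub>1 w) = T\<^sub>1 w \<longrightarrow> S w + B w = 0 \<longrightarrow> w = 0)"
proof -
  obtain L where L: "bounded_clinear L"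
    "\<And>z. L z - kernel_part (L z) + perturbation B T\<^sub>1 R\<^sub>1 (L z) = z"
    "\<And>z. z - kernel_part z + perturbation B T\<^sub>1 R\<^sub>1 z = 0 \<Longrightarrow> z = 0"
    using schur_matrix_nonsingular[OF perturbation_clinear[OF near] q assms] by blast
  define Q where "Q f = solve (L (f, 0))" for f
  have "bounded_clinear (\<lambda>f::'h. (f, 0::'l))"
    by (rule bounded_clinearI[where K = 1]) (auto simp: scaleC_prod_def)
  then have "bounded_clinear Q"
    unfolding Q_def
    by (rule bounded_clinear_compose[OF solve_bounded_clinear bounded_clinear_compose[OF L(1)]])
  moreover have "Q f \<in> D \<and> R\<^sub>1 (T\<^sub>1 (Q f)) = T\<^sub>1 (Q f) \<and> S (Q f) + B (Q f) = f" for f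
  proof -
    obtain f' b where fb: "L (f, 0) = (f', b)" by (metis surj_pair)
    have eq: "S (Q f) + B (Q f) = f"
      "R b + ((T\<^sub>1 (Q f) - R\<^sub>1 (T\<^sub>1 (Q f))) - R (T\<^sub>1 (Q f) - R\<^sub>1 (T\<^sub>1 (Q f)))) = 0"
      using L(2)[of "(f, 0)"] perturbed_operator[OF near, of f' b] by (auto simp: fb Q_def)
    have "R (R b + ((T\<^sub>1 (Q f) - R\<^sub>1 (T\<^sub>1 (Q f))) - R (T\<^sub>1 (Q f) - R\<^sub>1 (T\<^sub>1 (Q f))))) = R b"
      by (simp only: bounded_clinear_add[OF R] bounded_clinear_diff[OF R] RR diff_self add_0_right)
    then have "R b = 0"
      using eq(2) bounded_clinear_zero[OF R] by simp
    then have "R\<^sub>1 (T\<^sub>1 (Q f)) = T\<^sub>1 (Q f)"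
      using near_projection_injective[OF near \<epsilon>] eq(2) by simp
    then show ?thesis using eq(1) by (simp add: Q_def solve_D)
  qed
  moreover have "w = 0" if w: "w \<in> D" "R\<^sub>1 (T\<^sub>1 w) = T\<^sub>1 w" "S w + B w = 0" for w
  proof -
    have s: "solve (S w + proj w, T w - R (T w)) = w"
      by (rule solve_eqI) (simp_all add: w bounded_clinear_diff[OF R] RR)
    have "(S w + proj w, T w - R (T w)) = 0"
      by (rule L(3), subst perturbed_operator[OF near])
        (simp add: s w bounded_clinear_diff[OF R] RR bounded_clinear_zero[OF R] zero_prod_def)
    then show ?thesis using s bounded_clinear_zero[OF solve_bounded_clinear] by simp
  qed
  ultimately show ?thesis by blast
qed

end

text \<open>The derivative of the Schur matrix is the defect functional of \<open>u j\<close>, applied to the first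
  order change of the equations for \<open>u i\<close>; boundary terms in the range of \<open>R\<close> are annihilated.\<close>

lemma perturbation_has_derivative:
  fixes B :: "real \<Rightarrow> 'h \<Rightarrow> 'h" and T\<^sub>1 :: "real \<Rightarrow> 'h \<Rightarrow> 'l" and R\<^sub>1 :: "real \<Rightarrow> 'l \<Rightarrow> 'l"
    and \<epsilon> :: "real \<Rightarrow> real"
  assumes near: "\<forall>\<^sub>F t in at t0. near_problem (\<epsilon> t) (B t) (T\<^sub>1 t) (R\<^sub>1 t)"
    and \<epsilon>: "(\<epsilon> \<longlongrightarrow> 0) (at t0)" "\<forall>\<^sub>F t in at t0. 0 \<le> \<epsilon> t"
    and base: "\<And>w. B t0 w = 0" "\<And>w. w \<in> D \<Longrightarrow> T\<^sub>1 t0 w = T w" "R\<^sub>1 t0 = R"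
    and B': "((\<lambda>t. B t (u i)) has_vector_derivative \<beta>) (at t0)"
    and T': "((\<lambda>t. T\<^sub>1 t (u i)) has_vector_derivative \<theta>) (at t0)"
    and R': "((\<lambda>t. R\<^sub>1 t (T (u i))) has_vector_derivative \<rho>) (at t0)"
    and ij: "i < g" "j < g"
  shows "((\<lambda>t. schur_matrix (perturbation (B t) (T\<^sub>1 t) (R\<^sub>1 t)) $$ (j, i)) has_vector_derivative
      (cinner \<beta> (u j) + cinner (J \<rho>) (T (u j)) - cinner (J \<theta>) (T (u j)))) (at t0)"
proof -
  obtain C where C: "0 < C" "\<And>\<epsilon> B T\<^sub>1 R\<^sub>1 z. 0 \<le> \<epsilon> \<Longrightarrow> \<epsilon> \<le> 1 \<Longrightarrow> near_problem \<epsilon> B T\<^sub>1 R\<^sub>1 \<Longrightarrow>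
      norm (perturbation B T\<^sub>1 R\<^sub>1 z) \<le> C * \<epsilon> * norm z"
    using perturbation_bound by blast
  have uD: "u i \<in> D" and uR: "R (T (u i)) = T (u i)"
    using u_E[OF ij(1)] by (auto simp: E_def D\<^sub>R_def)
  have R1T: "((\<lambda>t. R\<^sub>1 t (T\<^sub>1 t (u i))) has_vector_derivative R \<theta> + \<rho>) (at t0)"
  proof -
    define d where "d t = (T\<^sub>1 t (u i) - T (u i)) /\<^sub>R (t - t0)" for t
    have d: "(d \<longlongrightarrow> \<theta>) (at t0)"
      using T' unfolding has_vector_derivative_iff_quotient d_def by (simp add: base uD)
    have rho: "((\<lambda>t. (R\<^sub>1 t (T (u i)) - R (T (u i))) /\<^sub>R (t - t0)) \<longlongrightarrow> \<rho>) (at t0)"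
      using R' unfolding has_vector_derivative_iff_quotient by (simp add: base)
    have "((\<lambda>t. R\<^sub>1 t (d t) - R (d t)) \<longlongrightarrow> 0) (at t0)"
    proof (rule Lim_null_comparison)
      show "((\<lambda>t. \<epsilon> t * norm (d t)) \<longlongrightarrow> 0) (at t0)"
        using tendsto_mult[OF \<epsilon>(1) tendsto_norm[OF d]] by simp
      show "\<forall>\<^sub>F t in at t0. norm (R\<^sub>1 t (d t) - R (d t)) \<le> \<epsilon> t * norm (d t)"
        using near by eventually_elim (simp add: near_problem_def)
    qed
    moreover have "((\<lambda>t. R (d t)) \<longlongrightarrow> R \<theta>) (at t0)"
      by (rule bounded_linear.tendsto[OF bounded_clinear_bounded_linear[OF R] d])
    ultimately have "((\<lambda>t. (R\<^sub>1 t (d t) - R (d t)) + R (d t) +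
        (R\<^sub>1 t (T (u i)) - R (T (u i))) /\<^sub>R (t - t0)) \<longlongrightarrow> 0 + R \<theta> + \<rho>) (at t0)"
      by (intro tendsto_add rho)
    moreover have "\<forall>\<^sub>F t in at t0. (R\<^sub>1 t (d t) - R (d t)) + R (d t) +
        (R\<^sub>1 t (T (u i)) - R (T (u i))) /\<^sub>R (t - t0) = (R\<^sub>1 t (T\<^sub>1 t (u i)) - R (T (u i))) /\<^sub>R (t - t0)"
      using near
    proof eventually_elim
      case (elim t)
      then have lin: "clinear_on UNIV (R\<^sub>1 t)" by (simp add: near_problem_def)
      have "R\<^sub>1 t (d t) = (R\<^sub>1 t (T\<^sub>1 t (u i)) - R\<^sub>1 t (T (u i))) /\<^sub>R (t - t0)"
        unfolding d_def scaleR_eq_scaleC by (simp add: clinear_on_scaleC[OF lin] clinear_on_diff[OF lin])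
      then show ?case by (simp add: scaleR_diff_right)
    qed
    ultimately have "((\<lambda>t. (R\<^sub>1 t (T\<^sub>1 t (u i)) - R (T (u i))) /\<^sub>R (t - t0)) \<longlongrightarrow> 0 + R \<theta> + \<rho>) (at t0)"
      by (rule Lim_transform_eventually)
    then show ?thesis
      unfolding has_vector_derivative_iff_quotient by (simp add: base uD)
  qed
  define \<delta> where "\<delta> = \<theta> - (R \<theta> + \<rho>)"
  have "((\<lambda>t. boundary_defect (T\<^sub>1 t) (R\<^sub>1 t) (u i)) has_vector_derivative \<delta>) (at t0)"
    using has_vector_derivative_diff[OF has_vector_derivative_diff[OF T' R1T]
        has_vector_derivative_const[of "T (u i) - R (T (u i))"]]
    by (simp add: boundary_defect_def \<delta>_def)
  note defect' = this bounded_linear.has_vector_derivative[OF bounded_clinear_bounded_linear[OF R] this]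
  have W': "((\<lambda>t. perturbation (B t) (T\<^sub>1 t) (R\<^sub>1 t) (u i, 0)) has_vector_derivative
      (\<beta>, \<delta> - R \<delta>)) (at t0)"
    unfolding perturbation_def solve_kernel[OF u_E[OF ij(1)]]
    by (intro has_vector_derivative_Pair B' has_vector_derivative_diff defect')
  have "\<forall>\<^sub>F t in at t0. \<epsilon> t < 1" by (rule order_tendstoD(2)[OF \<epsilon>(1)]) simp
  with near \<epsilon>(2) have bound: "\<forall>\<^sub>F t in at t0. \<forall>z.
      norm (perturbation (B t) (T\<^sub>1 t) (R\<^sub>1 t) z) \<le> C * \<epsilon> t * norm z"
    by eventually_elim (auto intro: C(2))
  have M': "((\<lambda>t. schur_matrix (perturbation (B t) (T\<^sub>1 t) (R\<^sub>1 t)) $$ (j, i)) has_vector_derivative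
      cinner (kernel_part (\<beta>, \<delta> - R \<delta>)) (u j, 0)) (at t0)"
  proof (rule schur_matrix_has_derivative[where q = "\<lambda>t. C * \<epsilon> t"])
    show "\<forall>\<^sub>F t in at t0. clinear_on UNIV (perturbation (B t) (T\<^sub>1 t) (R\<^sub>1 t))"
      using near by eventually_elim (rule perturbation_clinear)
    show "((\<lambda>t. C * \<epsilon> t) \<longlongrightarrow> 0) (at t0)"
      using tendsto_mult_left[OF \<epsilon>(1), of C] by simp
    show "\<forall>\<^sub>F t in at t0. 0 \<le> C * \<epsilon> t"
      using \<epsilon>(2) by eventually_elim (use C(1) in simp)
    show "perturbation (B t0) (T\<^sub>1 t0) (R\<^sub>1 t0) z = 0" for z
      by (simp add: perturbation_def boundary_defect_def base solve_D bounded_clinear_zero[OF R]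
          zero_prod_def)
  qed (fact W' bound ij)+
  have "cinner (kernel_part (\<beta>, \<delta> - R \<delta>)) (u j, 0 :: 'l)
      = cinner (solve (\<beta>, \<delta> - R \<delta>)) (u j)"
    by (simp add: kernel_part_def cinner_prod_def proj(2)[OF u_E[OF ij(2)]])
  moreover have "cinner (J (\<delta> - R \<delta>)) (T (u j)) = cinner (J \<theta>) (T (u j)) - cinner (J \<rho>) (T (u j))"
    using isotropic_trace[OF E_D\<^sub>R[OF u_E[OF ij(2)]]]
    by (simp add: \<delta>_def bounded_clinear_diff[OF J] bounded_clinear_add[OF J] cinner_simps)
  ultimately have "cinner (kernel_part (\<beta>, \<delta> - R \<delta>)) (u j, 0 :: 'l)
      = cinner \<beta> (u j) + cinner (J \<rho>) (T (u j)) - cinner (J \<theta>) (T (u j))"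
    using cinner_solve_kernel[OF u_E[OF ij(2)], of \<beta> "\<delta> - R \<delta>"] by simp
  with M' show ?thesis by simp
qed

end

section \<open>Adjoints, traces and the coupled operator\<close>

lemma orthogonal_to_dense:
  fixes d :: "'a::complex_hilbert"
  assumes "closure X = UNIV" "\<And>x. x \<in> X \<Longrightarrow> cinner x d = 0"
  shows "d = 0"
proof -
  have "closed {x. cinner x d = 0}"
    by (intro closed_Collect_eq linear_continuous_on bounded_linear_cinner_left continuous_on_const)
  then have "closure X \<subseteq> {x. cinner x d = 0}"
    by (rule closure_minimal[rotated]) (use assms(2) in auto)
  then have "cinner d d = 0" using assms(1) by blast
  then show ?thesis by (simp add: cinner_self)
qed

lemma adj_eqI:
  assumes dense: "densely_defined T" and w: "\<And>u. u \<in> dm T \<Longrightarrow> cinner (ap T u) v = cinner u w"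
  shows "v \<in> dm (adj T)" "ap (adj T) v = w"
proof -
  show "v \<in> dm (adj T)" using w by (auto simp: adj_def)
  have "w' = w" if w': "\<forall>u\<in>dm T. cinner (ap T u) v = cinner u w'" for w'
  proof -
    have "cinner u (w' - w) = 0" if "u \<in> dm T" for u
      using w[OF that] w' that by (simp add: cinner_diff_right)
    then have "w' - w = 0"
      by (rule orthogonal_to_dense[OF dense[unfolded densely_defined_def]])
    then show ?thesis by simp
  qed
  then show "ap (adj T) v = w"
    using w by (auto simp: adj_def intro!: the_equality)
qed

lemma cinner_adj:
  assumes "densely_defined T" "v \<in> dm (adj T)" "u \<in> dm T"
  shows "cinner (ap T u) v = cinner u (ap (adj T) v)"
proof -
  obtain w where w: "\<And>u. u \<in> dm T \<Longrightarrow> cinner (ap T u) v = cinner u w"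
    using assms(2) by (auto simp: adj_def)
  then show ?thesis using adj_eqI(2)[OF assms(1) w] assms(3) by simp
qed

lemma adj_clinear:
  assumes T: "densely_defined T"
  shows "clinear_on (dm (adj T)) (ap (adj T))"
proof -
  have add: "x + y \<in> dm (adj T)" "ap (adj T) (x + y) = ap (adj T) x + ap (adj T) y"
    if "x \<in> dm (adj T)" "y \<in> dm (adj T)" for x y
    using that adj_eqI[OF T, of "x + y" "ap (adj T) x + ap (adj T) y"]
    by (auto simp: cinner_add_right cinner_adj[OF T])
  have scale: "c *\<^sub>C x \<in> dm (adj T)" "ap (adj T) (c *\<^sub>C x) = c *\<^sub>C ap (adj T) x"
    if "x \<in> dm (adj T)" for c x
    using that adj_eqI[OF T, of "c *\<^sub>C x" "c *\<^sub>C ap (adj T) x"]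
    by (auto simp: cinner_scaleC_right cinner_adj[OF T])
  have "0 \<in> dm (adj T)" by (rule adj_eqI[OF T, of 0 0]) simp
  then show ?thesis
    unfolding clinear_on_def using add scale by (auto intro: csubspaceI)
qed

lemma self_adjoint_extension:
  assumes A: "densely_defined A" and B: "self_adjoint B" "extends B A" and x: "x \<in> dm B"
  shows "x \<in> dm (adj A)" "ap (adj A) x = ap B x"
proof -
  have "cinner (ap A u) x = cinner u (ap B x)" if "u \<in> dm A" for u
    using that B x cinner_adj[of B x u] by (auto simp: self_adjoint_def extends_def subset_iff)
  then show "x \<in> dm (adj A)" "ap (adj A) x = ap B x"
    using adj_eqI[OF A] by blast+
qed

text \<open>A vector with vanishing trace belongs to every self-adjoint extension, by Green's identity.\<close>

lemma self_adjoint_extension_domain: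
  assumes A: "densely_defined A" and B: "self_adjoint B" "extends B A"
    and tr: "trace_op A tr" "tr ` dm B = range P" and P: "\<And>b. P (P b) = P b"
  shows "x \<in> dm B \<longleftrightarrow> x \<in> dm (adj A) \<and> P (tr x) = tr x"
proof
  assume x: "x \<in> dm B"
  then have "tr x \<in> range P" using tr(2) by blast
  then show "x \<in> dm (adj A) \<and> P (tr x) = tr x"
    using self_adjoint_extension(1)[OF A B x] P by auto
next
  assume x: "x \<in> dm (adj A) \<and> P (tr x) = tr x"
  then have "tr x \<in> tr ` dm B" using tr(2) by (metis rangeI)
  then obtain a where a: "a \<in> dm B" "tr a = tr x" by auto
  have aA: "a \<in> dm (adj A)" by (rule self_adjoint_extension(1)[OF A B a(1)])
  have lin: "clinear_on (dm (adj A)) tr"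
    using tr(1) by (simp add: trace_op_def bounded_op_on_def)
  define d where "d = x - a"
  have d: "d \<in> dm (adj A)" "tr d = 0"
    using x aA a(2) csubspace_diff[OF clinear_on_subspace[OF lin]] clinear_on_diff[OF lin]
    by (auto simp: d_def)
  have "cinner (ap B v) d = cinner v (ap (adj A) d)" if v: "v \<in> dm B" for v
  proof -
    have "cinner (ap (adj A) v) d - cinner v (ap (adj A) d) = 0"
      using tr(1) d self_adjoint_extension(1)[OF A B v] by (simp add: trace_op_def)
    then show ?thesis using self_adjoint_extension(2)[OF A B v] by simp
  qed
  then have "d \<in> dm (adj B)"
    using B(1) adj_eqI(1)[of B d] by (auto simp: self_adjoint_def)
  then have dB: "d \<in> dm B" using B(1) by (simp add: self_adjoint_def)
  have "csubspace (dm B)"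
    using B(1) by (auto simp: self_adjoint_def lin_oper_def intro: clinear_on_subspace)
  then have "d + a \<in> dm B" using dB a(1) by (rule csubspace_add)
  then show "x \<in> dm B" by (simp add: d_def)
qed

lemma self_adjoint_bdd_oper:
  assumes "self_adjoint (bdd_oper F)"
  shows "bounded_clinear (blinfun_apply F)" "cinner (F x) y = cinner x (F y)"
proof -
  show "bounded_clinear (blinfun_apply F)"
    using assms norm_blinfun[of F]
    by (auto simp: self_adjoint_def lin_oper_def bdd_oper_def bounded_op_on_def)
  have "cinner (ap (bdd_oper F) x) y = cinner x (ap (adj (bdd_oper F)) y)"
    using assms by (intro cinner_adj) (auto simp: self_adjoint_def bdd_oper_def)
  then show "cinner (F x) y = cinner x (F y)"
    using assms by (auto simp: self_adjoint_def bdd_oper_def)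
qed

text \<open>The operator \<open>\<tau> (- N\<^sup>* + V - l)\<close> on the domain of \<open>N\<^sup>*\<close>. On the product of
  the domains of the two extensions it is \<open>\<tau>\<close> times the shifted coupled operator; the factor \<open>\<tau>\<close> makes
  it symmetric there.\<close>

definition maximal_op ::
    "('h::complex_hilbert, 'h) oper \<Rightarrow> (('h \<times> 'h) \<Rightarrow>\<^sub>L ('h \<times> 'h)) \<Rightarrow> real \<Rightarrow> 'h \<times> 'h \<Rightarrow> 'h \<times> 'h"
  where "maximal_op A V l w = (ap (adj A) (fst w), - ap (adj A) (snd w)) + prod.swap (V w)
    - complex_of_real l *\<^sub>C prod.swap w"

definition Jmap2 :: "('k \<times> 'k) \<times> ('k \<times> 'k) \<Rightarrow> ('k \<times> 'k) \<times> ('k \<times> ('k::complex_hilbert))"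
  where "Jmap2 f = (Jmap (fst f), - Jmap (snd f))"

lemma Omega_Jmap2: "Omega f g = cinner (Jmap2 f) g"
  by (simp add: Omega_def Jmap2_def)

lemma Omega_omega: "Omega f g = omega (fst f) (fst g) - omega (snd f) (snd g)"
  by (simp add: Omega_def omega_def cinner_prod_def cinner_minus_left)

lemma norm_Jmap: "norm (Jmap f) = norm f"
  by (cases f) (simp add: Jmap_def norm_Pair add.commute)

lemma Jmap2_bounded_clinear: "bounded_clinear Jmap2"
proof (rule bounded_clinearI[where K = 1])
  show "norm (Jmap2 f) \<le> 1 * norm f" for f :: "('a \<times> 'a) \<times> ('a \<times> 'a)"
    by (cases f) (simp add: Jmap2_def norm_Pair[of "Jmap _"] norm_Pair[of "fst f"] norm_Jmap,
        simp add: norm_Pair)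
qed (auto simp: Jmap2_def Jmap_def scaleC_prod_def)

lemma norm_swap: "norm (prod.swap z) = norm z"
  by (cases z) (simp add: norm_Pair add.commute)

lemma swap_eq_zero: "prod.swap z = 0 \<longleftrightarrow> z = 0"
  by (cases z) (auto simp: zero_prod_def)

lemma swap_zero: "prod.swap 0 = 0"
  by (simp add: zero_prod_def)

lemma swap_diff: "prod.swap (x - y) = prod.swap x - prod.swap y"
  by (cases x; cases y) simp

lemma swap_scaleC: "prod.swap (c *\<^sub>C x) = c *\<^sub>C prod.swap x"
  by (cases x) (simp add: scaleC_prod_def)

lemma swap_bounded_clinear: "bounded_clinear prod.swap"
  by (rule bounded_clinearI[where K = 1]) (auto simp: swap_scaleC norm_swap)

lemma ap_tau: "ap tau z = prod.swap z"
  by (cases z) (simp add: tau_def)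

lemma graph_norm_eq: "graph_norm T x = sqrt ((norm x)\<^sup>2 + (norm (ap T x))\<^sup>2)"
  by (simp add: graph_norm_def graph_cinner_def norm_square_cinner)

lemma graph_norm2_eq:
  "graph_norm2 (adj A) w = norm (w, (ap (adj A) (fst w), - ap (adj A) (snd w)))"
  unfolding graph_norm2_def graph_norm_eq
  by (cases w) (simp add: norm_Pair algebra_simps)

lemma graph_norm2_nonneg: "0 \<le> graph_norm2 (adj A) w"
  by (simp add: graph_norm2_def)

text \<open>The graph norm of the maximal domain is dominated by the graph norm of \<open>maximal_op A V l\<close>,
  because the two operators differ by a bounded one.\<close>

lemma graph_norm2_le:
  "graph_norm2 (adj A) w \<le> (1 + norm V + \<bar>l\<bar>) * (norm w + norm (maximal_op A V l w))"
proof -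
  let ?n = "(ap (adj A) (fst w), - ap (adj A) (snd w))"
  have "?n = maximal_op A V l w - prod.swap (V w) + complex_of_real l *\<^sub>C prod.swap w"
    by (simp add: maximal_op_def)
  then have "norm ?n \<le> norm (maximal_op A V l w) + norm (V w) + \<bar>l\<bar> * norm w"
    using norm_triangle_ineq[of "maximal_op A V l w - prod.swap (V w)" "complex_of_real l *\<^sub>C prod.swap w"]
      norm_triangle_ineq4[of "maximal_op A V l w" "prod.swap (V w)"]
    by (simp add: norm_swap norm_scaleC)
  then have "norm ?n \<le> norm (maximal_op A V l w) + (norm V + \<bar>l\<bar>) * norm w"
    using norm_blinfun[of V w] by (simp add: algebra_simps)
  moreover have "graph_norm2 (adj A) w \<le> norm w + norm ?n"
    unfolding graph_norm2_eq by (rule norm_Pair_le)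
  moreover have "0 \<le> norm V * norm (maximal_op A V l w)" "0 \<le> \<bar>l\<bar> * norm (maximal_op A V l w)"
    by simp_all
  ultimately show ?thesis unfolding distrib_left distrib_right by linarith
qed

lemma Omega_trace:
  assumes "trace_op A tr" "w \<in> dm (adj A) \<times> dm (adj A)" "v \<in> dm (adj A) \<times> dm (adj A)"
  shows "Omega (map_prod tr tr w) (map_prod tr tr v) =
    (cinner (ap (adj A) (fst w)) (fst v) - cinner (fst w) (ap (adj A) (fst v)))
    - (cinner (ap (adj A) (snd w)) (snd v) - cinner (snd w) (ap (adj A) (snd v)))"
  using assms
  by (auto simp: trace_op_def Omega_omega omega_def Jmap_def cinner_prod_def cinner_minus_left)

locale coupled_extensions =
  fixes A At Bt :: "('h::complex_hilbert, 'h) oper"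
    and tr :: "'h \<Rightarrow> 'k \<times> ('k::complex_hilbert)"
    and P Q :: "('k \<times> 'k) \<Rightarrow>\<^sub>L ('k \<times> 'k)"
    and F G :: "'h \<Rightarrow>\<^sub>L 'h" and V :: "('h \<times> 'h) \<Rightarrow>\<^sub>L ('h \<times> 'h)"
  assumes dense: "densely_defined A"
    and tr: "trace_op A tr"
    and P: "orth_proj P" "lagrangian (range P)" and Q: "orth_proj Q" "lagrangian (range Q)"
    and At: "self_adjoint At" "extends At A" "tr ` dm At = range P"
    and Bt: "self_adjoint Bt" "extends Bt A" "tr ` dm Bt = range Q"
    and FG: "self_adjoint (bdd_oper F)" "self_adjoint (bdd_oper G)"
    and V: "\<And>x y. V (x, y) = (- G y, F x)"
begin

abbreviation D :: "('h \<times> 'h) set" where "D \<equiv> dm (adj A) \<times> dm (adj A)"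
abbreviation T :: "'h \<times> 'h \<Rightarrow> ('k \<times> 'k) \<times> ('k \<times> 'k)" where "T \<equiv> map_prod tr tr"
abbreviation R :: "('k \<times> 'k) \<times> ('k \<times> 'k) \<Rightarrow> ('k \<times> 'k) \<times> ('k \<times> 'k)" where "R \<equiv> map_prod P Q"
abbreviation shifted :: "real \<Rightarrow> ('h \<times> 'h, 'h \<times> 'h) oper"
  where "shifted l \<equiv> oper_shift (oper_plus (offdiag Bt At) (bdd_oper V)) (complex_of_real l)"

lemma PP: "P (P b) = P b" "Q (Q b) = Q b"
  using P(1) Q(1) by (auto simp: orth_proj_def dest: arg_cong[of _ _ "\<lambda>f. blinfun_apply f b"])

lemma PQ_clinear: "bounded_clinear (blinfun_apply P)" "bounded_clinear (blinfun_apply Q)"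
  using P(1) Q(1) self_adjoint_bdd_oper(1) by (auto simp: orth_proj_def)

lemma R_bounded_clinear: "bounded_clinear R"
proof (rule bounded_clinearI[where K = "norm P + norm Q"])
  fix b :: "('k \<times> 'k) \<times> ('k \<times> 'k)"
  obtain b1 b2 where b: "b = (b1, b2)" by (metis surj_pair)
  have "norm (R b) \<le> norm (P b1) + norm (Q b2)"
    by (simp add: b norm_Pair_le)
  also have "\<dots> \<le> norm P * norm b + norm Q * norm b"
    unfolding b by (intro add_mono order_trans[OF norm_blinfun] mult_left_mono norm_fst_le norm_snd_le)
      simp_all
  finally show "norm (R b) \<le> (norm P + norm Q) * norm b" by (simp add: distrib_right)
next
  fix b c :: "('k \<times> 'k) \<times> ('k \<times> 'k)"
  show "R (b + c) = R b + R c"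
    by (simp add: prod_eq_iff blinfun.add_right map_prod_def split_beta)
next
  fix z :: complex and b :: "('k \<times> 'k) \<times> ('k \<times> 'k)"
  show "R (z *\<^sub>C b) = z *\<^sub>C R b"
    by (simp only: scaleC_prod_def[of z b] scaleC_prod_def[of z "R b"] fst_map_prod snd_map_prod
        map_prod_simp bounded_clinear_scaleC[OF PQ_clinear(1)] bounded_clinear_scaleC[OF PQ_clinear(2)])
qed

lemma R_idempotent: "R (R b) = R b"
  by (cases b) (simp add: PP)

lemma R_isotropic: "cinner (Jmap2 (R b)) (R c) = 0"
proof -
  have "omega f g = 0" if "lagrangian L" "f \<in> L" "g \<in> L" for L and f g :: "'k \<times> 'k"
    using that by (auto simp: lagrangian_def)
  then show ?thesis
    using P(2) Q(2) unfolding Omega_Jmap2[symmetric] Omega_omega by simp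
qed

lemma domain_iff: "w \<in> dm At \<times> dm Bt \<longleftrightarrow> w \<in> D \<and> R (T w) = T w"
  using self_adjoint_extension_domain[OF dense At(1,2) tr At(3) PP(1)]
    self_adjoint_extension_domain[OF dense Bt(1,2) tr Bt(3) PP(2)]
  by (cases w) auto

lemma maximal_op_Pair:
  "maximal_op A V l (x, y) = (ap (adj A) x + F x - complex_of_real l *\<^sub>C y,
    - ap (adj A) y - G y - complex_of_real l *\<^sub>C x)"
  by (simp add: maximal_op_def V scaleC_prod_def)

lemma shifted_swap:
  assumes "w \<in> dm At \<times> dm Bt"
  shows "maximal_op A V l w = prod.swap (ap (shifted l) w)"
  using assms self_adjoint_extension(2)[OF dense At(1,2)] self_adjoint_extension(2)[OF dense Bt(1,2)]
  by (cases w) (simp add: maximal_op_Pair oper_shift_def oper_plus_def offdiag_def bdd_oper_def V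
      scaleC_prod_def)

lemma dm_shifted: "dm (shifted l) = dm At \<times> dm Bt"
  by (simp add: oper_shift_def oper_plus_def offdiag_def bdd_oper_def)

lemma tr_clinear: "clinear_on (dm (adj A)) tr"
  using tr by (simp add: trace_op_def bounded_op_on_def)

lemma D_subspace: "csubspace D"
  using clinear_on_subspace[OF tr_clinear]
  by (intro csubspaceI)
    (auto simp: zero_prod_def scaleC_prod_def csubspace_zero csubspace_add csubspace_scaleC)

lemma T_clinear: "clinear_on D T"
  unfolding clinear_on_def using D_subspace
  by (auto simp: scaleC_prod_def clinear_on_add[OF tr_clinear] clinear_on_scaleC[OF tr_clinear])

lemma maximal_op_clinear: "clinear_on D (maximal_op A V l)"
  unfolding clinear_on_def
  using D_subspace
  by (auto simp: maximal_op_Pair scaleC_prod_def clinear_on_add[OF adj_clinear[OF dense]]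
      clinear_on_scaleC[OF adj_clinear[OF dense]] blinfun.add_right
      bounded_clinear_scaleC[OF self_adjoint_bdd_oper(1)[OF FG(1)]]
      bounded_clinear_scaleC[OF self_adjoint_bdd_oper(1)[OF FG(2)]]
      scaleC_add_right scaleC_scaleC complex_vs.scale_right_diff_distrib mult.commute)

lemma T_surjective: "\<exists>w\<in>D. T w = b"
proof -
  have "\<exists>x\<in>dm (adj A). tr x = c" for c
    using tr unfolding trace_op_def by (metis UNIV_I imageE)
  then obtain x y where "x \<in> dm (adj A)" "tr x = fst b" "y \<in> dm (adj A)" "tr y = snd b"
    by blast
  then show ?thesis by (intro bexI[of _ "(x, y)"]) auto
qed

lemma T_bound: "\<exists>K. \<forall>w\<in>D. norm (T w) \<le> K * (norm w + norm (maximal_op A V l w))"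
proof -
  obtain K' where K': "\<And>x. x \<in> dm (adj A) \<Longrightarrow> norm (tr x) \<le> K' * graph_norm (adj A) x"
    using tr by (auto simp: trace_op_def bounded_op_on_def)
  define K where "K = \<bar>K'\<bar>"
  have K: "norm (tr x) \<le> K * graph_norm (adj A) x" if "x \<in> dm (adj A)" for x
    using K'[OF that] by (rule order_trans) (simp add: K_def mult_right_mono graph_norm_eq)
  have "norm (T w) \<le> 2 * K * (1 + norm V + \<bar>l\<bar>) * (norm w + norm (maximal_op A V l w))"
    if w: "w \<in> D" for w
  proof -
    have le: "graph_norm (adj A) (fst w) \<le> graph_norm2 (adj A) w"
      "graph_norm (adj A) (snd w) \<le> graph_norm2 (adj A) w"
      unfolding graph_norm2_def by (auto intro: real_le_rsqrt)
    have "norm (T w) \<le> norm (tr (fst w)) + norm (tr (snd w))"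
      by (cases w) (simp add: norm_Pair_le)
    also have "\<dots> \<le> K * graph_norm2 (adj A) w + K * graph_norm2 (adj A) w"
      using w by (intro add_mono order_trans[OF K] mult_left_mono le) (auto simp: K_def)
    also have "\<dots> = 2 * K * graph_norm2 (adj A) w" by simp
    also have "\<dots> \<le> 2 * K * ((1 + norm V + \<bar>l\<bar>) * (norm w + norm (maximal_op A V l w)))"
      by (intro mult_left_mono graph_norm2_le) (simp add: K_def)
    finally show ?thesis by (simp add: mult.assoc)
  qed
  then show ?thesis by blast
qed

lemma maximal_op_Green:
  assumes "w \<in> D" "v \<in> D"
  shows "cinner (maximal_op A V l w) v - cinner w (maximal_op A V l v) = cinner (Jmap2 (T w)) (T v)"
  unfolding Omega_Jmap2[symmetric] Omega_trace[OF tr assms]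
  by (cases w; cases v)
    (simp add: maximal_op_Pair cinner_prod_def cinner_simps self_adjoint_bdd_oper(2)[OF FG(1)]
      self_adjoint_bdd_oper(2)[OF FG(2)])

text \<open>Testing with \<open>(x, 0)\<close> and with \<open>(0, y)\<close> reduces maximality to the self-adjointness of the
  two extensions.\<close>

lemma maximal_op_maximal:
  assumes "\<And>v. v \<in> D \<Longrightarrow> R (T v) = T v \<Longrightarrow> cinner (maximal_op A V l v) q = 0"
  shows "q \<in> D \<and> R (T q) = T q \<and> maximal_op A V l q = 0"
proof -
  obtain q1 q2 where q: "q = (q1, q2)" by (metis surj_pair)
  have orth: "cinner (maximal_op A V l v) q = 0" if "v \<in> dm At \<times> dm Bt" for v
    using assms that domain_iff by blast
  have zero: "0 \<in> dm At" "0 \<in> dm Bt"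
    using At(1) Bt(1) by (auto simp: self_adjoint_def lin_oper_def intro: csubspace_zero clinear_on_subspace)
  have adj0: "ap (adj A) 0 = 0"
    by (rule clinear_on_zero[OF adj_clinear[OF dense]])
  have "cinner (ap At x) q1 = cinner x (complex_of_real l *\<^sub>C q2 - F q1)" if "x \<in> dm At" for x
    using orth[of "(x, 0)"] that zero self_adjoint_extension(2)[OF dense At(1,2) that]
    by (simp add: maximal_op_Pair q cinner_prod_def cinner_simps adj0
        self_adjoint_bdd_oper(2)[OF FG(1)] algebra_simps)
  then have q1: "q1 \<in> dm At" "ap At q1 = complex_of_real l *\<^sub>C q2 - F q1"
    using adj_eqI[of At q1 "complex_of_real l *\<^sub>C q2 - F q1"] At(1) by (auto simp: self_adjoint_def)
  have "cinner (ap Bt y) q2 = cinner y (- G q2 - complex_of_real l *\<^sub>C q1)" if "y \<in> dm Bt" for y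
  proof -
    have "- cinner (ap Bt y) q2 = cinner y (G q2) + complex_of_real l * cinner y q1"
      using orth[of "(0, y)"] that zero self_adjoint_extension(2)[OF dense Bt(1,2) that]
      by (simp add: maximal_op_Pair q cinner_prod_def cinner_simps adj0
          self_adjoint_bdd_oper(2)[OF FG(2)] algebra_simps)
    then have "cinner (ap Bt y) q2 = - (cinner y (G q2) + complex_of_real l * cinner y q1)"
      by (metis minus_minus)
    then show ?thesis by (simp add: cinner_simps)
  qed
  then have q2: "q2 \<in> dm Bt" "ap Bt q2 = - G q2 - complex_of_real l *\<^sub>C q1"
    using adj_eqI[of Bt q2 "- G q2 - complex_of_real l *\<^sub>C q1"] Bt(1) by (auto simp: self_adjoint_def)
  have "maximal_op A V l q = 0"
    using self_adjoint_extension(2)[OF dense At(1,2) q1(1)]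
      self_adjoint_extension(2)[OF dense Bt(1,2) q2(1)] q1(2) q2(2)
    by (simp add: q maximal_op_Pair zero_prod_def)
  then show ?thesis
    using q1(1) q2(1) domain_iff[of q] by (simp add: q)
qed

lemma is_boundary_problem:
  assumes closed: "closed (ran (shifted l))" and basis: "is_cbasis g u (ker (shifted l))"
  shows "boundary_problem D (maximal_op A V l) T Jmap2 R g u"
proof
  have dom: "{v \<in> D. R (T v) = T v} = dm At \<times> dm Bt"
    using domain_iff by blast
  have "maximal_op A V l ` {v \<in> D. R (T v) = T v} = prod.swap -` ran (shifted l)"
  proof -
    have "maximal_op A V l ` (dm At \<times> dm Bt) = prod.swap ` ran (shifted l)"
      unfolding ran_def dm_shifted image_image by (intro image_cong refl shifted_swap)
    also have "\<dots> = prod.swap -` ran (shifted l)"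
      by auto
    finally show ?thesis unfolding dom .
  qed
  moreover have "closed (prod.swap -` ran (shifted l))"
    by (intro continuous_closed_vimage closed isCont_swap)
  ultimately show "closed (maximal_op A V l ` {v \<in> D. R (T v) = T v})" by simp
  have "{v \<in> D. R (T v) = T v \<and> maximal_op A V l v = 0}
      = {v \<in> dm At \<times> dm Bt. maximal_op A V l v = 0}"
    using domain_iff by blast
  also have "\<dots> = {v \<in> dm At \<times> dm Bt. ap (shifted l) v = 0}"
    by (intro Collect_cong conj_cong refl) (simp only: shifted_swap swap_eq_zero)
  finally have "{v \<in> D. R (T v) = T v \<and> maximal_op A V l v = 0} = ker (shifted l)"
    by (simp only: ker_def dm_shifted)
  with basis show "is_cbasis g u {v \<in> D. R (T v) = T v \<and> maximal_op A V l v = 0}" by simp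
qed (fact maximal_op_clinear T_clinear T_bound T_surjective Jmap2_bounded_clinear R_bounded_clinear
    R_idempotent R_isotropic maximal_op_Green maximal_op_maximal)+

lemma kernel_imp_Spec:
  assumes "w \<in> D" "R (T w) = T w" "w \<noteq> 0" "maximal_op A V l w = 0"
  shows "complex_of_real l \<in> Spec (oper_plus (offdiag Bt At) (bdd_oper V))"
proof -
  have w: "w \<in> dm (shifted l)" "ap (shifted l) w = 0"
    using assms domain_iff[of w] shifted_swap[of w l] unfolding dm_shifted
    by (simp_all only: swap_eq_zero simp_thms)
  have "\<not> (\<forall>x\<in>dm (oper_plus (offdiag Bt At) (bdd_oper V)). Y (ap (shifted l) x) = x)"
    for Y :: "('h \<times> 'h) \<Rightarrow>\<^sub>L ('h \<times> 'h)"
  proof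
    assume "\<forall>x\<in>dm (oper_plus (offdiag Bt At) (bdd_oper V)). Y (ap (shifted l) x) = x"
    moreover have "w \<in> dm (oper_plus (offdiag Bt At) (bdd_oper V))"
      using w(1) by (simp add: oper_shift_def)
    ultimately have "Y 0 = w" using w(2) by metis
    then show False using assms(3) by (simp add: blinfun.zero_right)
  qed
  then show ?thesis
    unfolding Spec_def resolvent_set_def by blast
qed

lemma inverse_imp_not_Spec:
  assumes Z: "bounded_clinear Z"
    and sol: "\<And>f. Z f \<in> D \<and> R (T (Z f)) = T (Z f) \<and> maximal_op A V l (Z f) = f"
    and inj: "\<And>w. w \<in> D \<Longrightarrow> R (T w) = T w \<Longrightarrow> maximal_op A V l w = 0 \<Longrightarrow> w = 0"
  shows "complex_of_real l \<notin> Spec (oper_plus (offdiag Bt At) (bdd_oper V))"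
proof -
  have "bounded_linear (\<lambda>y. Z (prod.swap y))"
    by (rule bounded_linear_compose[OF bounded_clinear_bounded_linear[OF Z]
          bounded_clinear_bounded_linear[OF swap_bounded_clinear]])
  then obtain Y :: "('h \<times> 'h) \<Rightarrow>\<^sub>L ('h \<times> 'h)" where Y: "\<And>y. Y y = Z (prod.swap y)"
    by (metis bounded_linear_Blinfun_apply)
  have dom: "Z f \<in> dm At \<times> dm Bt" for f using sol domain_iff by blast
  have "Y y \<in> dm (oper_plus (offdiag Bt At) (bdd_oper V))" "ap (shifted l) (Y y) = y" for y
  proof -
    show "Y y \<in> dm (oper_plus (offdiag Bt At) (bdd_oper V))"
      using dom[of "prod.swap y"] by (simp add: Y oper_plus_def offdiag_def bdd_oper_def)
    have "prod.swap (ap (shifted l) (Y y)) = prod.swap y"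
      using shifted_swap[OF dom, of l "prod.swap y"] sol[of "prod.swap y"] by (simp add: Y)
    then show "ap (shifted l) (Y y) = y" by (metis swap_swap)
  qed
  moreover have "Y (ap (shifted l) x) = x" if "x \<in> dm (oper_plus (offdiag Bt At) (bdd_oper V))" for x
  proof -
    have x: "x \<in> dm At \<times> dm Bt"
      using that by (simp add: oper_plus_def offdiag_def bdd_oper_def)
    define z where "z = Z (maximal_op A V l x)"
    have "z = Y (ap (shifted l) x)"
      by (simp add: z_def Y shifted_swap[OF x])
    have zD: "z \<in> D" "R (T z) = T z" "maximal_op A V l z = maximal_op A V l x"
      using sol by (auto simp: z_def)
    have xD: "x \<in> D" "R (T x) = T x" using x domain_iff by blast+
    have "z - x = 0"
    proof (rule inj)
      show "z - x \<in> D" using zD xD csubspace_diff[OF D_subspace] by blast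
      show "R (T (z - x)) = T (z - x)"
        using zD xD by (simp add: clinear_on_diff[OF T_clinear] bounded_clinear_diff[OF R_bounded_clinear])
      show "maximal_op A V l (z - x) = 0"
        using zD xD by (simp add: clinear_on_diff[OF maximal_op_clinear])
    qed
    then show ?thesis using \<open>z = Y (ap (shifted l) x)\<close> by simp
  qed
  ultimately show ?thesis
    unfolding Spec_def resolvent_set_def by blast
qed

end

section \<open>Families of operators\<close>

lemma op_norm_on_bound:
  fixes f :: "'a::complex_hilbert \<Rightarrow> 'b::complex_hilbert"
  assumes f: "bounded_op_on D \<nu> f" and \<nu>: "\<And>x. 0 \<le> \<nu> x" and x: "x \<in> D"
  shows "norm (f x) \<le> op_norm_on D \<nu> f * \<nu> x"
proof (cases "\<nu> x = 0")
  case True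
  then show ?thesis using f x by (fastforce simp: bounded_op_on_def)
next
  case False
  obtain K where K: "\<And>x. x \<in> D \<Longrightarrow> norm (f x) \<le> K * \<nu> x"
    using f by (auto simp: bounded_op_on_def)
  have "norm (f y) / \<nu> y \<le> \<bar>K\<bar>" if "y \<in> D" for y
  proof (cases "\<nu> y = 0")
    case False
    then have "0 < \<nu> y" using \<nu>[of y] by simp
    then have "norm (f y) / \<nu> y \<le> K" using K[OF that] by (simp add: divide_le_eq)
    then show ?thesis by simp
  qed simp
  then have "bdd_above ((\<lambda>x. norm (f x) / \<nu> x) ` D)"
    by (intro bdd_aboveI[of _ "\<bar>K\<bar>"]) auto
  then have "norm (f x) / \<nu> x \<le> op_norm_on D \<nu> f"
    unfolding op_norm_on_def by (intro cSUP_upper x)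
  then show ?thesis using False \<nu>[of x] by (simp add: divide_le_eq)
qed

lemma bounded_op_on_difference_quotient:
  fixes f h k :: "'a::complex_hilbert \<Rightarrow> 'b::complex_hilbert"
  assumes "bounded_op_on D \<nu> f" "bounded_op_on D \<nu> h" "bounded_op_on D \<nu> k"
    and \<nu>: "\<And>x. 0 \<le> \<nu> x"
  shows "bounded_op_on D \<nu> (\<lambda>x. (f x - h x) /\<^sub>R r - k x)"
proof -
  have lin: "clinear_on D f" "clinear_on D h" "clinear_on D k"
    using assms by (auto simp: bounded_op_on_def)
  obtain K1 K2 K3 where K: "\<And>x. x \<in> D \<Longrightarrow> norm (f x) \<le> K1 * \<nu> x"
    "\<And>x. x \<in> D \<Longrightarrow> norm (h x) \<le> K2 * \<nu> x" "\<And>x. x \<in> D \<Longrightarrow> norm (k x) \<le> K3 * \<nu> x"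
    using assms unfolding bounded_op_on_def by blast
  have "norm ((f x - h x) /\<^sub>R r - k x) \<le> (\<bar>inverse r\<bar> * (K1 + K2) + K3) * \<nu> x" if "x \<in> D" for x
  proof -
    have "norm (f x - h x) \<le> (K1 + K2) * \<nu> x"
      using norm_triangle_ineq4[of "f x" "h x"] K(1,2)[OF that] by (simp add: distrib_right)
    then have "norm ((f x - h x) /\<^sub>R r) \<le> \<bar>inverse r\<bar> * ((K1 + K2) * \<nu> x)"
      unfolding norm_scaleR by (rule mult_left_mono) simp
    then show ?thesis
      using norm_triangle_ineq4[of "(f x - h x) /\<^sub>R r" "k x"] K(3)[OF that]
      by (simp only: distrib_right mult.assoc)
  qed
  moreover have "clinear_on D (\<lambda>x. (f x - h x) /\<^sub>R r - k x)"
    unfolding clinear_on_def scaleR_eq_scaleC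
    using clinear_on_subspace[OF lin(1)]
    by (auto simp: clinear_on_add[OF lin(1)] clinear_on_add[OF lin(2)] clinear_on_add[OF lin(3)]
        clinear_on_scaleC[OF lin(1)] clinear_on_scaleC[OF lin(2)] clinear_on_scaleC[OF lin(3)]
        scaleC_add_right scaleC_scaleC complex_vs.scale_right_diff_distrib mult.commute)
  ultimately show ?thesis by (auto simp: bounded_op_on_def)
qed

text \<open>The modulus \<open>\<eta>\<close> is the distance \<open>\<bar>s - t\<bar>\<close> times a bound for the norms of the difference
  quotients; by the first factor the estimate extends to \<open>s = t\<close>.\<close>

lemma C2_op_on_modulus:
  fixes f :: "real \<Rightarrow> 'a::complex_hilbert \<Rightarrow> 'b::complex_hilbert"
  assumes f: "C2_op_on D \<nu> I f f'" and t: "t \<in> I" and \<nu>: "\<And>x. 0 \<le> \<nu> x"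
  shows "\<exists>\<eta>. (\<eta> \<longlongrightarrow> 0) (at t within I) \<and> \<eta> t = 0 \<and> (\<forall>s. 0 \<le> \<eta> s) \<and>
      (\<forall>s\<in>I. \<forall>x\<in>D. norm (f s x - f t x) \<le> \<eta> s * \<nu> x)" (is ?modulus)
    and "x \<in> D \<Longrightarrow> ((\<lambda>s. f s x) has_vector_derivative f' t x) (at t within I)"
proof -
  define e where "e s = op_norm_on D \<nu> (\<lambda>x. (f s x - f t x) /\<^sub>R (s - t) - f' t x)" for s
  define \<eta> where "\<eta> s = \<bar>s - t\<bar> * (\<bar>e s\<bar> + \<bar>op_norm_on D \<nu> (f' t)\<bar>)" for s
  have bdd: "bounded_op_on D \<nu> (f' t)" "\<And>s. s \<in> I \<Longrightarrow> bounded_op_on D \<nu> (f s)"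
    using f t by (auto simp: C2_op_on_def)
  have e: "(e \<longlongrightarrow> 0) (at t within I)"
    using f t unfolding e_def[abs_def] by (auto simp: C2_op_on_def has_op_derivative_on_def)
  have q: "norm ((f s x - f t x) /\<^sub>R (s - t) - f' t x) \<le> e s * \<nu> x" if "s \<in> I" "x \<in> D" for s x
    unfolding e_def using that
    by (intro op_norm_on_bound[of D \<nu> "\<lambda>x. (f s x - f t x) /\<^sub>R (s - t) - f' t x"]
        bounded_op_on_difference_quotient bdd t \<nu>)
  show ?modulus
  proof (intro exI[of _ \<eta>] conjI allI ballI)
    have "(\<eta> \<longlongrightarrow> \<bar>t - t\<bar> * (\<bar>0\<bar> + \<bar>op_norm_on D \<nu> (f' t)\<bar>)) (at t within I)"
      unfolding \<eta>_def
      by (intro tendsto_mult tendsto_add tendsto_rabs tendsto_diff tendsto_const tendsto_ident_at e)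
    then show "(\<eta> \<longlongrightarrow> 0) (at t within I)" by simp
    show "\<eta> t = 0" by (simp add: \<eta>_def)
    fix s
    show "0 \<le> \<eta> s" by (simp add: \<eta>_def)
    show "norm (f s x - f t x) \<le> \<eta> s * \<nu> x" if "s \<in> I" "x \<in> D" for x
    proof (cases "s = t")
      case False
      define y where "y = (f s x - f t x) /\<^sub>R (s - t)"
      have "norm (f' t x) \<le> op_norm_on D \<nu> (f' t) * \<nu> x"
        by (rule op_norm_on_bound[OF bdd(1) \<nu> that(2)])
      also have "\<dots> \<le> \<bar>op_norm_on D \<nu> (f' t)\<bar> * \<nu> x"
        by (intro mult_right_mono \<nu>) simp
      finally have 1: "norm (f' t x) \<le> \<bar>op_norm_on D \<nu> (f' t)\<bar> * \<nu> x" .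
      have "norm (y - f' t x) \<le> e s * \<nu> x"
        using q[OF that] by (simp add: y_def)
      also have "\<dots> \<le> \<bar>e s\<bar> * \<nu> x"
        by (intro mult_right_mono \<nu>) simp
      finally have "norm y \<le> (\<bar>e s\<bar> + \<bar>op_norm_on D \<nu> (f' t)\<bar>) * \<nu> x"
        using 1 norm_triangle_ineq[of "y - f' t x" "f' t x"] by (simp add: distrib_right)
      moreover have "norm (f s x - f t x) = \<bar>s - t\<bar> * norm y"
        using False by (simp add: y_def)
      ultimately show ?thesis
        by (simp add: \<eta>_def mult.assoc mult_left_mono)
    qed (simp add: \<eta>_def)
  qed
  show "((\<lambda>s. f s x) has_vector_derivative f' t x) (at t within I)" if "x \<in> D"
    unfolding has_vector_derivative_iff_quotient
  proof (rule LIM_zero_cancel, rule Lim_null_comparison)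
    show "((\<lambda>s. e s * \<nu> x) \<longlongrightarrow> 0) (at t within I)"
      using tendsto_mult_right[OF e, of "\<nu> x"] by simp
    show "\<forall>\<^sub>F s in at t within I. norm ((f s x - f t x) /\<^sub>R (s - t) - f' t x) \<le> e s * \<nu> x"
      using q that by (auto simp: eventually_at_filter)
  qed
qed

lemma bounded_bilinear_cinner: "bounded_bilinear (cinner :: 'a::complex_hilbert \<Rightarrow> 'a \<Rightarrow> complex)"
proof
  show "\<exists>K. \<forall>a b::'a. norm (cinner a b) \<le> norm a * norm b * K"
    by (intro exI[of _ 1]) (simp add: Cauchy_Schwarz)
qed (simp_all add: cinner_simps scaleR_eq_scaleC scaleR_conv_of_real)

lemma C2_on_derivative:
  assumes "C2_on I f f'" "t \<in> interior I"
  shows "(f has_vector_derivative f' t) (at t)" "((\<lambda>s. norm (f s - f t)) \<longlongrightarrow> 0) (at t)"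
proof -
  have "t \<in> I" using assms(2) interior_subset by blast
  then have "(f has_vector_derivative f' t) (at t within I)"
    using assms(1) by (auto simp: C2_on_def)
  then show *: "(f has_vector_derivative f' t) (at t)"
    by (simp add: at_within_interior[OF assms(2)])
  have "(f \<longlongrightarrow> f t) (at t)"
    using has_vector_derivative_continuous[OF *] by (simp add: continuous_at)
  then show "((\<lambda>s. norm (f s - f t)) \<longlongrightarrow> 0) (at t)"
    by (simp only: LIM_zero_iff tendsto_norm_zero_iff)
qed

lemma blinfun_apply_has_vector_derivative:
  assumes "(f has_vector_derivative f') F"
  shows "((\<lambda>s. blinfun_apply (f s) x) has_vector_derivative blinfun_apply f' x) F"
  by (rule bounded_linear.has_vector_derivative[OF blinfun.bounded_linear_left assms])


section \<open>The crossing matrix\<close>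

theorem proposition4p6:
  fixes A :: "('h::complex_hilbert, 'h) oper"
    and tr :: "real \<Rightarrow> 'h \<Rightarrow> 'k \<times> ('k::complex_hilbert)"
    and T T' :: "real \<Rightarrow> 'h \<times> 'h \<Rightarrow> ('k \<times> 'k) \<times> ('k \<times> 'k)"
    and P P' Q Q' :: "real \<Rightarrow> ('k \<times> 'k) \<Rightarrow>\<^sub>L ('k \<times> 'k)"
    and At Bt :: "real \<Rightarrow> ('h, 'h) oper"
    and N :: "('h \<times> 'h, 'h \<times> 'h) oper"
    and Nt :: "real \<Rightarrow> ('h \<times> 'h, 'h \<times> 'h) oper"
    and F G :: "real \<Rightarrow> 'h \<Rightarrow>\<^sub>L 'h"
    and V V' :: "real \<Rightarrow> ('h \<times> 'h) \<Rightarrow>\<^sub>L ('h \<times> 'h)"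
    and l0 t0 :: real
    and g :: nat
    and u :: "nat \<Rightarrow> 'h \<times> 'h"
    and I :: "real set"
  defines "N \<equiv> offdiag A A"
    and "Nt \<equiv> (\<lambda>t. offdiag (Bt t) (At t))"
    and "T \<equiv> (\<lambda>t. map_prod (tr t) (tr t))"
  assumes separable: "separable_space (euclidean :: 'h topology)"
      "separable_space (euclidean :: 'k topology)"
    and A: "lin_oper A" "closed_oper A" "densely_defined A" "symmetric_oper A"
    and deficiency:
      "finite_cdim (ker (oper_shift (adj A) (- \<i>)))"
      "finite_cdim (ker (oper_shift (adj A) \<i>))"
      "cdim (ker (oper_shift (adj A) (- \<i>))) = cdim (ker (oper_shift (adj A) \<i>))"
    and traces: "\<forall>t\<in>{0..1}. trace_op A (tr t)"
    and projections: "\<forall>t\<in>{0..1}. orth_proj (P t) \<and> orth_proj (Q t) \<and>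
      lagrangian (range (P t)) \<and> lagrangian (range (Q t))"
    and extensions: "\<forall>t\<in>{0..1}. self_adjoint (At t) \<and> extends (At t) A \<and>
      self_adjoint (Bt t) \<and> extends (Bt t) A \<and>
      tr t ` dm (At t) = range (P t) \<and> tr t ` dm (Bt t) = range (Q t)"
    and potentials: "\<forall>t\<in>{0..1}. self_adjoint (bdd_oper (F t)) \<and> self_adjoint (bdd_oper (G t)) \<and>
      (\<forall>x y. V t (x, y) = (- G t y, F t x))"
    and t0: "t0 \<in> {0<..<1}"
    and i: "complex_of_real l0 \<notin> Spec_ess (oper_plus (Nt t0) (bdd_oper (V t0)))"
    and ii: "cdim (ker (oper_shift (oper_plus (Nt t0) (bdd_oper (V t0))) (complex_of_real l0))) = g"
      "is_cbasis g u (ker (oper_shift (oper_plus (Nt t0) (bdd_oper (V t0))) (complex_of_real l0)))"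
    and I: "is_interval I" "I \<subseteq> {0..1}" "t0 \<in> interior I"
    and iii: "C2_on I V V'" "C2_on I P P'" "C2_on I Q Q'"
      "C2_op_on (dm (adj A) \<times> dm (adj A)) (graph_norm2 (adj A)) I T T'"
    and iv: "\<forall>\<^sub>F l in nhds l0. \<forall>t\<in>I.
      ker (oper_comp (oper_shift (oper_plus (adj N) (adj (bdd_oper (V t)))) (complex_of_real l)) tau)
        \<inter> dm (oper_comp tau N) = {0}"
  shows "\<exists>M :: real \<Rightarrow> real \<Rightarrow> complex mat.
    (\<forall>\<^sub>F (l, t) in nhds (l0, t0). M l t \<in> carrier_mat g g \<and>
      (complex_of_real l \<in> Spec (oper_plus (Nt t) (bdd_oper (V t))) \<longleftrightarrow> Determinant.det (M l t) = 0)) \<and>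
    M l0 t0 = 0\<^sub>m g g \<and>
    (\<forall>i<g. \<forall>j<g.
      ((\<lambda>t. M l0 t $$ (j, i)) has_vector_derivative
        (cinner (ap tau (V' t0 (u i))) (u j)
          + Omega (map_prod (P' t0) (Q' t0) (T t0 (u i))) (T t0 (u j))
          + Omega (T t0 (u i)) (T' t0 (u j)))) (at t0) \<and>
      ((\<lambda>l. M l t0 $$ (j, i)) has_vector_derivative
        (- cinner (ap tau (u i)) (u j))) (at l0))"
proof -
  let ?D = "dm (adj A) \<times> dm (adj A)"
  let ?H = "\<lambda>t. oper_plus (Nt t) (bdd_oper (V t))"
  define S where "S = maximal_op A (V t0) l0"
  define R where "R t = map_prod (blinfun_apply (P t)) (blinfun_apply (Q t))" for t
  define B where "B l t w = prod.swap (V t w - V t0 w) - complex_of_real (l - l0) *\<^sub>C prod.swap w"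
    for l t w
  have "t0 \<in> I" using I(3) interior_subset by blast
  have at_I: "at t0 within I = at t0" by (rule at_within_interior[OF I(3)])
  have coupled: "coupled_extensions A (At t) (Bt t) (tr t) (P t) (Q t) (F t) (G t) (V t)"
    if "t \<in> I" for t
  proof -
    have t: "t \<in> {0..1}" using that I(2) by blast
    show ?thesis
      by unfold_locales
        (use t A(3) traces projections extensions potentials in blast)+
  qed
  interpret ce: coupled_extensions A "At t0" "Bt t0" "tr t0" "P t0" "Q t0" "F t0" "G t0" "V t0"
    by (rule coupled[OF \<open>t0 \<in> I\<close>])
  have ran_closed: "closed (ran (oper_shift (?H t0) (complex_of_real l0)))"
    using i by (simp add: Spec_ess_def fredholm_def)
  interpret bp: boundary_problem ?D S "T t0" Jmap2 "R t0" g u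
    using ce.is_boundary_problem[of l0 g u] ran_closed ii(2)
    by (simp add: S_def T_def R_def Nt_def)

  have u: "u i \<in> ?D" "R t0 (T t0 (u i)) = T t0 (u i)" if "i < g" for i
    using bp.u_E[OF that] by (auto simp: bp.E_def bp.D\<^sub>R_def)

  \<comment> \<open>The distance of the problem at \<open>(l, t)\<close> from the one at \<open>(l0, t0)\<close> will be \<open>e t + \<bar>l - l0\<bar>\<close>;
    the constant \<open>K\<close> passes from the graph norm of the maximal domain to the one of \<open>S\<close>.\<close>

  obtain \<eta> where \<eta>: "(\<eta> \<longlongrightarrow> 0) (at t0 within I)" "\<eta> t0 = 0" "\<And>s. 0 \<le> \<eta> s"
    and T_near: "\<And>s x. s \<in> I \<Longrightarrow> x \<in> ?D \<Longrightarrow> norm (T s x - T t0 x) \<le> \<eta> s * graph_norm2 (adj A) x"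
    using C2_op_on_modulus(1)[OF iii(4) \<open>t0 \<in> I\<close> graph_norm2_nonneg] by blast
  note T_deriv = C2_op_on_modulus(2)[OF iii(4) \<open>t0 \<in> I\<close> graph_norm2_nonneg]
    and V_deriv = C2_on_derivative[OF iii(1) I(3)]
    and P_deriv = C2_on_derivative[OF iii(2) I(3)]
    and Q_deriv = C2_on_derivative[OF iii(3) I(3)]
  define K where "K = 1 + norm (V t0) + \<bar>l0\<bar>"
  define e where "e t = norm (V t - V t0) + K * \<eta> t + (norm (P t - P t0) + norm (Q t - Q t0))" for t
  have e_nonneg: "0 \<le> e t" for t by (simp add: e_def K_def \<eta>(3))
  have e_t0: "e t0 = 0" by (simp add: e_def \<eta>(2))
  have "(e \<longlongrightarrow> 0 + K * 0 + (0 + 0)) (at t0)"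
    unfolding e_def
    by (intro tendsto_add tendsto_mult tendsto_const V_deriv(2) P_deriv(2) Q_deriv(2) \<eta>(1)[unfolded at_I])
  then have e_lim: "(e \<longlongrightarrow> 0) (at t0)" by simp

  have near: "bp.near_problem (e t + \<bar>l - l0\<bar>) (B l t) (T t) (R t)" if "t \<in> I" for l t
  proof -
    interpret ct: coupled_extensions A "At t" "Bt t" "tr t" "P t" "Q t" "F t" "G t" "V t"
      by (rule coupled[OF that])
    have V_lin: "V t (c *\<^sub>C w) = c *\<^sub>C V t w" if "t \<in> I" for t c w
    proof -
      interpret cs: coupled_extensions A "At t" "Bt t" "tr t" "P t" "Q t" "F t" "G t" "V t"
        by (rule coupled[OF that])
      show ?thesis
        by (cases w) (simp add: scaleC_prod_def cs.V
            bounded_clinear_scaleC[OF self_adjoint_bdd_oper(1)[OF cs.FG(1)]]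
            bounded_clinear_scaleC[OF self_adjoint_bdd_oper(1)[OF cs.FG(2)]])
    qed
    have "clinear_on UNIV (B l t)"
    proof -
      have "B l t (x + y) = B l t x + B l t y" for x y
        by (simp add: B_def prod_eq_iff blinfun.add_right scaleC_prod_def scaleC_add_right algebra_simps)
      moreover have "B l t (c *\<^sub>C x) = c *\<^sub>C B l t x" for c x
        by (simp add: B_def V_lin[OF that] V_lin[OF \<open>t0 \<in> I\<close>] swap_diff swap_scaleC scaleC_scaleC
            complex_vs.scale_right_diff_distrib mult.commute)
      ultimately show ?thesis
        by (auto simp: clinear_on_def complex_vs.subspace_UNIV)
    qed
    moreover have "clinear_on ?D (T t)"
      using ct.T_clinear by (simp add: T_def)
    moreover have "clinear_on UNIV (R t)"
      using bounded_clinear_clinear[OF ct.R_bounded_clinear] by (simp add: R_def)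
    moreover have "R t (R t b) = R t b" for b
      using ct.R_idempotent by (simp add: R_def)
    moreover have "norm (B l t w) \<le> (e t + \<bar>l - l0\<bar>) * norm w" for w
    proof -
      have "norm (B l t w) \<le> norm (V t w - V t0 w) + \<bar>l - l0\<bar> * norm w"
        unfolding B_def
        using norm_triangle_ineq4[of "prod.swap (V t w - V t0 w)" "complex_of_real (l - l0) *\<^sub>C prod.swap w"]
        by (simp add: norm_swap norm_scaleC del: of_real_diff)
      also have "norm (V t w - V t0 w) \<le> norm (V t - V t0) * norm w"
        using norm_blinfun[of "V t - V t0" w] by (simp add: blinfun.diff_left)
      also have "norm (V t - V t0) * norm w \<le> e t * norm w"
        by (intro mult_right_mono) (simp_all add: e_def K_def \<eta>(3))
      finally show ?thesis by (simp add: distrib_right)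
    qed
    moreover have "norm (T t w - T t0 w) \<le> (e t + \<bar>l - l0\<bar>) * (norm w + norm (S w))" if "w \<in> ?D" for w
    proof -
      have "norm (T t w - T t0 w) \<le> \<eta> t * graph_norm2 (adj A) w"
        by (rule T_near[OF \<open>t \<in> I\<close> that])
      also have "\<dots> \<le> \<eta> t * (K * (norm w + norm (S w)))"
        unfolding K_def S_def by (intro mult_left_mono graph_norm2_le \<eta>(3))
      also have "\<dots> = (K * \<eta> t) * (norm w + norm (S w))" by simp
      also have "\<dots> \<le> (e t + \<bar>l - l0\<bar>) * (norm w + norm (S w))"
        by (intro mult_right_mono) (simp_all add: e_def)
      finally show ?thesis .
    qed
    moreover have "norm (R t b - R t0 b) \<le> (e t + \<bar>l - l0\<bar>) * norm b" for b
    proof -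
      have "R t b - R t0 b = ((P t - P t0) (fst b), (Q t - Q t0) (snd b))"
        by (simp add: R_def prod_eq_iff blinfun.diff_left)
      then have "norm (R t b - R t0 b) \<le> norm ((P t - P t0) (fst b)) + norm ((Q t - Q t0) (snd b))"
        by (simp only: norm_Pair_le)
      also have "\<dots> \<le> norm (P t - P t0) * norm b + norm (Q t - Q t0) * norm b"
        using norm_fst_le[of "fst b" "snd b"] norm_snd_le[of "snd b" "fst b"]
        by (intro add_mono order_trans[OF norm_blinfun] mult_left_mono) simp_all
      also have "\<dots> \<le> (e t + \<bar>l - l0\<bar>) * norm b"
        unfolding distrib_right[symmetric]
        by (intro mult_right_mono) (simp_all add: e_def K_def \<eta>(3))
      finally show ?thesis .
    qed
    ultimately show ?thesis unfolding bp.near_problem_def by blast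
  qed

  define M where "M l t = bp.schur_matrix (bp.perturbation (B l t) (T t) (R t))" for l t

  \<comment> \<open>Near the base point the perturbation is a contraction, so that \<open>M\<close> decides invertibility.\<close>

  obtain C where C: "0 < C" "\<And>\<epsilon> B T1 R1 z. 0 \<le> \<epsilon> \<Longrightarrow> \<epsilon> \<le> 1 \<Longrightarrow> bp.near_problem \<epsilon> B T1 R1 \<Longrightarrow>
      norm (bp.perturbation B T1 R1 z) \<le> C * \<epsilon> * norm z"
    using bp.perturbation_bound by blast
  have Spec_iff: "complex_of_real l \<in> Spec (?H t) \<longleftrightarrow> Determinant.det (M l t) = 0"
    if t: "t \<in> I" and small: "e t + \<bar>l - l0\<bar> < 1" "C * (e t + \<bar>l - l0\<bar>) < 1" for l t
  proof -
    interpret ct: coupled_extensions A "At t" "Bt t" "tr t" "P t" "Q t" "F t" "G t" "V t"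
      by (rule coupled[OF t])
    have SB: "S w + B l t w = maximal_op A (V t) l w" for w
      by (simp add: S_def B_def maximal_op_def swap_diff complex_vs.scale_left_diff_distrib)
    have q: "0 \<le> C * (e t + \<bar>l - l0\<bar>)"
      using C(1) e_nonneg[of t] by simp
    have bound: "norm (bp.perturbation (B l t) (T t) (R t) z) \<le> C * (e t + \<bar>l - l0\<bar>) * norm z" for z
      using small(1) e_nonneg[of t] by (intro C(2) near t) simp_all
    show ?thesis
    proof
      assume "Determinant.det (M l t) = 0"
      then obtain w where "w \<in> ?D" "w \<noteq> 0" "R t (T t w) = T t w" "S w + B l t w = 0"
        using bp.singular_imp_kernel[OF near[OF t] small(1) q small(2) bound] unfolding M_def by blast
      then show "complex_of_real l \<in> Spec (?H t)"
        using ct.kernel_imp_Spec[of w l] unfolding SB by (simp add: R_def T_def Nt_def)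
    next
      assume spec: "complex_of_real l \<in> Spec (?H t)"
      show "Determinant.det (M l t) = 0"
      proof (rule ccontr)
        assume "Determinant.det (M l t) \<noteq> 0"
        then obtain Z where "bounded_clinear Z"
          "\<And>f. Z f \<in> ?D \<and> R t (T t (Z f)) = T t (Z f) \<and> S (Z f) + B l t (Z f) = f"
          "\<And>w. w \<in> ?D \<Longrightarrow> R t (T t w) = T t w \<Longrightarrow> S w + B l t w = 0 \<Longrightarrow> w = 0"
          using bp.nonsingular_imp_inverse[OF near[OF t] small(1) q small(2) bound]
          unfolding M_def by blast
        then have "complex_of_real l \<notin> Spec (?H t)"
          using ct.inverse_imp_not_Spec[of Z l] unfolding SB by (simp add: R_def T_def Nt_def)
        with spec show False by blast
      qed
    qed
  qed
  have ev: "\<forall>\<^sub>F (l, t) in nhds (l0, t0). M l t \<in> carrier_mat g g \<and>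
      (complex_of_real l \<in> Spec (?H t) \<longleftrightarrow> Determinant.det (M l t) = 0)"
  proof -
    define \<delta> where "\<delta> = min (1/2) (1 / (2 * C))"
    have \<delta>: "0 < \<delta>" "\<delta> \<le> 1/2" "\<delta> \<le> 1 / (2 * C)"
      using C(1) by (simp_all add: \<delta>_def)
    have C\<delta>: "C * \<delta> \<le> 1/2"
      using mult_left_mono[OF \<delta>(3), of C] C(1) by simp
    have "\<forall>\<^sub>F t in nhds t0. t \<in> interior I"
      using I(3) by (intro eventually_nhds_in_open) auto
    moreover have "\<forall>\<^sub>F t in nhds t0. e t < \<delta>"
    proof -
      have "\<forall>\<^sub>F t in at t0. e t < \<delta>"
        by (rule order_tendstoD(2)[OF e_lim \<delta>(1)])
      then show ?thesis
        unfolding eventually_at_filter by eventually_elim (use e_t0 \<delta>(1) in auto)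
    qed
    ultimately have ev_t: "\<forall>\<^sub>F t in nhds t0. t \<in> I \<and> e t < \<delta>"
      by eventually_elim (use interior_subset in blast)
    have ev_l: "\<forall>\<^sub>F l in nhds l0. \<bar>l - l0\<bar> < \<delta>"
      using \<delta>(1) by (auto simp: eventually_nhds_metric dist_real_def)
    have "\<forall>\<^sub>F x in nhds l0 \<times>\<^sub>F nhds t0. \<bar>fst x - l0\<bar> < \<delta> \<and> snd x \<in> I \<and> e (snd x) < \<delta>"
      by (rule eventually_prodI[OF ev_l ev_t])
    then show ?thesis
      unfolding nhds_prod
    proof eventually_elim
      case (elim x)
      then have small: "e (snd x) + \<bar>fst x - l0\<bar> < 2 * \<delta>" by linarith
      have "C * (e (snd x) + \<bar>fst x - l0\<bar>) < C * (2 * \<delta>)"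
        using C(1) small by (intro mult_strict_left_mono) auto
      then show ?case
        using Spec_iff[of "snd x" "fst x"] elim small \<delta>(2) C\<delta>
        by (simp add: split_beta M_def bp.schur_matrix_carrier)
    qed
  qed

  have B0: "B l0 t0 w = 0" for w by (simp add: B_def swap_zero)
  have M0: "M l0 t0 = 0\<^sub>m g g"
    unfolding M_def
  proof (rule bp.schur_matrix_zero)
    have "bp.boundary_defect (T t0) (R t0) w = 0" for w
      by (simp only: bp.boundary_defect_def diff_self)
    then show "bp.perturbation (B l0 t0) (T t0) (R t0) z = 0" for z
      by (simp only: bp.perturbation_def B0 bounded_clinear_zero[OF bp.R] diff_self
          zero_prod_def[symmetric])
  qed

  have swap_linear: "bounded_linear (prod.swap :: 'h \<times> 'h \<Rightarrow> 'h \<times> 'h)"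
    by (rule bounded_clinear_bounded_linear[OF swap_bounded_clinear])
  have deriv_t: "((\<lambda>t. M l0 t $$ (j, i)) has_vector_derivative
      (cinner (ap tau (V' t0 (u i))) (u j)
        + Omega (map_prod (P' t0) (Q' t0) (T t0 (u i))) (T t0 (u j))
        + Omega (T t0 (u i)) (T' t0 (u j)))) (at t0)"
    if ij: "i < g" "j < g" for i j
  proof -
    have T': "((\<lambda>t. T t (u i)) has_vector_derivative T' t0 (u i)) (at t0)" if "i < g" for i
      using T_deriv[OF u(1)[OF that]] unfolding at_I .
    have "((\<lambda>t. prod.swap (V t (u i) - V t0 (u i))) has_vector_derivative
        prod.swap (V' t0 (u i) - 0)) (at t0)"
      by (rule bounded_linear.has_vector_derivative[OF swap_linear has_vector_derivative_diff[OF
            blinfun_apply_has_vector_derivative[OF V_deriv(1)] has_vector_derivative_const]])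
    moreover have "B l0 t (u i) = prod.swap (V t (u i) - V t0 (u i))" for t
      by (simp add: B_def)
    ultimately have B': "((\<lambda>t. B l0 t (u i)) has_vector_derivative ap tau (V' t0 (u i))) (at t0)"
      by (simp only: ap_tau diff_0_right)
    have "((\<lambda>t. (P t (fst b), Q t (snd b))) has_vector_derivative (P' t0 (fst b), Q' t0 (snd b))) (at t0)"
      for b
      by (rule has_vector_derivative_Pair[OF blinfun_apply_has_vector_derivative[OF P_deriv(1)]
            blinfun_apply_has_vector_derivative[OF Q_deriv(1)]])
    moreover have "map_prod p q b = (p (fst b), q (snd b))"
      for p q :: "'k \<times> 'k \<Rightarrow> 'k \<times> 'k" and b
      by (simp add: prod_eq_iff)
    ultimately have R': "((\<lambda>t. R t b) has_vector_derivative map_prod (P' t0) (Q' t0) b) (at t0)" for b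
      by (simp only: R_def)
    have main: "((\<lambda>t. M l0 t $$ (j, i)) has_vector_derivative
        (cinner (ap tau (V' t0 (u i))) (u j)
          + cinner (Jmap2 (map_prod (P' t0) (Q' t0) (T t0 (u i)))) (T t0 (u j))
          - cinner (Jmap2 (T' t0 (u i))) (T t0 (u j)))) (at t0)"
      unfolding M_def
    proof (rule bp.perturbation_has_derivative[where B = "B l0" and T\<^sub>1 = T and R\<^sub>1 = R and \<epsilon> = e])
      have "\<forall>\<^sub>F t in at t0. t \<in> interior I"
        using I(3) by (intro eventually_at_in_open') auto
      then show "\<forall>\<^sub>F t in at t0. bp.near_problem (e t) (B l0 t) (T t) (R t)"
      proof eventually_elim
        case (elim t)
        then have "t \<in> I" using interior_subset by blast
        then show ?case using near[of t l0] by simp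
      qed
      show "\<forall>\<^sub>F t in at t0. 0 \<le> e t" by (simp add: e_nonneg)
    qed (rule e_lim B0 B' T'[OF ij(1)] R' ij refl)+
    \<comment> \<open>The Green identity expresses \<open>Omega (T t v) (T t w)\<close> without the trace, so that it does not
      depend on \<open>t\<close>.\<close>
    have "((\<lambda>t. cinner (Jmap2 (T t (u i))) (T t (u j))) has_vector_derivative
        (cinner (Jmap2 (T t0 (u i))) (T' t0 (u j)) + cinner (Jmap2 (T' t0 (u i))) (T t0 (u j)))) (at t0)"
      by (rule bounded_bilinear.has_vector_derivative[OF bounded_bilinear_cinner
            bounded_linear.has_vector_derivative[OF
              bounded_clinear_bounded_linear[OF Jmap2_bounded_clinear] T'[OF ij(1)]] T'[OF ij(2)]])
    moreover have "((\<lambda>t. cinner (Jmap2 (T t (u i))) (T t (u j))) has_vector_derivative 0) (at t0)"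
    proof (rule has_vector_derivative_transform_within_open[where S = "interior I" and
          f = "\<lambda>_. cinner (Jmap2 (T t0 (u i))) (T t0 (u j))"])
      fix t assume "t \<in> interior I"
      then have "t \<in> {0..1}" using I(2) interior_subset by blast
      then have tr: "trace_op A (tr t)" "trace_op A (tr t0)"
        using traces \<open>t0 \<in> I\<close> I(2) by auto
      show "cinner (Jmap2 (T t0 (u i))) (T t0 (u j)) = cinner (Jmap2 (T t (u i))) (T t (u j))"
        unfolding Omega_Jmap2[symmetric] T_def
        by (simp only: Omega_trace[OF tr(1) u(1)[OF ij(1)] u(1)[OF ij(2)]]
            Omega_trace[OF tr(2) u(1)[OF ij(1)] u(1)[OF ij(2)]])
    qed (rule has_vector_derivative_const open_interior I(3))+
    ultimately have "cinner (Jmap2 (T t0 (u i))) (T' t0 (u j))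
        + cinner (Jmap2 (T' t0 (u i))) (T t0 (u j)) = 0"
      by (rule vector_derivative_unique_at)
    then have "cinner (Jmap2 (T t0 (u i))) (T' t0 (u j)) = - cinner (Jmap2 (T' t0 (u i))) (T t0 (u j))"
      by (simp add: eq_neg_iff_add_eq_0)
    then show ?thesis using main by (simp add: Omega_Jmap2)
  qed

  have deriv_l: "((\<lambda>l. M l t0 $$ (j, i)) has_vector_derivative - cinner (ap tau (u i)) (u j)) (at l0)"
    if ij: "i < g" "j < g" for i j
  proof -
    have "((\<lambda>l. - ((l - l0) *\<^sub>R prod.swap (u i))) has_vector_derivative - ((1 - 0) *\<^sub>R prod.swap (u i))) (at l0)"
      by (intro has_vector_derivative_minus has_vector_derivative_diff has_vector_derivative_id
          has_vector_derivative_const bounded_linear.has_vector_derivative[OF bounded_linear_scaleR_left])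
    then have B': "((\<lambda>l. B l t0 (u i)) has_vector_derivative - prod.swap (u i)) (at l0)"
      by (simp add: B_def scaleR_eq_scaleC swap_zero del: of_real_diff)
    have "((\<lambda>l. \<bar>l - l0\<bar>) \<longlongrightarrow> \<bar>l0 - l0\<bar>) (at l0)"
      by (intro tendsto_rabs tendsto_diff tendsto_const tendsto_ident_at)
    then have lim: "((\<lambda>l. \<bar>l - l0\<bar>) \<longlongrightarrow> 0) (at l0)" by simp
    have near': "bp.near_problem \<bar>l - l0\<bar> (B l t0) (T t0) (R t0)" for l
      using near[OF \<open>t0 \<in> I\<close>, of l] by (simp add: e_t0)
    have "((\<lambda>l. M l t0 $$ (j, i)) has_vector_derivative
        (cinner (- prod.swap (u i)) (u j) + cinner (Jmap2 0) (T t0 (u j)) - cinner (Jmap2 0) (T t0 (u j))))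
        (at l0)"
      unfolding M_def
      by (rule bp.perturbation_has_derivative[where B = "\<lambda>l. B l t0" and T\<^sub>1 = "\<lambda>_. T t0"
            and R\<^sub>1 = "\<lambda>_. R t0" and \<epsilon> = "\<lambda>l. \<bar>l - l0\<bar>"])
        (rule lim B0 B' ij has_vector_derivative_const refl always_eventually allI near' abs_ge_zero)+
    then show ?thesis by (simp add: ap_tau cinner_minus_left)
  qed

  show ?thesis
    by (intro exI[of _ M] conjI allI impI ev M0 deriv_t deriv_l)
qed

end
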